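(* Let $p,m,q$ be positive integers with $p>m\ge q$, and let $A\sim W_p(m,I_p)$ and $B\sim W_p(q,I_p)$ be independent central Wishart matrices. Let $\lambda_{\max}$ denote the largest finite generalized root of the pair $(B,A)$. Then $$\lambda_{\max}\stackrel{d}{=}\lambda_{\max}\left\{W_m(q,I_m)\,W_m(p,I_m)^{-1}\right\},$$ where the right-hand side is understood as the largest nonzero eigenvalue of the product of two independent Wishart matrices with the indicated distributions, the second one being inverted. Equivalently, $$\lambda_{\max}\stackrel{d}{=}\lambda_{\max}\left\{W_q(m,I_q)\,W_q(p-m+q,I_q)^{-1}\right\},$$ where again the two Wishart matrices appearing on the right-hand side are independent. (Both distributional identities are asserted.)
   Context: For positive integers $d,r$ and a positive definite $d\times d$ matrix $\Sigma$, $W_d(r,\Sigma)$ denotes a $d\times d$ central Wishart matrix with $r$ degrees of freedom and scale matrix $\Sigma$, i.e. a random matrix distributed as $GG^T$ where $G\in\mathbb R^{d\times r}$ has independent $N_d(0,\Sigma)$ columns; $r<d$ is allowed, in which case the matrix is singular. $\stackrel{d}{=}$ denotes equality in distribution. For a square matrix $M$ whose eigenvalues are real, $\lambda_{\max}(M)$ (or $\lambda_{\max}\{M\}$) denotes its largest eigenvalue. Finite generalized roots: since $p>m$, $A$ is singular, and almost surely has rank $m$. Write its rank-$m$ spectral decomposition as $A=HLH^T$, where $H\in\mathbb R^{p\times m}$ satisfies $H^TH=I_m$ and $L$ is an $m\times m$ diagonal matrix with positive diagonal entries. The finite (generalized) roots of the pair $(B,A)$ are defined as the positive eigenvalues of the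 $m\times m$ symmetric positive semidefinite matrix $$K=L^{-1/2}H^TBHL^{-1/2}.$$ (Equivalently, they are the nonzero eigenvalues of $BA^+$, where $A^+$ is the Moore--Penrose inverse of $A$.) The largest of them is denoted $\lambda_{\max}$. *)

theory Defs
  imports "HOL-Probability.Probability"
begin

text \<open>
  A \<open>d \<times> n\<close> real matrix is an element of \<open>real ^ 'n ^ 'd\<close> with \<open>CARD('d) = d\<close> and
  \<open>CARD('n) = n\<close>. Degrees of freedom are plain natural numbers.
\<close>

text \<open>The law \<open>N(0, \<Sigma>)\<close>, meaningful only for positive definite \<open>\<Sigma>\<close>.\<close>

definition centered_normal :: "real ^ 'd ^ 'd \<Rightarrow> (real ^ 'd) measure" where
  "centered_normal \<Sigma> = density lborel
     (\<lambda>x. ennreal (exp (- (x \<bullet> (matrix_inv \<Sigma> *v x)) / 2)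
                     / sqrt ((2 * pi) ^ CARD('d) * det \<Sigma>)))"

text \<open>
  The law of \<open>G G\<^sup>T\<close>, where \<open>G\<close> is the matrix with the \<open>r\<close> independent columns
  \<open>g 0, \<dots>, g (r - 1)\<close>, that is, \<open>G\<^sub>i\<^sub>k = g k $ i\<close>. The case \<open>r < d\<close> is included.
\<close>

definition wishart :: "nat \<Rightarrow> real ^ 'd ^ 'd \<Rightarrow> (real ^ 'd ^ 'd) measure" where
  "wishart r \<Sigma> = distr (\<Pi>\<^sub>M k\<in>{..<r}. centered_normal \<Sigma>) borel
     (\<lambda>g. \<chi> i j. \<Sum>k<r. g k $ i * g k $ j)"

definition real_eigenvalue :: "real ^ 'n ^ 'n \<Rightarrow> real \<Rightarrow> bool" where
  "real_eigenvalue M \<mu> \<longleftrightarrow> (\<exists>v. v \<noteq> 0 \<and> M *v v = \<mu> *\<^sub>R v)"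

text \<open>
  A real matrix has finitely many real eigenvalues, so \<^const>\<open>Max\<close> is the genuine maximum
  below whenever the set is nonempty.
\<close>

definition lambda_max :: "real ^ 'n ^ 'n \<Rightarrow> real" where
  "lambda_max M = Max {\<mu>. real_eigenvalue M \<mu>}"

definition largest_nonzero_eigenvalue :: "real ^ 'n ^ 'n \<Rightarrow> real" where
  "largest_nonzero_eigenvalue M = Max {\<mu>. real_eigenvalue M \<mu> \<and> \<mu> \<noteq> 0}"

definition diagonal_of :: "real ^ 'm \<Rightarrow> real ^ 'm ^ 'm" where
  "diagonal_of l = (\<chi> i j. if i = j then l $ i else 0)"

text \<open>\<open>A = H L H\<^sup>T\<close> with \<open>L = diagonal_of l\<close>; the rank of \<open>A\<close> is then \<open>CARD('m)\<close>.\<close>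

definition spectral_decomposition ::
    "real ^ 'p ^ 'p \<Rightarrow> real ^ 'm ^ 'p \<Rightarrow> real ^ 'm \<Rightarrow> bool" where
  "spectral_decomposition A H l \<longleftrightarrow>
     transpose H ** H = mat 1 \<and> (\<forall>i. 0 < l $ i) \<and>
     A = H ** diagonal_of l ** transpose H"

text \<open>\<open>L\<^sup>-\<^sup>1\<^sup>/\<^sup>2 H\<^sup>T B H L\<^sup>-\<^sup>1\<^sup>/\<^sup>2\<close>\<close>

definition reduced_matrix ::
    "real ^ 'p ^ 'p \<Rightarrow> real ^ 'm ^ 'p \<Rightarrow> real ^ 'm \<Rightarrow> real ^ 'm ^ 'm" where
  "reduced_matrix B H l =
     (let R = diagonal_of (\<chi> i. 1 / sqrt (l $ i)) in R ** transpose H ** B ** H ** R)"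

text \<open>
  The finite roots of the pair \<open>(B, A)\<close> when \<open>A\<close> has rank \<open>CARD('m)\<close>; the type argument
  supplies the rank. They do not depend on the decomposition: two decompositions of the
  same \<open>A\<close> yield orthogonally similar reduced matrices.
\<close>

definition finite_roots ::
    "'m::finite itself \<Rightarrow> real ^ 'p ^ 'p \<Rightarrow> real ^ 'p ^ 'p \<Rightarrow> real set" where
  "finite_roots _ B A =
     {\<mu>. 0 < \<mu> \<and> (\<exists>(H :: real ^ 'm ^ 'p) l. spectral_decomposition A H l \<and>
                    real_eigenvalue (reduced_matrix B H l) \<mu>)}"

definition largest_finite_root ::
    "'m::finite itself \<Rightarrow> real ^ 'p ^ 'p \<Rightarrow> real ^ 'p ^ 'p \<Rightarrow> real" where
  "largest_finite_root m B A = Max (finite_roots m B A)"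

text \<open>
  Equality of the two push-forwards alone would not suffice: \<^const>\<open>distr\<close> is only
  meaningful for measurable functions.
\<close>

definition eq_in_distribution ::
    "'a measure \<Rightarrow> ('a \<Rightarrow> real) \<Rightarrow> 'b measure \<Rightarrow> ('b \<Rightarrow> real) \<Rightarrow> bool" where
  "eq_in_distribution M X N Y \<longleftrightarrow>
     X \<in> borel_measurable M \<and> Y \<in> borel_measurable N \<and>
     distr M borel X = distr N borel Y"

text \<open>\<open>U\<close> and \<open>V\<close> are independent random matrices on \<open>N\<close> with laws \<open>P\<close> and \<open>Q\<close>.\<close>

definition independent_with_laws ::
    "'a measure \<Rightarrow> ('a \<Rightarrow> real ^ 'd ^ 'd) \<Rightarrow> (real ^ 'd ^ 'd) measure \<Rightarrow>
     ('a \<Rightarrow> real ^ 'd ^ 'd) \<Rightarrow> (real ^ 'd ^ 'd) measure \<Rightarrow> bool" where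
  "independent_with_laws N U P V Q \<longleftrightarrow>
     prob_space N \<and> prob_space.indep_var N borel U borel V \<and>
     distr N borel U = P \<and> distr N borel V = Q"

end

theory Submission
  imports Defs
begin

text \<open>Write \<open>A = X X\<^sup>T\<close> and \<open>B = Y Y\<^sup>T\<close> with independent standard Gaussian matrices \<open>X\<close>
  (\<open>p \<times> m\<close>) and \<open>Y\<close> (\<open>p \<times> q\<close>). Both identities are obtained by conditioning on one Gaussian
  matrix and reducing to linear algebra in which that matrix is fixed.

  First identity. Almost surely \<open>X\<close> has full column rank (\<open>AE_gaussian_full_column_rank\<close>), so
  \<open>X = H S\<close> where \<open>H\<close> has orthonormal columns and \<open>S\<close> is the positive square root of
  \<open>V = X\<^sup>T X\<close>. The finite roots of \<open>(B, A)\<close> are then the \<open>\<mu> > 0\<close> for which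
  \<open>H\<^sup>T B H t = \<mu> V t\<close> has a solution \<open>t \<noteq> 0\<close> (\<open>finite_roots_eq_pencil_eigenvalues\<close>), that is, the
  nonzero eigenvalues of \<open>U V\<^sup>-\<^sup>1\<close> with \<open>U = (H\<^sup>T Y) (H\<^sup>T Y)\<^sup>T\<close>. For fixed \<open>X\<close> the matrix
  \<open>H\<^sup>T Y\<close> is again standard Gaussian, now \<open>m \<times> q\<close>, and its law does not involve \<open>X\<close>. So \<open>U\<close> may be
  replaced by a \<open>W\<^sub>m(q, I)\<close> matrix independent of \<open>V\<close>, and \<open>V\<close> is \<open>W\<^sub>m(p, I)\<close> because the rows
  of a Gaussian matrix are as good as its columns (\<open>gaussian_family_mixing\<close>). As \<open>X\<close> is fixed,
  \<open>H\<close> need not be chosen measurably.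

  Second identity. Now write \<open>U = Z Z\<^sup>T\<close> with \<open>Z\<close> Gaussian \<open>m \<times> q\<close>, fix \<open>Z = Q T\<close> with orthonormal
  columns in \<open>Q\<close> and \<open>T\<close> the positive square root of \<open>Z\<^sup>T Z\<close>, and extend the columns of \<open>Q\<close> to an
  orthonormal basis \<open>w\<^sub>c\<close> of \<open>\<real>\<^sup>m\<close>. The vectors \<open>X w\<^sub>c\<close> are independent standard Gaussian vectors in
  \<open>\<real>\<^sup>p\<close>. Let \<open>E\<close> collect those with \<open>w\<^sub>c\<close> a column of \<open>Q\<close> and \<open>D\<close> the \<open>m - q\<close> others. If \<open>P\<close> is the
  projection onto the orthogonal complement of the columns of \<open>D\<close>, the Schur complement
  \<open>W = E\<^sup>T P E\<close> is the inverse of \<open>Q\<^sup>T V\<^sup>-\<^sup>1 Q\<close> (\<open>schur_complement_inverse\<close>). Given \<open>D\<close>, expanding in an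
  orthonormal basis of a space of dimension \<open>p - (m - q)\<close> shows that \<open>W\<close> is
  \<open>W\<^sub>q(p - m + q, I)\<close>. Finally the nonzero eigenvalues of \<open>Z Z\<^sup>T V\<^sup>-\<^sup>1\<close> are those of
  \<open>T W\<^sup>-\<^sup>1 T\<close>, hence those of \<open>Z\<^sup>T Z W\<^sup>-\<^sup>1\<close> (\<open>pencil_eigenvalue_transfer\<close>), and \<open>Z\<^sup>T Z\<close> is
  \<open>W\<^sub>q(m, I)\<close>.

  Equality in distribution also asks for Borel measurability on the whole space, including
  the null set where ranks degenerate. The sets where the largest root exceeds a level
  are projections of \<open>F\<^sub>\<sigma>\<close> sets in Euclidean spaces, and such projections are again \<open>F\<^sub>\<sigma>\<close>.\<close>

section \<open>Orthonormal families\<close>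

definition orthonormal_family :: "'k set \<Rightarrow> ('k \<Rightarrow> real ^ 'd) \<Rightarrow> bool" where
  "orthonormal_family K u \<longleftrightarrow> (\<forall>i\<in>K. \<forall>j\<in>K. u i \<bullet> u j = (if i = j then 1 else 0))"

lemma orthonormal_family_inj: "orthonormal_family K u \<Longrightarrow> inj_on u K"
  unfolding orthonormal_family_def inj_on_def by (metis zero_neq_one)

lemma orthonormal_family_of_set:
  fixes B :: "(real ^ 'd) set"
  assumes "pairwise orthogonal B" and "\<And>b. b \<in> B \<Longrightarrow> norm b = 1"
    and "inj_on h K" and "h ` K \<subseteq> B"
  shows "orthonormal_family K h"
  unfolding orthonormal_family_def
proof (intro ballI)
  fix i j assume ij: "i \<in> K" "j \<in> K"
  then have B: "h i \<in> B" "h j \<in> B" using assms(4) by auto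
  show "h i \<bullet> h j = (if i = j then 1 else 0)"
  proof (cases "i = j")
    case True then show ?thesis using assms(2)[OF B(1)] by (simp add: norm_eq_1)
  next
    case False
    then have "h i \<noteq> h j" using assms(3) ij by (auto dest: inj_onD)
    then show ?thesis using assms(1) B False by (auto simp: pairwise_def orthogonal_def)
  qed
qed

text \<open>The given vectors are completed by an orthonormal basis of the orthogonal complement of their
  span. The map \<open>\<sigma>\<close> records which coordinates of the full basis they occupy.\<close>
lemma orthonormal_family_extension:
  fixes u :: "'k \<Rightarrow> real ^ 'd"
  assumes K: "finite K" and u: "orthonormal_family K u"
  obtains \<sigma> w where "inj_on \<sigma> K" "orthonormal_family (UNIV :: 'd set) w"
    "\<And>k. k \<in> K \<Longrightarrow> w (\<sigma> k) = u k"
proof -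
  define T where "T = {y \<in> UNIV. \<forall>x\<in>span (u ` K). orthogonal x y}"
  have subT: "subspace T"
    unfolding T_def by (auto simp: subspace_def orthogonal_clauses)
  obtain B where B: "B \<subseteq> T" "pairwise orthogonal B" "\<And>x. x \<in> B \<Longrightarrow> norm x = 1"
    "independent B" "card B = dim T" "span B = T"
    using orthonormal_basis_subspace[OF subT] by metis
  have norm_u: "norm (u k) = 1" if "k \<in> K" for k
    using u that by (simp add: orthonormal_family_def norm_eq_1)
  have orth_u: "pairwise orthogonal (u ` K)"
    using u by (auto simp: pairwise_def orthonormal_family_def orthogonal_def)
  have cross: "orthogonal x y" if "x \<in> u ` K" "y \<in> B" for x y
    using that B(1) by (auto simp: T_def span_base)
  have finB: "finite B" using B(4) by (rule independent_imp_finite)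
  let ?E = "u ` K \<union> B"
  have orthE: "pairwise orthogonal ?E"
    using orth_u B(2) cross unfolding pairwise_def by (metis Un_iff orthogonal_commute)
  have normE: "norm x = 1" if "x \<in> ?E" for x using that norm_u B(3) by auto
  have "independent (u ` K)"
    using orth_u norm_u by (intro pairwise_orthogonal_independent) (auto, metis norm_zero zero_neq_one)
  then have "dim (span (u ` K)) = card (u ` K)" by (simp add: dim_eq_card_independent)
  moreover have "dim T + dim (span (u ` K)) = dim (UNIV :: (real ^ 'd) set)"
    unfolding T_def
    by (rule dim_subspace_orthogonal_to_vectors[OF subspace_span subspace_UNIV subset_UNIV])
  moreover have "u ` K \<inter> B = {}"
  proof -
    have False if "x \<in> u ` K" "x \<in> B" for x
      using cross[OF that] B(3)[OF that(2)] by (simp add: orthogonal_def norm_eq_1)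
    then show ?thesis by blast
  qed
  ultimately have "card ?E = CARD('d)"
    using K finB B(5) by (simp add: card_Un_disjoint)
  then obtain h where h: "bij_betw h (UNIV :: 'd set) ?E"
    using K finB by (metis finite_Un finite_imageI finite_same_card_bij finite_class.finite_UNIV)
  show thesis
  proof
    show "orthonormal_family UNIV h"
      using h by (intro orthonormal_family_of_set[OF orthE normE]) (auto simp: bij_betw_def)
    show "inj_on (inv_into UNIV h \<circ> u) K"
      using h orthonormal_family_inj[OF u]
      by (intro comp_inj_on inj_on_inv_into) (auto simp: bij_betw_def)
    show "h ((inv_into UNIV h \<circ> u) k) = u k" if "k \<in> K" for k
      using h that by (auto simp: bij_betw_def intro!: f_inv_into_f)
  qed
qed

text \<open>The basis is indexed by natural numbers because the dimension of the subspace need not be the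
  cardinality of a type at hand.\<close>
lemma subspace_orthonormal_family:
  fixes T :: "(real ^ 'd) set"
  assumes "subspace T"
  obtains n :: "nat \<Rightarrow> real ^ 'd" where "orthonormal_family {..<dim T} n"
    "\<And>k. k < dim T \<Longrightarrow> n k \<in> T" "\<And>x. x \<in> T \<Longrightarrow> (\<Sum>k<dim T. (n k \<bullet> x) *\<^sub>R n k) = x"
proof -
  obtain B where B: "B \<subseteq> T" "pairwise orthogonal B" "\<And>x. x \<in> B \<Longrightarrow> norm x = 1"
    "independent B" "card B = dim T" "span B = T"
    using orthonormal_basis_subspace[OF assms] by metis
  have finB: "finite B" using B(4) by (rule independent_imp_finite)
  obtain n where n: "bij_betw n {..<dim T} B"
    using finB B(5) by (metis finite_lessThan card_lessThan finite_same_card_bij)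
  have on: "orthonormal_family {..<dim T} n"
    using n by (intro orthonormal_family_of_set[OF B(2,3)]) (auto simp: bij_betw_def)
  show thesis
  proof
    show "n k \<in> T" if "k < dim T" for k using n B(1) that by (auto simp: bij_betw_def)
    fix x assume x: "x \<in> T"
    let ?y = "x - (\<Sum>k<dim T. (n k \<bullet> x) *\<^sub>R n k)"
    have "(\<Sum>k<dim T. (n k \<bullet> x) *\<^sub>R n k) \<in> T"
      using assms \<open>\<And>k. k < dim T \<Longrightarrow> n k \<in> T\<close> by (intro subspace_sum subspace_scale) auto
    then have yT: "?y \<in> span B" using x assms B(6) by (simp add: subspace_diff)
    have "orthogonal ?y b" if bB: "b \<in> B" for b
    proof -
      obtain l where l: "l < dim T" "b = n l" using n bB unfolding bij_betw_def by blast
      have "(\<Sum>k<dim T. (n k \<bullet> x) * (n k \<bullet> n l)) = (\<Sum>k<dim T. if k = l then n k \<bullet> x else 0)"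
        using on l by (intro sum.cong) (auto simp: orthonormal_family_def)
      then show ?thesis
        using l by (simp add: orthogonal_def inner_diff_left inner_sum_left inner_commute[of x])
    qed
    then have "orthogonal ?y ?y" by (rule orthogonal_to_span[OF yT])
    then show "(\<Sum>k<dim T. (n k \<bullet> x) *\<^sub>R n k) = x" by (simp add: orthogonal_def)
  qed (fact on)
qed

section \<open>The spectral theorem for real symmetric matrices\<close>

text \<open>A maximiser \<open>v\<close> of the Rayleigh quotient on the unit sphere of \<open>S\<close> is an eigenvector. The
  residual \<open>w = f v - c v\<close> is orthogonal to \<open>v\<close>, and a nonzero \<open>w\<close> would be a direction
  in which the quotient increases to first order.\<close>
lemma selfadjoint_eigenvector_exists:
  fixes f :: "'a::euclidean_space \<Rightarrow> 'a"
  assumes lin: "linear f" and sa: "\<And>x y. f x \<bullet> y = x \<bullet> f y"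
    and S: "subspace S" "f ` S \<subseteq> S" "S \<noteq> {0}"
  obtains v c where "v \<in> S" "norm v = 1" "f v = c *\<^sub>R v"
proof -
  interpret f: linear f by (fact lin)
  have cont: "continuous_on A (\<lambda>x. x \<bullet> f x)" for A
    using lin by (intro continuous_intros linear_continuous_on linear_conv_bounded_linear[THEN iffD1])
  have cpt: "compact (S \<inter> sphere 0 1)"
    using S(1) closed_subspace by (intro closed_Int_compact) auto
  obtain s where s: "s \<in> S" "s \<noteq> 0" using S(1,3) subspace_0 by blast
  then have "(1 / norm s) *\<^sub>R s \<in> S \<inter> sphere 0 1" using S(1) by (simp add: subspace_scale)
  then obtain v where v: "v \<in> S" "norm v = 1"
    and max: "\<And>x. x \<in> S \<Longrightarrow> norm x = 1 \<Longrightarrow> x \<bullet> f x \<le> v \<bullet> f v"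
    using continuous_attains_sup[OF cpt _ cont] by (fastforce simp: dist_norm)
  define c where "c = v \<bullet> f v"
  have le: "x \<bullet> f x \<le> c * (x \<bullet> x)" if "x \<in> S" for x
  proof (cases "x = 0")
    case True then show ?thesis by (simp add: f.zero)
  next
    case False
    let ?y = "(1 / norm x) *\<^sub>R x"
    have "?y \<bullet> f ?y \<le> c"
      unfolding c_def using that False S(1) by (intro max) (auto simp: subspace_scale)
    then have "(x \<bullet> f x) / (x \<bullet> x) \<le> c"
      by (simp add: f.scaleR dot_square_norm power2_eq_square)
    then show ?thesis using False by (simp add: pos_divide_le_eq)
  qed
  define w where "w = f v - c *\<^sub>R v"
  have wS: "w \<in> S" unfolding w_def using S v by (intro subspace_diff subspace_scale) auto
  have vv: "v \<bullet> v = 1" using v(2) by (simp add: norm_eq_1)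
  have wv: "w \<bullet> v = 0" by (simp add: w_def inner_diff_left c_def vv inner_commute[of "f v"])
  have wfv: "w \<bullet> f v = w \<bullet> w"
  proof -
    have "w \<bullet> w = w \<bullet> (f v - c *\<^sub>R v)" by (subst (2) w_def) simp
    then show ?thesis using wv by (simp add: inner_diff_right)
  qed
  define b where "b = c * (w \<bullet> w) - w \<bullet> f w"
  (* maximality of the Rayleigh quotient at v, tested on v + t w *)
  have quad: "2 * t * (w \<bullet> w) \<le> t\<^sup>2 * b" for t
  proof -
    have "(v + t *\<^sub>R w) \<bullet> f (v + t *\<^sub>R w) \<le> c * ((v + t *\<^sub>R w) \<bullet> (v + t *\<^sub>R w))"
      using v wS S(1) by (intro le subspace_add subspace_scale)
    moreover have "v \<bullet> f w = w \<bullet> f v" using sa[of v w] by (simp add: inner_commute)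
    ultimately show ?thesis using wv wfv vv
      by (simp add: f.add f.scaleR inner_add_left inner_add_right inner_commute[of v w]
          c_def[symmetric] b_def power2_eq_square algebra_simps)
  qed
  have "w \<bullet> w = 0"
  proof (rule ccontr)
    assume "w \<bullet> w \<noteq> 0"
    then have pos: "0 < w \<bullet> w" by simp
    have "b > 0" using quad[of 1] pos by (simp del: inner_gt_zero_iff)
    (* t = |w|^2 / b minimises t^2 b - 2 t |w|^2, where it is negative *)
    have "2 * (w \<bullet> w / b) * (w \<bullet> w) \<le> (w \<bullet> w / b)\<^sup>2 * b" by (rule quad)
    then have "2 * ((w \<bullet> w)\<^sup>2 / b) \<le> (w \<bullet> w)\<^sup>2 / b"
      using \<open>b > 0\<close> by (simp add: power2_eq_square)
    then show False using pos \<open>b > 0\<close> by (simp add: divide_simps)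
  qed
  then have "f v = c *\<^sub>R v" by (simp add: w_def)
  with v show thesis using that by blast
qed

text \<open>Inside an invariant subspace the orthogonal complement of an eigenvector is again invariant,
  so eigenvectors can be split off one at a time.\<close>
lemma selfadjoint_orthonormal_eigenbasis:
  fixes f :: "'a::euclidean_space \<Rightarrow> 'a"
  assumes lin: "linear f" and sa: "\<And>x y. f x \<bullet> y = x \<bullet> f y"
    and "subspace S" "f ` S \<subseteq> S"
  shows "\<exists>B\<subseteq>S. finite B \<and> card B = dim S \<and> pairwise orthogonal B \<and>
    (\<forall>b\<in>B. norm b = 1 \<and> (\<exists>c. f b = c *\<^sub>R b))"
  using assms(3,4)
proof (induction "dim S" arbitrary: S rule: less_induct)
  case less
  show ?case
  proof (cases "S = {0}")
    case True
    then show ?thesis by (intro exI[of _ "{}"]) auto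
  next
    case False
    obtain v c where v: "v \<in> S" "norm v = 1" "f v = c *\<^sub>R v"
      by (rule selfadjoint_eigenvector_exists[OF lin sa less.prems False])
    define T where "T = {y \<in> S. \<forall>x\<in>span {v}. orthogonal x y}"
    have T_eq: "T = {y \<in> S. v \<bullet> y = 0}"
      unfolding T_def by (auto simp: span_singleton orthogonal_def)
    have subT: "subspace T"
      using less.prems(1) unfolding T_eq subspace_def by (auto simp: inner_add_right)
    have dimT: "dim T + dim (span {v}) = dim S"
      unfolding T_def using v(1) less.prems(1)
      by (intro dim_subspace_orthogonal_to_vectors span_minimal) auto
    have "v \<noteq> 0" using v(2) by auto
    then have dimv: "dim (span {v}) = 1" by (simp add: dim_insert)
    have fT: "f ` T \<subseteq> T"
    proof
      fix z assume "z \<in> f ` T"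
      then obtain y where y: "z = f y" "y \<in> S" "v \<bullet> y = 0" unfolding T_eq by auto
      have "v \<bullet> f y = 0" using sa[of v y] v(3) y(3) by simp
      then show "z \<in> T" using y less.prems(2) unfolding T_eq by auto
    qed
    have "dim T < dim S" using dimT dimv by linarith
    from less.hyps[OF this subT fT] obtain B where B: "B \<subseteq> T" "finite B" "card B = dim T"
      "pairwise orthogonal B" "\<forall>b\<in>B. norm b = 1 \<and> (\<exists>c. f b = c *\<^sub>R b)" by blast
    have "v \<notin> B" using B(1) \<open>v \<noteq> 0\<close> unfolding T_eq by auto
    have "insert v B \<subseteq> S" using B(1) v(1) unfolding T_eq by auto
    moreover have "card (insert v B) = dim S" using B(2,3) \<open>v \<notin> B\<close> dimT dimv by simp
    moreover have "pairwise orthogonal (insert v B)"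
      using B(1,4) unfolding T_eq pairwise_insert orthogonal_def by (auto simp: inner_commute)
    ultimately show ?thesis using B v by (intro exI[of _ "insert v B"]) auto
  qed
qed

lemma transpose_diagonal_of [simp]: "transpose (diagonal_of l) = diagonal_of l"
  by (auto simp: diagonal_of_def transpose_def vec_eq_iff)

lemma diagonal_of_mult_vec: "(diagonal_of l *v v) $ i = l $ i * v $ i"
proof -
  have "(diagonal_of l *v v) $ i = (\<Sum>j\<in>UNIV. if j = i then l $ j * v $ j else 0)"
    unfolding diagonal_of_def matrix_vector_mult_def vec_lambda_beta by (rule sum.cong) auto
  then show ?thesis by simp
qed

lemma diagonal_of_mult: "diagonal_of l ** diagonal_of k = diagonal_of (\<chi> i. l $ i * k $ i)"
  by (simp add: matrix_eq vec_eq_iff matrix_vector_mul_assoc[symmetric] diagonal_of_mult_vec mult.assoc)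

lemma diagonal_of_one: "diagonal_of (\<chi> i. 1) = mat 1"
  by (auto simp: diagonal_of_def mat_def vec_eq_iff)

theorem symmetric_matrix_diagonalization:
  fixes V :: "real ^ 'n ^ 'n"
  assumes sym: "transpose V = V"
  obtains Q :: "real ^ 'n ^ 'n" and l where "transpose Q ** Q = mat 1" "Q ** transpose Q = mat 1"
    "V = Q ** diagonal_of l ** transpose Q"
proof -
  have sa: "(V *v x) \<bullet> y = x \<bullet> (V *v y)" for x y
    using sym by (metis dot_lmul_matrix transpose_matrix_vector inner_commute)
  obtain B where B: "finite B" "card B = CARD('n)" "pairwise orthogonal B"
    "\<And>b. b \<in> B \<Longrightarrow> norm b = 1" "\<And>b. b \<in> B \<Longrightarrow> \<exists>c. V *v b = c *\<^sub>R b"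
    using selfadjoint_orthonormal_eigenbasis[OF matrix_vector_mul_linear[of V] sa subspace_UNIV]
    by auto
  obtain h where h: "bij_betw h (UNIV :: 'n set) B"
    using B(1,2) by (metis finite_same_card_bij finite_class.finite_UNIV)
  have on: "orthonormal_family UNIV h"
    using h by (intro orthonormal_family_of_set[OF B(3,4)]) (auto simp: bij_betw_def)
  have "\<exists>c. V *v h i = c *\<^sub>R h i" for i using h B(5) by (auto simp: bij_betw_def)
  then obtain c where c: "\<And>i. V *v h i = c i *\<^sub>R h i" by metis
  define Q where "Q = (\<chi> i j. h j $ i)"
  have QQ: "transpose Q ** Q = mat 1"
    using on by (simp add: vec_eq_iff matrix_matrix_mult_def transpose_def Q_def mat_def
        orthonormal_family_def inner_vec_def)
  then have QQ': "Q ** transpose Q = mat 1" by (simp add: matrix_left_right_inverse)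
  have "(V ** Q) $ i $ j = (Q ** diagonal_of (\<chi> i. c i)) $ i $ j" for i j
  proof -
    have "(V ** Q) $ i $ j = (V *v h j) $ i"
      by (simp add: matrix_matrix_mult_def matrix_vector_mult_def Q_def)
    also have "\<dots> = c j * h j $ i" by (simp add: c)
    finally show ?thesis
      by (simp add: matrix_matrix_mult_def diagonal_of_def Q_def if_distrib cong: if_cong)
  qed
  then have "V ** Q = Q ** diagonal_of (\<chi> i. c i)" by (simp add: vec_eq_iff)
  then have "V = Q ** diagonal_of (\<chi> i. c i) ** transpose Q"
    by (metis QQ' matrix_mul_assoc matrix_mul_rid)
  then show thesis using that QQ QQ' by metis
qed

section \<open>Gram matrices and polar decomposition\<close>

declare transpose_matrix_vector [simp del]

lemma inner_transpose: "(transpose M *v x) \<bullet> y = x \<bullet> (M *v y)" for M :: "real ^ 'n ^ 'm"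
  by (simp add: dot_lmul_matrix transpose_matrix_vector)

text \<open>The quadratic form of \<open>X\<^sup>T X\<close> is \<open>|X v|\<^sup>2\<close>.\<close>
lemma gram_pos:
  fixes X :: "real ^ 'm ^ 'p"
  assumes inj: "\<And>v. X *v v = 0 \<Longrightarrow> v = 0" and "v \<noteq> 0"
  shows "0 < v \<bullet> ((transpose X ** X) *v v)"
proof -
  have "v \<bullet> ((transpose X ** X) *v v) = (X *v v) \<bullet> (X *v v)"
    by (simp add: matrix_vector_mul_assoc[symmetric] inner_commute[of v] inner_transpose)
  then show ?thesis using assms by auto
qed

lemma matrix_mul_cancel_left: "A ** B = mat 1 \<Longrightarrow> A ** (B ** C) = C"
  for A :: "real ^ 'n ^ 'm" and B :: "real ^ 'm ^ 'n" and C :: "real ^ 'k ^ 'm"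
  by (simp add: matrix_mul_assoc)

lemma diagonal_of_inverse:
  assumes "\<forall>i. 0 < l $ i"
  shows "diagonal_of (\<chi> i. 1 / sqrt (l $ i)) ** diagonal_of (\<chi> i. sqrt (l $ i)) = mat 1"
    and "diagonal_of (\<chi> i. sqrt (l $ i)) ** diagonal_of (\<chi> i. 1 / sqrt (l $ i)) = mat 1"
    and "diagonal_of (\<chi> i. sqrt (l $ i)) ** diagonal_of (\<chi> i. sqrt (l $ i)) = diagonal_of l"
proof -
  have "sqrt (l $ i) \<noteq> 0" "0 \<le> l $ i" for i using assms[rule_format, of i] by auto
  then show "diagonal_of (\<chi> i. 1 / sqrt (l $ i)) ** diagonal_of (\<chi> i. sqrt (l $ i)) = mat 1"
    "diagonal_of (\<chi> i. sqrt (l $ i)) ** diagonal_of (\<chi> i. 1 / sqrt (l $ i)) = mat 1"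
    "diagonal_of (\<chi> i. sqrt (l $ i)) ** diagonal_of (\<chi> i. sqrt (l $ i)) = diagonal_of l"
    by (auto simp: diagonal_of_mult diagonal_of_one)
qed

lemma gram_diagonalization:
  fixes X :: "real ^ 'm ^ 'p"
  assumes inj: "\<And>v. X *v v = 0 \<Longrightarrow> v = 0"
  obtains Q :: "real ^ 'm ^ 'm" and l where "transpose Q ** Q = mat 1" "Q ** transpose Q = mat 1" "\<forall>i. 0 < l $ i"
    "transpose X ** X = Q ** diagonal_of l ** transpose Q"
proof -
  have "transpose (transpose X ** X) = transpose X ** X" by (simp add: matrix_transpose_mul)
  then obtain Q :: "real ^ 'm ^ 'm" and l where Q: "transpose Q ** Q = mat 1" "Q ** transpose Q = mat 1"
    "transpose X ** X = Q ** diagonal_of l ** transpose Q"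
    by (rule symmetric_matrix_diagonalization)
  have "0 < l $ i" for i
  proof -
    let ?v = "Q *v axis i 1"
    have tv: "transpose Q *v ?v = axis i 1" by (simp add: matrix_vector_mul_assoc Q)
    then have "?v \<noteq> 0" by (metis axis_eq_0_iff matrix_vector_mult_0_right zero_neq_one)
    then have "0 < ?v \<bullet> ((transpose X ** X) *v ?v)" by (intro gram_pos inj)
    also have "(transpose X ** X) *v ?v = Q *v (diagonal_of l *v axis i 1)"
      unfolding Q(3) by (simp only: matrix_vector_mul_assoc[symmetric] tv)
    also have "?v \<bullet> (Q *v (diagonal_of l *v axis i 1)) = axis i 1 \<bullet> (diagonal_of l *v axis i 1)"
      using tv by (metis inner_transpose)
    also have "\<dots> = l $ i" by (simp add: inner_axis' diagonal_of_mult_vec)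
    finally show ?thesis .
  qed
  with Q show thesis using that by blast
qed

text \<open>Here \<open>S\<close> is the positive square root of \<open>X\<^sup>T X\<close> and \<open>S'\<close> its inverse. Symmetry of \<open>S\<close>
  matters later: a factorisation \<open>X = H R\<close> with an arbitrary invertible \<open>R\<close> would produce
  \<open>R R\<^sup>T\<close> in places where \<open>X\<^sup>T X = R\<^sup>T R\<close> is wanted.\<close>
lemma polar_decomposition:
  fixes X :: "real ^ 'm ^ 'p"
  assumes inj: "\<And>v. X *v v = 0 \<Longrightarrow> v = 0"
  obtains H :: "real ^ 'm ^ 'p" and S S' where "transpose H ** H = mat 1" "X = H ** S"
    "transpose S = S" "S ** S = transpose X ** X" "S ** S' = mat 1" "S' ** S = mat 1"
proof -
  obtain Q :: "real ^ 'm ^ 'm" and l where Q: "transpose Q ** Q = mat 1" "Q ** transpose Q = mat 1" "\<forall>i. 0 < l $ i"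
    "transpose X ** X = Q ** diagonal_of l ** transpose Q"
    by (rule gram_diagonalization[OF inj])
  define D where "D = diagonal_of (\<chi> i. sqrt (l $ i))"
  define D' where "D' = diagonal_of (\<chi> i. 1 / sqrt (l $ i))"
  have D: "D' ** D = mat 1" "D ** D' = mat 1" "D ** D = diagonal_of l"
    unfolding D_def D'_def by (rule diagonal_of_inverse[OF Q(3)])+
  define S where "S = Q ** D ** transpose Q"
  define S' where "S' = Q ** D' ** transpose Q"
  have tS: "transpose S = S"
    by (simp add: S_def matrix_transpose_mul D_def matrix_mul_assoc)
  have tS': "transpose S' = S'"
    by (simp add: S'_def matrix_transpose_mul D'_def matrix_mul_assoc)
  note cancel = matrix_mul_assoc[symmetric] matrix_mul_cancel_left[OF Q(1)] matrix_mul_cancel_left[OF D(1)]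
    matrix_mul_cancel_left[OF D(2)]
  have SS: "S ** S = transpose X ** X"
    unfolding Q(4) S_def D(3)[symmetric] by (simp only: cancel)
  have SS': "S ** S' = mat 1" unfolding S_def S'_def by (simp only: cancel Q(2))
  have S'S: "S' ** S = mat 1" unfolding S_def S'_def by (simp only: cancel Q(2))
  have "transpose (X ** S') ** (X ** S') = S' ** (transpose X ** X) ** S'"
    by (simp add: matrix_transpose_mul tS' matrix_mul_assoc)
  also have "\<dots> = mat 1"
    unfolding SS[symmetric] by (simp only: matrix_mul_assoc[symmetric] matrix_mul_cancel_left[OF S'S] SS')
  finally have H: "transpose (X ** S') ** (X ** S') = mat 1" .
  have "X = (X ** S') ** S" by (simp add: matrix_mul_assoc[symmetric] S'S)
  from H this tS SS SS' S'S show thesis by (rule that)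
qed

lemma gram_invertible:
  fixes X :: "real ^ 'm ^ 'p"
  assumes inj: "\<And>v. X *v v = 0 \<Longrightarrow> v = 0"
  obtains V' where "(transpose X ** X) ** V' = mat 1"
proof -
  obtain H :: "real ^ 'm ^ 'p" and S S' where S: "S ** S = transpose X ** X" "S ** S' = mat 1"
    by (rule polar_decomposition[OF inj])
  have "(transpose X ** X) ** (S' ** S') = mat 1"
    unfolding S(1)[symmetric]
    by (simp only: matrix_mul_assoc[symmetric] matrix_mul_cancel_left[OF S(2)] S(2))
  then show thesis by (rule that)
qed

text \<open>If \<open>X\<^sup>T X = Q L Q\<^sup>T\<close>, then \<open>X X\<^sup>T = H L H\<^sup>T\<close> with \<open>H = X Q L\<^sup>-\<^sup>1\<^sup>/\<^sup>2\<close>.\<close>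
lemma spectral_decomposition_exists:
  fixes X :: "real ^ 'm ^ 'p"
  assumes inj: "\<And>v. X *v v = 0 \<Longrightarrow> v = 0"
  shows "\<exists>(H :: real ^ 'm ^ 'p) l. spectral_decomposition (X ** transpose X) H l"
proof -
  obtain Q :: "real ^ 'm ^ 'm" and l where Q: "transpose Q ** Q = mat 1" "Q ** transpose Q = mat 1" "\<forall>i. 0 < l $ i"
    "transpose X ** X = Q ** diagonal_of l ** transpose Q"
    by (rule gram_diagonalization[OF inj])
  define D where "D = diagonal_of (\<chi> i. sqrt (l $ i))"
  define D' where "D' = diagonal_of (\<chi> i. 1 / sqrt (l $ i))"
  have D: "D' ** D = mat 1" "D ** D' = mat 1" "D ** D = diagonal_of l"
    unfolding D_def D'_def by (rule diagonal_of_inverse[OF Q(3)])+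
  have tD: "transpose D' = D'" by (simp add: D'_def)
  let ?H = "X ** Q ** D'"
  note cancel = matrix_mul_assoc[symmetric] matrix_mul_cancel_left[OF Q(1)] matrix_mul_cancel_left[OF D(1)]
    matrix_mul_cancel_left[OF D(2)] matrix_mul_cancel_left[OF Q(2)]
  have "transpose ?H ** ?H = D' ** transpose Q ** (transpose X ** X) ** Q ** D'"
    by (simp add: matrix_transpose_mul tD matrix_mul_assoc)
  also have "\<dots> = mat 1" unfolding Q(4) D(3)[symmetric] by (simp only: cancel D(1,2))
  finally have H: "transpose ?H ** ?H = mat 1" .
  have "?H ** diagonal_of l ** transpose ?H = X ** transpose X"
    unfolding D(3)[symmetric] by (simp only: matrix_transpose_mul tD cancel)
  with H Q(3) have "spectral_decomposition (X ** transpose X) ?H l"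
    unfolding spectral_decomposition_def by simp
  then show ?thesis by blast
qed

section \<open>Finite roots as eigenvalues of a matrix pencil\<close>

text \<open>Multiplying the eigenvalue equation of the reduced matrix from the left by the injective matrix
  \<open>H L\<^sup>1\<^sup>/\<^sup>2 L\<close> and substituting \<open>A w\<close> for \<open>H L\<^sup>-\<^sup>1\<^sup>/\<^sup>2 v\<close> gives an equation that no longer
  mentions the decomposition of \<open>A\<close>. It is polynomial in \<open>A\<close>, \<open>B\<close>, \<open>w\<close> and \<open>\<mu>\<close>, which also serves
  measurability.\<close>
lemma real_eigenvalue_reduced_matrix_iff:
  fixes H :: "real ^ 'm ^ 'p"
  assumes "spectral_decomposition A H l"
  shows "real_eigenvalue (reduced_matrix B H l) \<mu> \<longleftrightarrow>
    (\<exists>w. A *v w \<noteq> 0 \<and> A *v (B *v (A *v w)) = \<mu> *\<^sub>R (A *v (A *v (A *v w))))"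
proof -
  define D where "D = diagonal_of (\<chi> i. sqrt (l $ i))"
  define R where "R = diagonal_of (\<chi> i. 1 / sqrt (l $ i))"
  have HH: "transpose H ** H = mat 1" and l: "\<forall>i. 0 < l $ i"
    and A: "A = H ** diagonal_of l ** transpose H"
    using assms by (auto simp: spectral_decomposition_def)
  have D: "R ** D = mat 1" "D ** R = mat 1" "D ** D = diagonal_of l"
    unfolding D_def R_def by (rule diagonal_of_inverse[OF l])+
  have c [simp]: "transpose H *v (H *v x) = x" "R *v (D *v x) = x" "D *v (R *v x) = x" for x
    using HH D by (simp_all add: matrix_vector_mul_assoc)
  have Av: "A *v x = H *v (D *v (D *v (transpose H *v x)))" for x
    by (simp add: A D(3)[symmetric] matrix_vector_mul_assoc matrix_mul_assoc)
  have Kv: "reduced_matrix B H l *v x = R *v (transpose H *v (B *v (H *v (R *v x))))" for x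
    by (simp add: reduced_matrix_def Let_def R_def[symmetric] matrix_vector_mul_assoc matrix_mul_assoc)
  have main: "A *v (B *v (H *v (R *v v))) - \<mu> *\<^sub>R (A *v (A *v (H *v (R *v v))))
      = H *v (D *v (D *v (D *v (reduced_matrix B H l *v v - \<mu> *\<^sub>R v))))" for v
    by (simp add: Av Kv matrix_vector_mult_diff_distrib matrix_vector_mult_scaleR)
  have zero: "H *v (D *v (D *v (D *v x))) = 0 \<longleftrightarrow> x = 0" for x
    by (metis c matrix_vector_mult_0_right)
  have eq: "A *v (B *v (H *v (R *v v))) = \<mu> *\<^sub>R (A *v (A *v (H *v (R *v v))))
      \<longleftrightarrow> reduced_matrix B H l *v v = \<mu> *\<^sub>R v" for v
    using main[of v] zero[of "reduced_matrix B H l *v v - \<mu> *\<^sub>R v"] by auto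
  have nz: "H *v (R *v v) \<noteq> 0 \<longleftrightarrow> v \<noteq> 0" for v
    by (metis c matrix_vector_mult_0_right)
  have range1: "A *v w = H *v (R *v (D *v (D *v (D *v (transpose H *v w)))))" for w
    by (simp add: Av)
  have range2: "H *v (R *v v) = A *v (H *v (R *v (R *v (R *v v))))" for v
    by (simp add: Av)
  show ?thesis
    unfolding real_eigenvalue_def
  proof safe
    fix v assume "v \<noteq> 0" "reduced_matrix B H l *v v = \<mu> *\<^sub>R v"
    then show "\<exists>w. A *v w \<noteq> 0 \<and> A *v (B *v (A *v w)) = \<mu> *\<^sub>R (A *v (A *v (A *v w)))"
      using eq[of v] nz[of v] range2[of v] by metis
  next
    fix w assume "A *v w \<noteq> 0" "A *v (B *v (A *v w)) = \<mu> *\<^sub>R (A *v (A *v (A *v w)))"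
    then show "\<exists>v. v \<noteq> 0 \<and> reduced_matrix B H l *v v = \<mu> *\<^sub>R v"
      using eq[of "D *v (D *v (D *v (transpose H *v w)))"] nz[of "D *v (D *v (D *v (transpose H *v w)))"]
        range1[of w] by metis
  qed
qed

lemma mem_finite_roots_iff:
  fixes A B :: "real ^ 'p ^ 'p"
  shows "\<mu> \<in> finite_roots TYPE('m::finite) B A \<longleftrightarrow>
    0 < \<mu> \<and> (\<exists>(H :: real ^ 'm ^ 'p) l. spectral_decomposition A H l) \<and>
    (\<exists>w. A *v w \<noteq> 0 \<and> A *v (B *v (A *v w)) = \<mu> *\<^sub>R (A *v (A *v (A *v w))))"
  unfolding finite_roots_def using real_eigenvalue_reduced_matrix_iff by blast

text \<open>Eigenvalues are zeros of the characteristic polynomial, which is not the zero polynomial since no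
  number above the operator norm is an eigenvalue.\<close>
lemma finite_real_eigenvalues: "finite {\<mu>. real_eigenvalue M \<mu>}" for M :: "real ^ 'n ^ 'n"
proof -
  define C :: "real poly ^ 'n ^ 'n" where
    "C = (\<chi> i j. [: M $ i $ j, if i = j then - 1 else 0 :])"
  have poly_det: "poly (det C) \<mu> = det (M - \<mu> *\<^sub>R mat 1)" for \<mu>
  proof -
    have "poly (C $ i $ j) \<mu> = (M - \<mu> *\<^sub>R mat 1) $ i $ j" for i j
      by (simp add: C_def mat_def)
    then show ?thesis by (simp add: det_def poly_sum poly_prod)
  qed
  have eig: "real_eigenvalue M \<mu> \<longleftrightarrow> poly (det C) \<mu> = 0" for \<mu>
  proof -
    have "real_eigenvalue M \<mu> \<longleftrightarrow> (\<exists>v. v \<noteq> 0 \<and> (M - \<mu> *\<^sub>R mat 1) *v v = 0)"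
      by (simp add: real_eigenvalue_def matrix_vector_mult_diff_rdistrib scaleR_matrix_vector_assoc[symmetric])
    also have "\<dots> \<longleftrightarrow> \<not> invertible (M - \<mu> *\<^sub>R mat 1)"
      unfolding invertible_left_inverse matrix_left_invertible_ker by blast
    finally show ?thesis by (simp add: poly_det invertible_det_nz)
  qed
  have "det C \<noteq> 0"
  proof
    assume 0: "det C = 0"
    (* exceeds the operator norm, hence is no eigenvalue *)
    define \<mu> where "\<mu> = onorm ((*v) M) + 1"
    have "real_eigenvalue M \<mu>" by (simp add: eig 0)
    then obtain v where v: "v \<noteq> 0" "M *v v = \<mu> *\<^sub>R v" by (auto simp: real_eigenvalue_def)
    have bl: "bounded_linear ((*v) M)" by (rule matrix_vector_mul_bounded_linear)
    have "\<bar>\<mu>\<bar> * norm v \<le> onorm ((*v) M) * norm v"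
      using onorm[OF bl, of v] v(2) by simp
    then have "\<bar>\<mu>\<bar> \<le> onorm ((*v) M)" using v(1) by simp
    then show False using onorm_pos_le[OF bl] by (simp add: \<mu>_def)
  qed
  then show ?thesis unfolding eig by (rule poly_roots_finite)
qed

lemma finite_finite_roots: "finite (finite_roots TYPE('m::finite) B A)" for A B :: "real ^ 'p ^ 'p"
proof (cases "\<exists>(H :: real ^ 'm ^ 'p) l. spectral_decomposition A H l")
  case True
  then obtain H :: "real ^ 'm ^ 'p" and l where "spectral_decomposition A H l" by blast
  from real_eigenvalue_reduced_matrix_iff[OF this]
  have "finite_roots TYPE('m::finite) B A \<subseteq> {\<mu>. real_eigenvalue (reduced_matrix B H l) \<mu>}"
    by (auto simp: mem_finite_roots_iff)
  then show ?thesis using finite_real_eigenvalues finite_subset by blast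
next
  case False
  then have "finite_roots TYPE('m) B A = {}" by (auto simp: mem_finite_roots_iff)
  then show ?thesis by simp
qed

text \<open>For invertible \<open>V\<close> these are the eigenvalues of \<open>U V\<^sup>-\<^sup>1\<close>, with the eigenvector \<open>V t\<close>; the
  present form avoids carrying the inverse through calculations.\<close>
definition pencil_eigenvalue :: "real ^ 'n ^ 'n \<Rightarrow> real ^ 'n ^ 'n \<Rightarrow> real \<Rightarrow> bool" where
  "pencil_eigenvalue U V \<mu> \<longleftrightarrow> (\<exists>t. t \<noteq> 0 \<and> U *v t = \<mu> *\<^sub>R (V *v t))"

lemma matrix_inv_inverse:
  fixes V :: "real ^ 'n ^ 'n"
  assumes "V ** V' = mat 1"
  shows "V ** matrix_inv V = mat 1" "matrix_inv V ** V = mat 1"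
proof -
  have "V ** V' = mat 1 \<and> V' ** V = mat 1" using assms matrix_left_right_inverse by blast
  then have "V ** matrix_inv V = mat 1 \<and> matrix_inv V ** V = mat 1"
    unfolding matrix_inv_def by (rule someI)
  then show "V ** matrix_inv V = mat 1" "matrix_inv V ** V = mat 1" by auto
qed

lemma real_eigenvalue_mult_matrix_inv:
  assumes V: "V ** V' = mat 1"
  shows "real_eigenvalue (U ** matrix_inv V) \<mu> \<longleftrightarrow> pencil_eigenvalue U V \<mu>"
proof -
  note i = matrix_inv_inverse[OF V]
  have c: "V *v (matrix_inv V *v x) = x" "matrix_inv V *v (V *v x) = x" for x
    using i by (simp_all add: matrix_vector_mul_assoc)
  show ?thesis unfolding real_eigenvalue_def pencil_eigenvalue_def matrix_vector_mul_assoc[symmetric]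
    by (metis c matrix_vector_mult_0_right)
qed

text \<open>With \<open>A = H S\<^sup>2 H\<^sup>T\<close> every vector \<open>A w\<close> has the form \<open>H t\<close>, and in
  \<open>A B H t = \<mu> A A H t\<close> the common injective factor \<open>H S\<^sup>2\<close> cancels.\<close>
lemma finite_roots_eq_pencil_eigenvalues:
  fixes X :: "real ^ 'm ^ 'p" and H :: "real ^ 'm ^ 'p"
  assumes inj: "\<And>v. X *v v = 0 \<Longrightarrow> v = 0"
    and H: "transpose H ** H = mat 1" "X = H ** S" "transpose S = S"
    and S: "S ** S = transpose X ** X" "S ** S' = mat 1" "S' ** S = mat 1"
  shows "finite_roots TYPE('m) B (X ** transpose X) =
    {\<mu>. 0 < \<mu> \<and> pencil_eigenvalue (transpose H ** B ** H) (transpose X ** X) \<mu>}"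
proof -
  let ?A = "X ** transpose X"
  have c [simp]: "transpose H *v (H *v x) = x" "S *v (S' *v x) = x" "S' *v (S *v x) = x" for x
    using H(1) S by (simp_all add: matrix_vector_mul_assoc)
  have A: "?A *v x = H *v (S *v (S *v (transpose H *v x)))" for x
    by (simp add: H(2,3) matrix_transpose_mul matrix_vector_mul_assoc matrix_mul_assoc)
  have "(\<exists>w. ?A *v w \<noteq> 0 \<and> ?A *v (B *v (?A *v w)) = \<mu> *\<^sub>R (?A *v (?A *v (?A *v w)))) \<longleftrightarrow>
    pencil_eigenvalue (transpose H ** B ** H) (transpose X ** X) \<mu>" for \<mu>
  proof -
    have pencil: "pencil_eigenvalue (transpose H ** B ** H) (transpose X ** X) \<mu> \<longleftrightarrow>
      (\<exists>t. t \<noteq> 0 \<and> transpose H *v (B *v (H *v t)) = \<mu> *\<^sub>R (S *v (S *v t)))"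
      unfolding pencil_eigenvalue_def S(1)[symmetric]
      by (simp add: matrix_vector_mul_assoc matrix_mul_assoc)
    have eq: "?A *v (B *v (H *v t)) = \<mu> *\<^sub>R (?A *v (?A *v (H *v t))) \<longleftrightarrow>
      transpose H *v (B *v (H *v t)) = \<mu> *\<^sub>R (S *v (S *v t))" (is "?L \<longleftrightarrow> ?R") for t
    proof
      assume ?L
      then have "S' *v (S' *v (transpose H *v (?A *v (B *v (H *v t)))))
        = S' *v (S' *v (transpose H *v (\<mu> *\<^sub>R (?A *v (?A *v (H *v t))))))" by simp
      then show ?R by (simp add: A matrix_vector_mult_scaleR)
    next
      assume ?R then show ?L by (simp add: A matrix_vector_mult_scaleR)
    qed
    have nz: "H *v t = 0 \<longleftrightarrow> t = 0" for t by (metis c(1) matrix_vector_mult_0_right)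
    have range1: "?A *v w = H *v (S *v (S *v (transpose H *v w)))" for w by (rule A)
    have range2: "H *v t = ?A *v (H *v (S' *v (S' *v t)))" for t by (simp add: A)
    show ?thesis unfolding pencil
      by (metis eq nz range1 range2)
  qed
  then show ?thesis
    using spectral_decomposition_exists[OF inj] by (auto simp: mem_finite_roots_iff)
qed

section \<open>Schur complements\<close>

text \<open>The nonzero eigenvalues of \<open>Z Z\<^sup>T V\<^sup>-\<^sup>1\<close> are those of
  \<open>Z\<^sup>T V\<^sup>-\<^sup>1 Z = T W\<^sup>-\<^sup>1 T\<close>, and moving the factor \<open>T\<close> around gives those of
  \<open>T\<^sup>2 W\<^sup>-\<^sup>1 = Z\<^sup>T Z W\<^sup>-\<^sup>1\<close>. On pencil eigenvectors this is the map
  \<open>t \<mapsto> W\<^sup>-\<^sup>1 T\<^sup>2 Q1\<^sup>T t\<close> with \<open>s \<mapsto> V\<^sup>-\<^sup>1 Q1 W s\<close> in the other direction. Zero is excluded on the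
  left because \<open>Z Z\<^sup>T\<close> may be singular, while \<open>Z\<^sup>T Z\<close> never is.\<close>
lemma pencil_eigenvalue_transfer:
  fixes Z Q1 :: "real ^ 'q ^ 'm"
  assumes Z: "Z = Q1 ** T" "transpose Q1 ** Q1 = mat 1" "transpose T = T"
    and V: "V ** V' = mat 1"
    and W: "W ** (transpose Q1 ** V' ** Q1) = mat 1"
    and T: "T ** T' = mat 1"
  shows "\<mu> \<noteq> 0 \<and> pencil_eigenvalue (Z ** transpose Z) V \<mu> \<longleftrightarrow>
    pencil_eigenvalue (transpose Z ** Z) W \<mu>"
proof -
  define W' where "W' = transpose Q1 ** V' ** Q1"
  have W': "W ** W' = mat 1" "W' ** W = mat 1"
    using W matrix_left_right_inverse by (auto simp: W'_def)
  have V': "V' ** V = mat 1" "T' ** T = mat 1" using V T matrix_left_right_inverse by auto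
  have c [simp]: "V *v (V' *v x) = x" "V' *v (V *v x) = x" for x
    using V V' by (simp_all add: matrix_vector_mul_assoc)
  have c1 [simp]: "T' *v (T *v y) = y" "W *v (W' *v y) = y" "W' *v (W *v y) = y"
    "transpose Q1 *v (Q1 *v y) = y" for y
    using V' T W' Z(2) by (simp_all add: matrix_vector_mul_assoc)
  have c2: "transpose Q1 *v (V' *v (Q1 *v y)) = W' *v y" for y
    by (simp add: W'_def matrix_vector_mul_assoc matrix_mul_assoc)
  have ZZ: "(Z ** transpose Z) *v t = Q1 *v (T *v (T *v (transpose Q1 *v t)))" for t
    by (simp add: Z matrix_transpose_mul matrix_vector_mul_assoc matrix_mul_assoc)
  have ZtZ: "(transpose Z ** Z) *v s = T *v (T *v s)" for s
    using c1(4) by (simp add: Z matrix_transpose_mul matrix_vector_mul_assoc[symmetric])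
  show ?thesis
    unfolding pencil_eigenvalue_def
  proof safe
    fix t assume \<mu>: "\<mu> \<noteq> 0" and t: "t \<noteq> 0" "(Z ** transpose Z) *v t = \<mu> *\<^sub>R (V *v t)"
    define s where "s = W' *v (T *v (T *v (transpose Q1 *v t)))"
    have "transpose Q1 *v (V' *v ((Z ** transpose Z) *v t)) = \<mu> *\<^sub>R (transpose Q1 *v t)"
      unfolding t(2) by (simp add: matrix_vector_mult_scaleR)
    then have s: "s = \<mu> *\<^sub>R (transpose Q1 *v t)" by (simp add: ZZ c2 s_def)
    have "(transpose Z ** Z) *v s = \<mu> *\<^sub>R (T *v (T *v (transpose Q1 *v t)))"
      unfolding ZtZ s by (simp add: matrix_vector_mult_scaleR)
    also have "T *v (T *v (transpose Q1 *v t)) = W *v s" by (simp add: s_def)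
    finally have eq: "(transpose Z ** Z) *v s = \<mu> *\<^sub>R (W *v s)" .
    have "s \<noteq> 0"
    proof
      assume "s = 0"
      then have "transpose Q1 *v t = 0" using s \<mu> by simp
      then have "\<mu> *\<^sub>R (V *v t) = 0" using t(2) by (simp add: ZZ)
      then have "V *v t = 0" using \<mu> by simp
      then show False using c(2)[of t] t(1) by simp
    qed
    with eq show "\<exists>s. s \<noteq> 0 \<and> (transpose Z ** Z) *v s = \<mu> *\<^sub>R (W *v s)" by blast
  next
    fix s assume s: "s \<noteq> 0" "(transpose Z ** Z) *v s = 0 *\<^sub>R (W *v s)"
    then have "T' *v (T' *v (T *v (T *v s))) = 0" by (simp add: ZtZ)
    then show False using s(1) by simp
  next
    fix s assume s: "s \<noteq> 0" "(transpose Z ** Z) *v s = \<mu> *\<^sub>R (W *v s)"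
    define t where "t = V' *v (Q1 *v (W *v s))"
    have Qt: "transpose Q1 *v t = s" by (simp add: t_def c2)
    have "(Z ** transpose Z) *v t = \<mu> *\<^sub>R (V *v t)"
      using s(2) unfolding ZZ Qt ZtZ by (simp add: t_def matrix_vector_mult_scaleR)
    moreover have "t \<noteq> 0" using Qt s(1) by auto
    ultimately show "\<exists>t. t \<noteq> 0 \<and> (Z ** transpose Z) *v t = \<mu> *\<^sub>R (V *v t)" by blast
  qed
qed

lemma matrix_vector_mult_sum: "X *v sum f A = (\<Sum>i\<in>A. X *v f i)" for X :: "real ^ 'n ^ 'm"
  by (rule linear_sum[OF matrix_vector_mul_linear])

text \<open>The hypotheses on \<open>n\<close> say that \<open>P z = \<Sum> (n\<^sub>k \<bullet> z) n\<^sub>k\<close> is the orthogonal projection onto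
  the complement of the vectors \<open>X w\<^sub>c\<close> with \<open>c\<close> outside the range of \<open>\<sigma>\<close>. As \<open>P\<close> kills those
  vectors, \<open>P X = P X Q1 Q1\<^sup>T\<close>. The columns of \<open>X V\<^sup>-\<^sup>1 Q1\<close> are orthogonal to them, since
  \<open>X\<^sup>T X V\<^sup>-\<^sup>1 Q1 = Q1\<close>, so \<open>P\<close> fixes these columns. With \<open>W = Q1\<^sup>T X\<^sup>T P X Q1\<close> both facts give
  \<open>W Q1\<^sup>T V\<^sup>-\<^sup>1 Q1 = Q1\<^sup>T X\<^sup>T P X V\<^sup>-\<^sup>1 Q1 = Q1\<^sup>T X\<^sup>T X V\<^sup>-\<^sup>1 Q1 = 1\<close>.\<close>
lemma schur_complement_inverse:
  fixes X :: "real ^ 'm ^ 'p" and w :: "'m \<Rightarrow> real ^ 'm" and \<sigma> :: "'q::finite \<Rightarrow> 'm"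
    and n :: "'k \<Rightarrow> real ^ 'p"
  assumes V': "(transpose X ** X) ** V' = mat 1"
    and w: "orthonormal_family UNIV w" and \<sigma>: "inj \<sigma>"
    and orth: "\<And>k c. k \<in> K \<Longrightarrow> c \<notin> range \<sigma> \<Longrightarrow> n k \<bullet> (X *v w c) = 0"
    and complete: "\<And>z. (\<And>c. c \<notin> range \<sigma> \<Longrightarrow> z \<bullet> (X *v w c) = 0) \<Longrightarrow> (\<Sum>k\<in>K. (n k \<bullet> z) *\<^sub>R n k) = z"
  defines "Q1 \<equiv> \<chi> i a. w (\<sigma> a) $ i"
  defines "W \<equiv> \<chi> a b. \<Sum>k\<in>K. (n k \<bullet> (X *v w (\<sigma> a))) * (n k \<bullet> (X *v w (\<sigma> b)))"
  shows "W ** (transpose Q1 ** V' ** Q1) = mat 1"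
proof -
  define P where "P z = (\<Sum>k\<in>K. (n k \<bullet> z) *\<^sub>R n k)" for z
  have P_lin: "P (x + y) = P x + P y" "P (r *\<^sub>R x) = r *\<^sub>R P x" for x y r
    by (simp_all add: P_def inner_add_right scaleR_add_left sum.distrib scaleR_sum_right)
  have P_sum: "P (sum f A) = (\<Sum>i\<in>A. P (f i))" if "finite A" for A :: "'m set" and f
    using that by (induction A rule: finite_induct) (simp_all add: P_lin, simp add: P_def)
  have P_sum': "P (sum f A) = (\<Sum>i\<in>A. P (f i))" if "finite A" for A :: "'q set" and f
    using that by (induction A rule: finite_induct) (simp_all add: P_lin, simp add: P_def)
  have P_sym: "P x \<bullet> y = x \<bullet> P y" for x y
    by (simp add: P_def inner_sum_left inner_sum_right inner_commute mult.commute)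
  have P0: "P (X *v w c) = 0" if "c \<notin> range \<sigma>" for c
    unfolding P_def using orth that by (intro sum.neutral) auto
  have Q1v: "Q1 *v y = (\<Sum>a\<in>UNIV. y $ a *\<^sub>R w (\<sigma> a))" for y
    by (simp add: vec_eq_iff Q1_def matrix_vector_mult_def mult.commute)
  have Q1t: "(transpose Q1 *v v) $ a = w (\<sigma> a) \<bullet> v" for v a
    by (simp add: Q1_def matrix_vector_mult_def transpose_def inner_vec_def)
  have expand: "v = (\<Sum>c\<in>UNIV. (w c \<bullet> v) *\<^sub>R w c)" for v
  proof -
    define M where "M = (\<chi> c i. w c $ i)"
    have "M ** transpose M = mat 1"
      using w by (simp add: vec_eq_iff matrix_matrix_mult_def transpose_def M_def mat_def
          orthonormal_family_def inner_vec_def)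
    then have "transpose M ** M = mat 1" by (simp add: matrix_left_right_inverse)
    then have "transpose M *v (M *v v) = v" by (simp add: matrix_vector_mul_assoc)
    moreover have "transpose M *v (M *v v) = (\<Sum>c\<in>UNIV. (w c \<bullet> v) *\<^sub>R w c)"
      by (simp add: vec_eq_iff M_def matrix_vector_mult_def transpose_def inner_vec_def mult.commute)
    ultimately show ?thesis by simp
  qed
  have PX: "P (X *v v) = P (X *v (Q1 *v (transpose Q1 *v v)))" for v
  proof -
    have "P (X *v v) = (\<Sum>c\<in>UNIV. (w c \<bullet> v) *\<^sub>R P (X *v w c))"
      by (subst expand) (simp add: matrix_vector_mult_sum P_sum P_lin matrix_vector_mult_scaleR)
    also have "\<dots> = (\<Sum>c\<in>range \<sigma>. (w c \<bullet> v) *\<^sub>R P (X *v w c))"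
      by (rule sum.mono_neutral_right) (auto simp: P0)
    also have "\<dots> = (\<Sum>a\<in>UNIV. (w (\<sigma> a) \<bullet> v) *\<^sub>R P (X *v w (\<sigma> a)))"
      using \<sigma> by (simp add: sum.reindex)
    also have "\<dots> = P (X *v (Q1 *v (transpose Q1 *v v)))"
      by (simp add: Q1v Q1t matrix_vector_mult_sum P_sum' P_lin matrix_vector_mult_scaleR)
    finally show ?thesis .
  qed
  have V: "transpose X *v (X *v (V' *v x)) = x" for x
    using V' by (simp add: matrix_vector_mul_assoc matrix_mul_assoc)
  have QQ: "transpose Q1 *v (Q1 *v y) = y" for y
  proof -
    have "(transpose Q1 ** Q1) $ a $ b = mat 1 $ a $ b" for a b
      using w \<sigma> by (auto simp: matrix_matrix_mult_def transpose_def Q1_def mat_def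
          orthonormal_family_def inner_vec_def inj_eq[OF \<sigma>])
    then have "transpose Q1 ** Q1 = mat 1" by (simp add: vec_eq_iff)
    then show ?thesis by (simp add: matrix_vector_mul_assoc)
  qed
  have Pfix: "P (X *v (V' *v (Q1 *v y))) = X *v (V' *v (Q1 *v y))" for y
    unfolding P_def
  proof (rule complete)
    fix c assume c: "c \<notin> range \<sigma>"
    have "(X *v (V' *v (Q1 *v y))) \<bullet> (X *v w c) = (transpose X *v (X *v (V' *v (Q1 *v y)))) \<bullet> w c"
      by (simp add: inner_transpose)
    also have "\<dots> = (Q1 *v y) \<bullet> w c" by (simp add: V)
    also have "\<dots> = 0"
      unfolding Q1v inner_sum_left using c w by (intro sum.neutral) (auto simp: orthonormal_family_def)
    finally show "(X *v (V' *v (Q1 *v y))) \<bullet> (X *v w c) = 0" .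
  qed
  have Wv: "W *v y = transpose Q1 *v (transpose X *v P (X *v (Q1 *v y)))" for y
  proof -
    have "(W *v y) $ a = (transpose Q1 *v (transpose X *v P (X *v (Q1 *v y)))) $ a" for a
    proof -
      have "(transpose Q1 *v (transpose X *v P (X *v (Q1 *v y)))) $ a = P (X *v (Q1 *v y)) \<bullet> (X *v w (\<sigma> a))"
        by (simp add: Q1t inner_commute[of "w (\<sigma> a)"] inner_transpose)
      moreover have "X *v (Q1 *v y) = (\<Sum>b\<in>UNIV. y $ b *\<^sub>R (X *v w (\<sigma> b)))"
        by (simp add: Q1v matrix_vector_mult_sum matrix_vector_mult_scaleR)
      moreover have "P (\<Sum>b\<in>UNIV. y $ b *\<^sub>R (X *v w (\<sigma> b))) \<bullet> (X *v w (\<sigma> a)) = (\<Sum>b\<in>UNIV. y $ b * (P (X *v w (\<sigma> b)) \<bullet> (X *v w (\<sigma> a))))"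
        by (simp add: P_sum' P_lin inner_sum_left)
      moreover have "(\<Sum>b\<in>UNIV. y $ b * (P (X *v w (\<sigma> b)) \<bullet> (X *v w (\<sigma> a)))) = (W *v y) $ a"
        by (simp add: W_def matrix_vector_mult_def P_def inner_sum_left mult.commute)
      ultimately show ?thesis by simp
    qed
    then show ?thesis by (simp add: vec_eq_iff)
  qed
  have "W *v (transpose Q1 *v (V' *v (Q1 *v y))) = y" for y
  proof -
    have "W *v (transpose Q1 *v (V' *v (Q1 *v y))) = transpose Q1 *v (transpose X *v P (X *v (V' *v (Q1 *v y))))"
      unfolding Wv by (simp only: PX[symmetric])
    also have "\<dots> = y" unfolding Pfix V QQ ..
    finally show ?thesis .
  qed
  then show ?thesis
    by (simp add: matrix_eq matrix_vector_mul_assoc[symmetric])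
qed

lemma orthonormal_basis_of_columns_complement:
  fixes X :: "real ^ 'm ^ 'p" and C :: "'m set"
  assumes inj: "\<And>v. X *v v = 0 \<Longrightarrow> v = 0" and r: "r + card C = CARD('p)"
  obtains n :: "nat \<Rightarrow> real ^ 'p" where "orthonormal_family {..<r} n"
    "\<And>k c. k < r \<Longrightarrow> c \<in> C \<Longrightarrow> n k \<bullet> column c X = 0"
    "\<And>z. (\<And>c. c \<in> C \<Longrightarrow> z \<bullet> column c X = 0) \<Longrightarrow> (\<Sum>k<r. (n k \<bullet> z) *\<^sub>R n k) = z"
proof -
  have col: "column c X = X *v axis c 1" for c
    by (simp add: matrix_vector_mult_basis)
  have "inj ((*v) X)"
    using inj by (simp add: inj_matrix_vector_mult matrix_left_invertible_ker[symmetric]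
        invertible_left_inverse linear_injective_0)
  then have inj': "inj ((*v) X)" .
  let ?E = "(\<lambda>c. axis c 1 :: real ^ 'm) ` C"
  have "independent ?E"
    by (rule independent_mono[OF independent_Basis]) (auto simp: axis_in_Basis_iff)
  then have "independent ((*v) X ` ?E)"
    using inj' by (intro linear_independent_injective_image matrix_vector_mul_linear) (auto intro: inj_on_subset)
  moreover have "card ((*v) X ` ?E) = card C"
  proof -
    have "inj_on (\<lambda>c. axis c 1 :: real ^ 'm) C" by (auto simp: inj_on_def axis_eq_axis)
    then have "card ?E = card C" by (rule card_image)
    moreover have "inj_on ((*v) X) ?E" using inj' by (auto intro: inj_on_subset)
    ultimately show ?thesis by (simp add: card_image)
  qed
  ultimately have dimC: "dim (span ((*v) X ` ?E)) = card C" by (simp add: dim_eq_card_independent)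
  define T where "T = {y \<in> UNIV. \<forall>x\<in>span ((*v) X ` ?E). orthogonal x y}"
  have "dim T + dim (span ((*v) X ` ?E)) = dim (UNIV :: (real ^ 'p) set)"
    unfolding T_def
    by (rule dim_subspace_orthogonal_to_vectors[OF subspace_span subspace_UNIV subset_UNIV])
  then have dimT: "dim T = r" using r dimC by simp
  have subT: "subspace T" unfolding T_def by (auto simp: subspace_def orthogonal_clauses)
  have T_iff: "y \<in> T \<longleftrightarrow> (\<forall>c\<in>C. y \<bullet> column c X = 0)" for y
  proof
    assume y: "y \<in> T"
    show "\<forall>c\<in>C. y \<bullet> column c X = 0"
    proof
      fix c assume "c \<in> C"
      then have "column c X \<in> span ((*v) X ` ?E)" unfolding col by (intro span_base) blast
      then show "y \<bullet> column c X = 0" using y by (auto simp: T_def orthogonal_def inner_commute)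
    qed
  next
    assume y: "\<forall>c\<in>C. y \<bullet> column c X = 0"
    have "orthogonal y x" if x: "x \<in> span ((*v) X ` ?E)" for x
      using y by (intro orthogonal_to_span[OF x]) (auto simp: orthogonal_def col)
    then show "y \<in> T" by (auto simp: T_def orthogonal_commute)
  qed
  obtain n :: "nat \<Rightarrow> real ^ 'p" where n: "orthonormal_family {..<dim T} n"
    "\<And>k. k < dim T \<Longrightarrow> n k \<in> T" "\<And>x. x \<in> T \<Longrightarrow> (\<Sum>k<dim T. (n k \<bullet> x) *\<^sub>R n k) = x"
    using subspace_orthonormal_family[OF subT] by blast
  show thesis
    using n that unfolding dimT T_iff by blast
qed

section \<open>The standard Gaussian measure\<close>

abbreviation gaussian :: "(real ^ 'd) measure" where
  "gaussian \<equiv> centered_normal (mat 1)"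

lemma matrix_inv_mat_1: "matrix_inv (mat 1 :: real ^ 'n ^ 'n) = mat 1"
  using matrix_inv_inverse(1)[of "mat 1 :: real ^ 'n ^ 'n" "mat 1"] by simp

lemma gaussian_eq_density:
  "(gaussian :: (real ^ 'd) measure) =
    density lborel (\<lambda>x. ennreal (exp (- (x \<bullet> x) / 2) / sqrt ((2 * pi) ^ CARD('d))))"
  by (simp add: centered_normal_def matrix_inv_mat_1 det_I)

lemma sets_gaussian [measurable_cong, simp]: "sets gaussian = sets borel"
  and space_gaussian [simp]: "space gaussian = UNIV"
  by (simp_all add: gaussian_eq_density)

lemma gaussian_density_prod:
  "exp (- (x \<bullet> x) / 2) / sqrt ((2 * pi) ^ CARD('d)) = (\<Prod>i\<in>UNIV. std_normal_density (x $ i))"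
  for x :: "real ^ 'd"
proof -
  have "(\<Prod>i\<in>UNIV. std_normal_density (x $ i)) =
    (\<Prod>i\<in>(UNIV :: 'd set). 1 / sqrt (2 * pi)) * (\<Prod>i\<in>UNIV. exp (- (x $ i)\<^sup>2 / 2))"
    unfolding std_normal_density_def by (rule prod.distrib)
  also have "(\<Prod>i\<in>(UNIV :: 'd set). 1 / sqrt (2 * pi)) = 1 / sqrt ((2 * pi) ^ CARD('d))"
    by (simp add: power_divide real_sqrt_mult real_sqrt_power power_mult_distrib)
  also have "(\<Prod>i\<in>UNIV. exp (- (x $ i)\<^sup>2 / 2)) = exp (- (x \<bullet> x) / 2)"
    by (simp add: exp_sum[symmetric] inner_vec_def power2_eq_square sum_negf sum_divide_distrib)
  finally show ?thesis by simp
qed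

lemma borel_measurable_vec_nth: "(\<lambda>x. x $ i) \<in> borel_measurable borel" for i :: "'i::finite"
  by (intro borel_measurable_continuous_onI continuous_intros)

lemma prob_space_std_normal: "prob_space std_normal_distribution"
  by (rule prob_space_normal_density) simp

text \<open>The Gaussian density and the Lebesgue measure both factor over the coordinates, so the measure
  of a box is a product of one-dimensional integrals.\<close>
lemma gaussian_coordinates:
  "distr (gaussian :: (real ^ 'd) measure) (\<Pi>\<^sub>M i\<in>UNIV. std_normal_distribution) (\<lambda>x i. x $ i) =
    (\<Pi>\<^sub>M i\<in>UNIV. std_normal_distribution)"
proof -
  interpret product_prob_space "\<lambda>_ :: 'd. std_normal_distribution" UNIV
    by (intro product_prob_spaceI prob_space_std_normal)
  have meas: "(\<lambda>x i. x $ i) \<in> (gaussian :: (real ^ 'd) measure) \<rightarrow>\<^sub>M (\<Pi>\<^sub>M i\<in>(UNIV :: 'd set). std_normal_distribution)"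
    by (intro measurable_PiM_single') (auto simp: borel_measurable_vec_nth)
  show ?thesis
  proof (rule PiM_eqI)
    fix A :: "'d \<Rightarrow> real set" assume A: "\<And>i. i \<in> UNIV \<Longrightarrow> A i \<in> sets std_normal_distribution"
    then have [measurable]: "A i \<in> sets borel" for i by auto
    (* idx recovers the coordinate to which a standard basis vector belongs *)
    define idx :: "real ^ 'd \<Rightarrow> 'd" where "idx b = (THE i. b = axis i 1)" for b
    have idx: "idx (axis i 1) = i" for i by (auto simp: idx_def axis_eq_axis)
    have Basis: "(Basis :: (real ^ 'd) set) = (\<lambda>i. axis i 1) ` UNIV"
      by (auto simp: Basis_vec_def)
    have inj: "inj (\<lambda>i :: 'd. axis i (1 :: real))" by (auto simp: inj_on_def axis_eq_axis)
    define f where "f b t = ennreal (std_normal_density t) * indicator (A (idx b)) t" for b t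
    have "Pi\<^sub>E UNIV A \<in> sets (\<Pi>\<^sub>M i\<in>(UNIV :: 'd set). std_normal_distribution)"
      using A by (intro sets_PiM_I_finite) auto
    then have "emeasure (distr gaussian (\<Pi>\<^sub>M i\<in>UNIV. std_normal_distribution) (\<lambda>x i. x $ i)) (Pi\<^sub>E UNIV A) =
      emeasure gaussian {x. \<forall>i. x $ i \<in> A i}"
      by (subst emeasure_distr[OF meas]) (auto intro!: arg_cong2[where f = emeasure])
    also have "\<dots> = (\<integral>\<^sup>+ x. ennreal (\<Prod>i\<in>UNIV. std_normal_density (x $ i)) * indicator {x. \<forall>i. x $ i \<in> A i} x \<partial>lborel)"
      unfolding gaussian_eq_density gaussian_density_prod
      by (subst emeasure_density) (auto simp: borel_measurable_vec_nth)
    also have "\<dots> = (\<integral>\<^sup>+ (x :: real ^ 'd). (\<Prod>i\<in>UNIV. f (axis i 1) (x \<bullet> axis i 1)) \<partial>lborel)"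
    proof (rule nn_integral_cong)
      fix x :: "real ^ 'd"
      have "indicator {x. \<forall>i. x $ i \<in> A i} x = (\<Prod>i\<in>UNIV. indicator (A i) (x $ i) :: ennreal)"
        by (auto simp: indicator_def)
      then show "ennreal (\<Prod>i\<in>UNIV. std_normal_density (x $ i)) * indicator {x. \<forall>i. x $ i \<in> A i} x
        = (\<Prod>i\<in>UNIV. f (axis i 1) (x \<bullet> axis i 1))"
        by (simp add: f_def idx prod.distrib prod_ennreal inner_axis)
    qed
    also have "\<dots> = (\<integral>\<^sup>+ (x :: real ^ 'd). (\<Prod>b\<in>Basis. f b (x \<bullet> b)) \<partial>lborel)"
      unfolding Basis by (simp add: prod.reindex[OF inj])
    also have "\<dots> = (\<Prod>b\<in>Basis. (\<integral>\<^sup>+ t. f b t \<partial>lborel))"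
      by (rule nn_integral_lborel_prod) (auto simp: f_def)
    also have "\<dots> = (\<Prod>i\<in>UNIV. (\<integral>\<^sup>+ t. f (axis i 1) t \<partial>lborel))"
      unfolding Basis by (simp add: prod.reindex[OF inj])
    also have "\<dots> = (\<Prod>i\<in>UNIV. emeasure std_normal_distribution (A i))"
      by (simp add: f_def idx emeasure_density)
    finally show "emeasure (distr gaussian (\<Pi>\<^sub>M i\<in>UNIV. std_normal_distribution) (\<lambda>x i. x $ i)) (Pi\<^sub>E UNIV A) =
      (\<Prod>i\<in>UNIV. emeasure std_normal_distribution (A i))" .
  qed auto
qed

lemma borel_measurable_vec_lambda:
  "(\<And>i. (\<lambda>x. f x i) \<in> borel_measurable M) \<Longrightarrow> (\<lambda>x. \<chi> i. f x i) \<in> borel_measurable M"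
  for f :: "'a \<Rightarrow> 'i::finite \<Rightarrow> 'b::euclidean_space"
  by (subst borel_measurable_euclidean_space) (auto simp: Basis_vec_def inner_axis)

lemma distr_distr_distr:
  assumes "f \<in> M \<rightarrow>\<^sub>M N" "g \<in> N \<rightarrow>\<^sub>M L" "h \<in> L \<rightarrow>\<^sub>M R"
  shows "distr (distr (distr M N f) L g) R h = distr M R (h \<circ> (g \<circ> f))"
  using assms by (simp add: distr_distr comp_assoc)

lemma measurable_coordinates:
  "(\<lambda>x i. x $ i) \<in> (gaussian :: (real ^ 'd) measure) \<rightarrow>\<^sub>M (\<Pi>\<^sub>M i\<in>(UNIV :: 'd set). std_normal_distribution)"
  by (intro measurable_PiM_single') (auto simp: borel_measurable_vec_nth)

lemma distr_vec_lambda_std_normal: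
  "distr (\<Pi>\<^sub>M i\<in>UNIV. std_normal_distribution) borel (\<lambda>f. \<chi> i. f i) = (gaussian :: (real ^ 'd) measure)"
proof -
  have "(\<lambda>f. (\<chi> i. f i) :: real ^ 'd) \<in> borel_measurable (\<Pi>\<^sub>M i\<in>(UNIV :: 'd set). std_normal_distribution)"
    by (intro borel_measurable_vec_lambda) measurable
  then have "distr (distr gaussian (\<Pi>\<^sub>M i\<in>UNIV. std_normal_distribution) (\<lambda>x i. x $ i)) borel (\<lambda>f. \<chi> i. f i)
    = distr (gaussian :: (real ^ 'd) measure) borel ((\<lambda>f. \<chi> i. f i) \<circ> (\<lambda>x i. x $ i))"
    by (intro distr_distr measurable_coordinates)
  also have "(\<lambda>f. \<chi> i. f i) \<circ> (\<lambda>x i. x $ i) = (\<lambda>x :: real ^ 'd. x)" by (auto simp: fun_eq_iff)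
  also have "distr (gaussian :: (real ^ 'd) measure) borel (\<lambda>x. x) = gaussian" by (rule distr_id2) simp
  finally show ?thesis unfolding gaussian_coordinates .
qed

lemma prob_space_gaussian: "prob_space (gaussian :: (real ^ 'd) measure)"
proof -
  interpret product_prob_space "\<lambda>_ :: 'd. std_normal_distribution" UNIV
    by (intro product_prob_spaceI prob_space_std_normal)
  have "(\<lambda>f. (\<chi> i. f i) :: real ^ 'd) \<in> borel_measurable (\<Pi>\<^sub>M i\<in>(UNIV :: 'd set). std_normal_distribution)"
    by (intro borel_measurable_vec_lambda) measurable
  then show ?thesis
    unfolding distr_vec_lambda_std_normal[symmetric] by (rule prob_space_distr)
qed

text \<open>Boxes determine the Lebesgue measure, and isometries preserve their volume. The linear change
  of variables formula behind this concerns well-ordered coordinates; \<open>ordered_index\<close> below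
  carries its consequences over to all finite index types.\<close>
lemma distr_lborel_orthogonal:
  fixes f :: "real ^ 'd::{finite,wellorder} \<Rightarrow> real ^ 'd::_"
  assumes f: "orthogonal_transformation f"
  shows "distr lborel borel f = lborel"
proof (rule lborel_eqI[symmetric])
  fix l u :: "(real, 'd) vec" assume lu: "\<And>b. b \<in> Basis \<Longrightarrow> l \<bullet> b \<le> u \<bullet> b"
  have lin: "linear f" using f by (rule orthogonal_transformation_linear)
  then have fm [measurable]: "f \<in> borel_measurable borel"
    by (intro borel_measurable_continuous_onI linear_continuous_on) (simp add: linear_conv_bounded_linear)
  have inv: "orthogonal_transformation (inv f)" "bij f"
    using f by (auto simp: orthogonal_transformation_inv orthogonal_transformation_bij)
  have im: "f -` box l u = inv f ` box l u" using inv(2) by (simp add: bij_vimage_eq_inv_image)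
  have "inv f ` box l u \<in> lmeasurable"
    using inv(1) by (rule measurable_orthogonal_image) auto
  have "emeasure (distr lborel borel f) (box l u) = emeasure lborel (f -` box l u)"
    by (simp add: emeasure_distr)
  also have "\<dots> = emeasure lebesgue (f -` box l u)"
  proof -
    have "f -` box l u \<in> sets lborel" using measurable_sets_borel[OF fm] by simp
    then show ?thesis by (simp add: emeasure_completion)
  qed
  also have "\<dots> = emeasure lebesgue (inv f ` box l u)" by (simp add: im)
  also have "\<dots> = ennreal (measure lebesgue (inv f ` box l u))"
    using \<open>inv f ` box l u \<in> lmeasurable\<close> by (simp add: emeasure_eq_measure2)
  also have "\<dots> = ennreal (measure lebesgue (box l u))"
    using inv(1) by (simp add: measure_orthogonal_image)
  also have "\<dots> = ennreal (\<Prod>b\<in>Basis. (u - l) \<bullet> b)" using lu by simp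
  finally show "emeasure (distr lborel borel f) (box l u) = ennreal (\<Prod>b\<in>Basis. (u - l) \<bullet> b)" .
qed simp

lemma gaussian_rotation_invariant:
  fixes f :: "real ^ 'd::{finite,wellorder} \<Rightarrow> real ^ 'd::_"
  assumes f: "orthogonal_transformation f"
  shows "distr gaussian borel f = gaussian"
proof -
  have [measurable]: "f \<in> borel_measurable borel"
    using f by (intro borel_measurable_continuous_onI linear_continuous_on)
      (simp add: linear_conv_bounded_linear[symmetric] orthogonal_transformation_linear)
  have eq: "f x \<bullet> f x = x \<bullet> x" for x using f by (simp add: orthogonal_transformation_def)
  have "density (distr lborel borel f) (\<lambda>x. ennreal (exp (- (x \<bullet> x) / 2) / sqrt ((2 * pi) ^ CARD('d))))
    = distr gaussian borel f"
    unfolding gaussian_eq_density by (subst density_distr) (auto simp: eq)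
  then show ?thesis unfolding distr_lborel_orthogonal[OF f] gaussian_eq_density by simp
qed

text \<open>A rotation takes the orthonormal vectors to coordinate vectors, and the standard Gaussian measure
  is invariant under rotations.\<close>
lemma gaussian_orthonormal_coordinates_wellorder:
  fixes n :: "'k \<Rightarrow> real ^ 'd::{finite,wellorder}"
  assumes K: "finite K" and n: "orthonormal_family K n"
  shows "distr gaussian (\<Pi>\<^sub>M k\<in>K. std_normal_distribution) (\<lambda>x. \<lambda>k\<in>K. n k \<bullet> x) =
    (\<Pi>\<^sub>M k\<in>K. std_normal_distribution)"
proof -
  obtain \<sigma> and w :: "'d \<Rightarrow> (real, 'd) vec" where \<sigma>: "inj_on \<sigma> K" and w: "orthonormal_family UNIV w"
    and eq: "\<And>k. k \<in> K \<Longrightarrow> w (\<sigma> k) = n k"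
    using orthonormal_family_extension[OF K n] by blast
  define f where "f x = (\<chi> i. w i \<bullet> x)" for x
  have "orthogonal_matrix (\<chi> i j. w i $ j)"
    using w by (auto simp: orthogonal_matrix_orthonormal_rows row_def orthonormal_family_def norm_eq_1 orthogonal_def)
  then have "orthogonal_transformation ((*v) (\<chi> i j. w i $ j))"
    by (simp add: orthogonal_transformation_matrix)
  also have "(*v) (\<chi> i j. w i $ j) = f"
    by (auto simp: f_def fun_eq_iff vec_eq_iff matrix_vector_mult_def inner_vec_def)
  finally have f: "orthogonal_transformation f" .
  have [measurable]: "f \<in> borel_measurable borel"
    using f by (intro borel_measurable_continuous_onI linear_continuous_on)
      (simp add: linear_conv_bounded_linear[symmetric] orthogonal_transformation_linear)
  let ?r = "\<lambda>\<omega> :: 'd \<Rightarrow> real. \<lambda>k\<in>K. \<omega> (\<sigma> k)"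
  have [measurable]: "?r \<in> (\<Pi>\<^sub>M i\<in>UNIV. std_normal_distribution) \<rightarrow>\<^sub>M (\<Pi>\<^sub>M k\<in>K. std_normal_distribution)"
    by measurable
  have m2 [measurable]: "(\<lambda>x. ?r (\<lambda>i. x $ i)) \<in> gaussian \<rightarrow>\<^sub>M (\<Pi>\<^sub>M k\<in>K. std_normal_distribution)"
    using measurable_comp[OF measurable_coordinates \<open>?r \<in> _\<close>] by (simp add: comp_def)
  have "(\<lambda>x. \<lambda>k\<in>K. n k \<bullet> x) = (\<lambda>x. ?r (\<lambda>i. x $ i)) \<circ> f"
    by (auto simp: fun_eq_iff f_def eq restrict_def)
  then have "distr gaussian (\<Pi>\<^sub>M k\<in>K. std_normal_distribution) (\<lambda>x. \<lambda>k\<in>K. n k \<bullet> x) =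
    distr (distr gaussian borel f) (\<Pi>\<^sub>M k\<in>K. std_normal_distribution) (\<lambda>x. ?r (\<lambda>i. x $ i))"
    using m2 by (subst distr_distr) (auto simp: measurable_cong_sets[OF sets_gaussian refl])
  also have "\<dots> = distr (distr gaussian (\<Pi>\<^sub>M i\<in>UNIV. std_normal_distribution) (\<lambda>x i. x $ i))
      (\<Pi>\<^sub>M k\<in>K. std_normal_distribution) ?r"
    unfolding gaussian_rotation_invariant[OF f]
    by (subst distr_distr) (auto simp: measurable_coordinates comp_def)
  also have "\<dots> = (\<Pi>\<^sub>M k\<in>K. std_normal_distribution)"
    unfolding gaussian_coordinates
    by (rule distr_PiM_reindex) (use \<sigma> prob_space_std_normal in auto)
  finally show ?thesis .
qed

text \<open>A copy of a finite index type whose elements are numbered and hence well-ordered.\<close>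
typedef (overloaded) ('d::finite) ordered_index = "{..<CARD('d)}"
  by (rule exI[of _ 0]) simp

instantiation ordered_index :: (finite) wellorder
begin

definition less_eq_ordered_index :: "'a ordered_index \<Rightarrow> 'a ordered_index \<Rightarrow> bool" where
  "less_eq_ordered_index x y \<longleftrightarrow> Rep_ordered_index x \<le> Rep_ordered_index y"

definition less_ordered_index :: "'a ordered_index \<Rightarrow> 'a ordered_index \<Rightarrow> bool" where
  "less_ordered_index x y \<longleftrightarrow> Rep_ordered_index x < Rep_ordered_index y"

instance
proof
  fix P :: "'a ordered_index \<Rightarrow> bool" and x
  assume step: "\<And>x. (\<And>y. y < x \<Longrightarrow> P y) \<Longrightarrow> P x"
  show "P x"
    by (induction "Rep_ordered_index x" arbitrary: x rule: less_induct)
      (auto simp: less_ordered_index_def intro: step)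
qed (auto simp: less_eq_ordered_index_def less_ordered_index_def Rep_ordered_index_inject)

end

lemma bij_ordered_index: "bij_betw Rep_ordered_index (UNIV :: 'd::finite ordered_index set) {..<CARD('d)}"
  unfolding bij_betw_def
  using type_definition.Rep_range[OF type_definition_ordered_index]
  by (auto simp: inj_on_def Rep_ordered_index_inject)

instance ordered_index :: (finite) finite
  by standard (use bij_ordered_index bij_betw_finite in blast)

lemma gaussian_reindex:
  fixes b :: "'d::finite \<Rightarrow> 'e::finite"
  assumes b: "inj b"
  shows "distr (gaussian :: (real ^ 'e) measure) borel (\<lambda>x. \<chi> i. x $ b i) = gaussian"
proof -
  let ?N = std_normal_distribution
  let ?r = "\<lambda>\<omega> :: 'e \<Rightarrow> real. \<lambda>i\<in>(UNIV :: 'd set). \<omega> (b i)"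
  let ?v = "\<lambda>f. \<chi> i. f i"
  have r: "?r \<in> (\<Pi>\<^sub>M i\<in>UNIV. ?N) \<rightarrow>\<^sub>M (\<Pi>\<^sub>M i\<in>UNIV. ?N)" by measurable
  have v: "(\<lambda>f. (\<chi> i. f i) :: real ^ 'd) \<in> borel_measurable (\<Pi>\<^sub>M i\<in>(UNIV :: 'd set). ?N)"
    by (intro borel_measurable_vec_lambda) measurable
  have "(\<lambda>x. \<chi> i. x $ b i) = ?v \<circ> (?r \<circ> (\<lambda>x i. x $ i))" by (auto simp: fun_eq_iff)
  then have "distr (gaussian :: (real ^ 'e) measure) borel (\<lambda>x. \<chi> i. x $ b i)
    = distr (distr (distr gaussian (\<Pi>\<^sub>M i\<in>UNIV. ?N) (\<lambda>x i. x $ i)) (\<Pi>\<^sub>M i\<in>UNIV. ?N) ?r) borel ?v"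
    using distr_distr_distr[OF measurable_coordinates r v] by simp
  moreover have "distr (\<Pi>\<^sub>M i\<in>UNIV. ?N) (\<Pi>\<^sub>M i\<in>UNIV. ?N) ?r = (\<Pi>\<^sub>M i\<in>UNIV. ?N)"
    by (rule distr_PiM_reindex) (use b prob_space_std_normal in auto)
  then have "distr (distr (distr gaussian (\<Pi>\<^sub>M i\<in>UNIV. ?N) (\<lambda>x i. x $ i)) (\<Pi>\<^sub>M i\<in>UNIV. ?N) ?r) borel ?v
    = distr (\<Pi>\<^sub>M i\<in>UNIV. ?N) borel ?v" by (simp only: gaussian_coordinates)
  ultimately show ?thesis by (simp only: distr_vec_lambda_std_normal)
qed

lemma gaussian_orthonormal_coordinates:
  fixes n :: "'k \<Rightarrow> real ^ 'd"
  assumes K: "finite K" and n: "orthonormal_family K n"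
  shows "distr gaussian (\<Pi>\<^sub>M k\<in>K. std_normal_distribution) (\<lambda>x. \<lambda>k\<in>K. n k \<bullet> x) =
    (\<Pi>\<^sub>M k\<in>K. std_normal_distribution)"
proof -
  have "card (UNIV :: 'd ordered_index set) = CARD('d)"
    using bij_betw_same_card[OF bij_ordered_index] by simp
  then obtain b :: "'d \<Rightarrow> 'd ordered_index" where b: "bij b"
    by (metis finite_same_card_bij finite_class.finite_UNIV)
  define n' where "n' k = (\<chi> a. n k $ inv b a)" for k
  have inner: "n' k \<bullet> x = n k \<bullet> (\<chi> i. x $ b i)" for k x
    unfolding inner_vec_def n'_def
    by (subst sum.reindex_bij_betw[OF b, symmetric]) (use b in \<open>simp add: bij_is_inj\<close>)
  have eq: "(\<chi> i. n' k $ b i) = n k" for k using b by (simp add: n'_def bij_is_inj vec_eq_iff)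
  have "orthonormal_family K n'"
    using n by (auto simp: orthonormal_family_def inner eq)
  then have *: "distr gaussian (\<Pi>\<^sub>M k\<in>K. std_normal_distribution) (\<lambda>x. \<lambda>k\<in>K. n' k \<bullet> x) =
    (\<Pi>\<^sub>M k\<in>K. std_normal_distribution)"
    by (rule gaussian_orthonormal_coordinates_wellorder[OF K])
  have m1: "(\<lambda>x. \<chi> i. x $ b i) \<in> borel_measurable gaussian"
    by (intro borel_measurable_vec_lambda) (simp add: borel_measurable_vec_nth measurable_cong_sets[OF sets_gaussian refl])
  have m2: "(\<lambda>x. \<lambda>k\<in>K. n k \<bullet> x) \<in> borel \<rightarrow>\<^sub>M (\<Pi>\<^sub>M k\<in>K. std_normal_distribution)"
    by (intro measurable_restrict) simp
  have "distr gaussian (\<Pi>\<^sub>M k\<in>K. std_normal_distribution) (\<lambda>x. \<lambda>k\<in>K. n k \<bullet> x)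
    = distr gaussian (\<Pi>\<^sub>M k\<in>K. std_normal_distribution) ((\<lambda>x. \<lambda>k\<in>K. n k \<bullet> x) \<circ> (\<lambda>x. \<chi> i. x $ b i))"
    unfolding gaussian_reindex[OF bij_is_inj[OF b], symmetric] by (rule distr_distr[OF m2 m1])
  then show ?thesis using * by (simp add: comp_def inner)
qed

section \<open>Rows and columns of Gaussian matrices\<close>

lemma distr_PiM_componentwise:
  assumes "finite I" "prob_space M" "f \<in> M \<rightarrow>\<^sub>M M'" "distr M M' f = M'"
  shows "distr (\<Pi>\<^sub>M i\<in>I. M) (\<Pi>\<^sub>M i\<in>I. M') (\<lambda>x. \<lambda>i\<in>I. f (x i)) = (\<Pi>\<^sub>M i\<in>I. M')"
proof -
  have "prob_space M'" using assms prob_space.prob_space_distr by metis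
  then have "distr (\<Pi>\<^sub>M i\<in>I. M) (\<Pi>\<^sub>M i\<in>I. M') (compose I f) = (\<Pi>\<^sub>M i\<in>I. distr M M' f)"
    using assms by (intro distr_PiM_finite_prob_space') auto
  then show ?thesis using assms(4) by (simp add: compose_def[abs_def])
qed

lemma measurable_component_component:
  "i \<in> I \<Longrightarrow> j \<in> J \<Longrightarrow> (\<lambda>x. x i j) \<in> (\<Pi>\<^sub>M i\<in>I. \<Pi>\<^sub>M j\<in>J. N) \<rightarrow>\<^sub>M N"
  using measurable_compose[OF measurable_component_singleton[of i I "\<lambda>_. \<Pi>\<^sub>M j\<in>J. N"]
      measurable_component_singleton[of j J "\<lambda>_. N"]] by simp

text \<open>Together with its inverse, currying, this lets families of families be rearranged through
  their index pairs.\<close>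
lemma PiM_uncurry:
  assumes I: "finite I" and J: "finite J" and N: "prob_space N"
  shows "distr (\<Pi>\<^sub>M i\<in>I. \<Pi>\<^sub>M j\<in>J. N) (\<Pi>\<^sub>M k\<in>I \<times> J. N) (\<lambda>x. \<lambda>k\<in>I \<times> J. x (fst k) (snd k)) =
    (\<Pi>\<^sub>M k\<in>I \<times> J. N)"
proof -
  interpret N: prob_space N by fact
  interpret A: product_prob_space "\<lambda>_. N" "I \<times> J" by (intro product_prob_spaceI N)
  interpret B: product_prob_space "\<lambda>_. N" J by (intro product_prob_spaceI N)
  interpret C: product_prob_space "\<lambda>_. \<Pi>\<^sub>M j\<in>J. N" I by (intro product_prob_spaceI B.prob_space_axioms)
  have meas: "(\<lambda>x. \<lambda>k\<in>I \<times> J. x (fst k) (snd k)) \<in> (\<Pi>\<^sub>M i\<in>I. \<Pi>\<^sub>M j\<in>J. N) \<rightarrow>\<^sub>M (\<Pi>\<^sub>M k\<in>I \<times> J. N)"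
    by (intro measurable_restrict measurable_component_component) auto
  show ?thesis
  proof (rule A.PiM_eqI)
    fix A assume A: "\<And>k. k \<in> I \<times> J \<Longrightarrow> A k \<in> sets N"
    have "(\<lambda>x. \<lambda>k\<in>I \<times> J. x (fst k) (snd k)) -` Pi\<^sub>E (I \<times> J) A \<inter> space (\<Pi>\<^sub>M i\<in>I. \<Pi>\<^sub>M j\<in>J. N)
      = Pi\<^sub>E I (\<lambda>i. Pi\<^sub>E J (\<lambda>j. A (i, j)))"
      using A[THEN sets.sets_into_space] by (auto simp: space_PiM PiE_iff) blast
    then have "emeasure (distr (\<Pi>\<^sub>M i\<in>I. \<Pi>\<^sub>M j\<in>J. N) (\<Pi>\<^sub>M k\<in>I \<times> J. N) (\<lambda>x. \<lambda>k\<in>I \<times> J. x (fst k) (snd k))) (Pi\<^sub>E (I \<times> J) A)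
      = emeasure (\<Pi>\<^sub>M i\<in>I. \<Pi>\<^sub>M j\<in>J. N) (Pi\<^sub>E I (\<lambda>i. Pi\<^sub>E J (\<lambda>j. A (i, j))))"
      using A I J by (subst emeasure_distr[OF meas]) (auto intro!: sets_PiM_I_finite)
    also have "\<dots> = (\<Prod>i\<in>I. emeasure (\<Pi>\<^sub>M j\<in>J. N) (Pi\<^sub>E J (\<lambda>j. A (i, j))))"
      using A I J by (intro C.emeasure_PiM) (auto intro!: sets_PiM_I_finite)
    also have "\<dots> = (\<Prod>i\<in>I. \<Prod>j\<in>J. emeasure N (A (i, j)))"
      using A J by (intro prod.cong refl B.emeasure_PiM) auto
    also have "\<dots> = (\<Prod>k\<in>I \<times> J. emeasure N (A k))" by (simp add: prod.cartesian_product)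
    finally show "emeasure (distr (\<Pi>\<^sub>M i\<in>I. \<Pi>\<^sub>M j\<in>J. N) (\<Pi>\<^sub>M k\<in>I \<times> J. N) (\<lambda>x. \<lambda>k\<in>I \<times> J. x (fst k) (snd k))) (Pi\<^sub>E (I \<times> J) A)
      = (\<Prod>k\<in>I \<times> J. emeasure N (A k))" .
  qed (use I J in auto)
qed

lemma PiM_swap:
  assumes I: "finite I" and J: "finite J" and N: "prob_space N"
  shows "distr (\<Pi>\<^sub>M i\<in>I. \<Pi>\<^sub>M j\<in>J. N) (\<Pi>\<^sub>M j\<in>J. \<Pi>\<^sub>M i\<in>I. N) (\<lambda>x. \<lambda>j\<in>J. \<lambda>i\<in>I. x i j) =
    (\<Pi>\<^sub>M j\<in>J. \<Pi>\<^sub>M i\<in>I. N)"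
proof -
  let ?u = "\<lambda>x. \<lambda>k\<in>I \<times> J. x (fst k) (snd k)"
  let ?u' = "\<lambda>x. \<lambda>k\<in>J \<times> I. x (fst k) (snd k)"
  let ?s = "\<lambda>x. \<lambda>k\<in>J \<times> I. x (prod.swap k)"
  let ?c = "\<lambda>x. \<lambda>j\<in>J. \<lambda>i\<in>I. x (j, i)"
  have u: "(\<lambda>x. \<lambda>k\<in>I \<times> J. x (fst k) (snd k)) \<in> (\<Pi>\<^sub>M i\<in>I. \<Pi>\<^sub>M j\<in>J. N) \<rightarrow>\<^sub>M (\<Pi>\<^sub>M k\<in>I \<times> J. N)" for I :: "'x set" and J :: "'y set"
    by (intro measurable_restrict measurable_component_component) auto
  have s: "?s \<in> (\<Pi>\<^sub>M k\<in>I \<times> J. N) \<rightarrow>\<^sub>M (\<Pi>\<^sub>M k\<in>J \<times> I. N)"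
    by (intro measurable_restrict measurable_component_singleton) auto
  have c: "?c \<in> (\<Pi>\<^sub>M k\<in>J \<times> I. N) \<rightarrow>\<^sub>M (\<Pi>\<^sub>M j\<in>J. \<Pi>\<^sub>M i\<in>I. N)"
    by (intro measurable_restrict measurable_component_singleton) auto
  have "distr (\<Pi>\<^sub>M i\<in>I. \<Pi>\<^sub>M j\<in>J. N) (\<Pi>\<^sub>M j\<in>J. \<Pi>\<^sub>M i\<in>I. N) (\<lambda>x. \<lambda>j\<in>J. \<lambda>i\<in>I. x i j)
    = distr (\<Pi>\<^sub>M i\<in>I. \<Pi>\<^sub>M j\<in>J. N) (\<Pi>\<^sub>M j\<in>J. \<Pi>\<^sub>M i\<in>I. N) (?c \<circ> (?s \<circ> ?u))"
    by (intro distr_cong) (auto simp: fun_eq_iff restrict_def)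
  also have "\<dots> = distr (distr (distr (\<Pi>\<^sub>M i\<in>I. \<Pi>\<^sub>M j\<in>J. N) (\<Pi>\<^sub>M k\<in>I \<times> J. N) ?u) (\<Pi>\<^sub>M k\<in>J \<times> I. N) ?s)
      (\<Pi>\<^sub>M j\<in>J. \<Pi>\<^sub>M i\<in>I. N) ?c"
    by (rule distr_distr_distr[OF u s c, symmetric])
  also have "\<dots> = distr (\<Pi>\<^sub>M k\<in>J \<times> I. N) (\<Pi>\<^sub>M j\<in>J. \<Pi>\<^sub>M i\<in>I. N) ?c"
  proof -
    have "distr (\<Pi>\<^sub>M k\<in>I \<times> J. N) (\<Pi>\<^sub>M k\<in>J \<times> I. N) ?s = (\<Pi>\<^sub>M k\<in>J \<times> I. N)"
      by (rule distr_PiM_reindex) (use N in auto)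
    then show ?thesis by (simp add: PiM_uncurry[OF I J N])
  qed
  also have "\<dots> = distr (distr (\<Pi>\<^sub>M j\<in>J. \<Pi>\<^sub>M i\<in>I. N) (\<Pi>\<^sub>M k\<in>J \<times> I. N) ?u') (\<Pi>\<^sub>M j\<in>J. \<Pi>\<^sub>M i\<in>I. N) ?c"
    by (simp add: PiM_uncurry[OF J I N])
  also have "\<dots> = distr (\<Pi>\<^sub>M j\<in>J. \<Pi>\<^sub>M i\<in>I. N) (\<Pi>\<^sub>M j\<in>J. \<Pi>\<^sub>M i\<in>I. N) (?c \<circ> ?u')"
    by (rule distr_distr[OF c u])
  also have "\<dots> = distr (\<Pi>\<^sub>M j\<in>J. \<Pi>\<^sub>M i\<in>I. N) (\<Pi>\<^sub>M j\<in>J. \<Pi>\<^sub>M i\<in>I. N) (\<lambda>x. x)"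
    by (intro distr_cong) (auto simp: space_PiM fun_eq_iff restrict_def PiE_iff extensional_def)
  also have "\<dots> = (\<Pi>\<^sub>M j\<in>J. \<Pi>\<^sub>M i\<in>I. N)" by (rule distr_id2) simp
  finally show ?thesis .
qed

lemma measurable_inner_const: "(\<lambda>x. a \<bullet> x) \<in> borel_measurable gaussian" for a :: "real ^ 'd"
  by (simp add: measurable_cong_sets[OF sets_gaussian refl])

text \<open>The vectors \<open>x a\<close> are the columns of a Gaussian matrix. Replacing each column by its
  coordinates in an orthonormal system leaves the entries independent and standard normal, and
  such entries may be grouped by rows instead of columns.\<close>
lemma gaussian_family_mixing:
  fixes n :: "'k \<Rightarrow> real ^ 'd"
  assumes K: "finite K" and n: "orthonormal_family K n"
  shows "distr (\<Pi>\<^sub>M a\<in>UNIV. gaussian) (\<Pi>\<^sub>M k\<in>K. gaussian) (\<lambda>x. \<lambda>k\<in>K. \<chi> a. n k \<bullet> x a) =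
    (\<Pi>\<^sub>M k\<in>K. (gaussian :: (real ^ 'n) measure))"
proof -
  let ?N = "std_normal_distribution"
  let ?P = "\<Pi>\<^sub>M k\<in>K. ?N" and ?Q = "\<Pi>\<^sub>M a\<in>(UNIV :: 'n set). ?N"
  interpret P: product_prob_space "\<lambda>_. ?N" K by (intro product_prob_spaceI prob_space_std_normal)
  interpret Q: product_prob_space "\<lambda>_. ?N" "UNIV :: 'n set" by (intro product_prob_spaceI prob_space_std_normal)
  let ?f = "\<lambda>x. \<lambda>a\<in>(UNIV :: 'n set). \<lambda>k\<in>K. n k \<bullet> x a"
  let ?g = "\<lambda>y. \<lambda>k\<in>K. \<lambda>a\<in>(UNIV :: 'n set). y a k"
  let ?h = "\<lambda>z. \<lambda>k\<in>K. \<chi> a. z k a"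
  have f0: "(\<lambda>x. \<lambda>k\<in>K. n k \<bullet> x) \<in> gaussian \<rightarrow>\<^sub>M ?P"
    by (intro measurable_restrict) (simp add: measurable_inner_const)
  have f: "?f \<in> (\<Pi>\<^sub>M a\<in>UNIV. gaussian) \<rightarrow>\<^sub>M (\<Pi>\<^sub>M a\<in>UNIV. ?P)"
    by (intro measurable_restrict measurable_compose[OF _ f0] measurable_component_singleton) auto
  have g: "?g \<in> (\<Pi>\<^sub>M a\<in>UNIV. ?P) \<rightarrow>\<^sub>M (\<Pi>\<^sub>M k\<in>K. ?Q)"
    by (intro measurable_restrict measurable_component_component) auto
  have h0: "(\<lambda>z. \<chi> a. z a) \<in> ?Q \<rightarrow>\<^sub>M (gaussian :: (real ^ 'n) measure)"
    unfolding measurable_cong_sets[OF refl sets_gaussian]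
    by (intro borel_measurable_vec_lambda) measurable
  have h: "?h \<in> (\<Pi>\<^sub>M k\<in>K. ?Q) \<rightarrow>\<^sub>M (\<Pi>\<^sub>M k\<in>K. gaussian)"
    by (intro measurable_restrict measurable_compose[OF _ h0] measurable_component_singleton) auto
  have ff: "distr (\<Pi>\<^sub>M a\<in>UNIV. gaussian) (\<Pi>\<^sub>M a\<in>UNIV. ?P) ?f = (\<Pi>\<^sub>M a\<in>UNIV. ?P)"
    by (intro distr_PiM_componentwise prob_space_gaussian f0 gaussian_orthonormal_coordinates K n) simp
  have gg: "distr (\<Pi>\<^sub>M a\<in>(UNIV :: 'n set). ?P) (\<Pi>\<^sub>M k\<in>K. ?Q) ?g = (\<Pi>\<^sub>M k\<in>K. ?Q)"
    by (intro PiM_swap prob_space_std_normal K) simp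
  have "distr ?Q gaussian (\<lambda>z. \<chi> a. z a) = (gaussian :: (real ^ 'n) measure)"
    unfolding distr_vec_lambda_std_normal[symmetric] by (intro distr_cong) (auto simp: distr_vec_lambda_std_normal)
  then have hh: "distr (\<Pi>\<^sub>M k\<in>K. ?Q) (\<Pi>\<^sub>M k\<in>K. gaussian) ?h = (\<Pi>\<^sub>M k\<in>K. (gaussian :: (real ^ 'n) measure))"
    by (intro distr_PiM_componentwise h0 K Q.prob_space_axioms)
  have "(\<lambda>x. \<lambda>k\<in>K. \<chi> a. n k \<bullet> x a) = ?h \<circ> (?g \<circ> ?f)"
    by (auto simp: fun_eq_iff restrict_def vec_eq_iff)
  then have "distr (\<Pi>\<^sub>M a\<in>UNIV. gaussian) (\<Pi>\<^sub>M k\<in>K. gaussian) (\<lambda>x. \<lambda>k\<in>K. \<chi> a. n k \<bullet> x a)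
    = distr (distr (distr (\<Pi>\<^sub>M a\<in>UNIV. gaussian) (\<Pi>\<^sub>M a\<in>UNIV. ?P) ?f) (\<Pi>\<^sub>M k\<in>K. ?Q) ?g) (\<Pi>\<^sub>M k\<in>K. gaussian) ?h"
    using distr_distr_distr[OF f g h] by simp
  then show ?thesis by (simp only: ff gg hh)
qed

section \<open>Measurability of the largest roots\<close>

lemma fsigma_closed: "closed S \<Longrightarrow> fsigma S"
  using fsigma.intros[of "\<lambda>_. S"] by simp

lemma fsigma_Int:
  assumes "fsigma S" "fsigma T"
  shows "fsigma (S \<inter> T)"
proof -
  obtain F G :: "nat \<Rightarrow> 'a set" where F: "\<And>n. closed (F n)" "S = (\<Union>n. F n)"
    and G: "\<And>n. closed (G n)" "T = (\<Union>n. G n)"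
    using assms by (auto elim!: fsigma.cases)
  have "fsigma (\<Union>k. F (fst (prod_decode k)) \<inter> G (snd (prod_decode k)))"
    by (intro fsigma.intros closed_Int F G)
  also have "(\<Union>k. F (fst (prod_decode k)) \<inter> G (snd (prod_decode k))) = S \<inter> T"
    unfolding F(2) G(2) by (auto, metis fst_conv snd_conv prod_encode_inverse)
  finally show ?thesis .
qed

lemma fsigma_INT:
  fixes S :: "'i \<Rightarrow> 'a::euclidean_space set"
  assumes "finite I" "\<And>i. i \<in> I \<Longrightarrow> fsigma (S i)"
  shows "fsigma (\<Inter>i\<in>I. S i)"
  using assms by (induction I rule: finite_induct) (auto intro: fsigma_Int)

lemma fsigma_open: "open S \<Longrightarrow> fsigma S" for S :: "'a::euclidean_space set"
proof -
  assume "open S"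
  then obtain D where D: "countable D" "D \<subseteq> Pow S" "\<And>X. X \<in> D \<Longrightarrow> \<exists>a b. X = cbox a b" "\<Union>D = S"
    by (rule open_countable_Union_open_cbox) blast
  show ?thesis
  proof (cases "D = {}")
    case True then show ?thesis using D(4) by (auto intro: fsigma_closed)
  next
    case False
    have "closed (from_nat_into D n)" for n
      using D(3)[OF from_nat_into[OF False, of n]] by auto
    then have "fsigma (\<Union>n. from_nat_into D n)" by (rule fsigma.intros)
    then show ?thesis using D(1,4) False by (simp add: range_from_nat_into)
  qed
qed

text \<open>An \<open>F\<^sub>\<sigma>\<close> set in a Euclidean space is a countable union of compact sets.\<close>
lemma fsigma_continuous_image:
  fixes f :: "'a::euclidean_space \<Rightarrow> 'b::euclidean_space"
  assumes S: "fsigma S" and f: "continuous_on UNIV f"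
  shows "fsigma (f ` S)"
proof -
  obtain F :: "nat \<Rightarrow> 'a set" where F: "range F \<subseteq> Collect compact" "S = (\<Union>n. F n)"
    using S unfolding fsigma_Union_compact by auto
  have "fsigma (\<Union>n. f ` F n)"
    using F(1) f by (intro fsigma.intros compact_imp_closed compact_continuous_image)
      (auto intro: continuous_on_subset)
  then show ?thesis unfolding F(2) by (simp add: image_UN)
qed

lemma fsigma_borel: "fsigma S \<Longrightarrow> S \<in> sets borel"
  by (erule fsigma.cases) auto

text \<open>Projections of general Borel sets need not be Borel, which is why conditions are kept \<open>F\<^sub>\<sigma>\<close>,
  that is, built from equations and strict inequalities between continuous functions.\<close>
lemma borel_projection:
  fixes P :: "'a::euclidean_space \<Rightarrow> 'b::euclidean_space \<Rightarrow> bool"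
  assumes "fsigma {z. P (fst z) (snd z)}"
  shows "{x. \<exists>y. P x y} \<in> sets borel"
proof -
  have "fsigma (fst ` {z. P (fst z) (snd z)})"
    by (intro fsigma_continuous_image assms continuous_intros)
  also have "fst ` {z. P (fst z) (snd z)} = {x. \<exists>y. P x y}" by (force simp: image_iff)
  finally show ?thesis by (rule fsigma_borel)
qed

lemma fsigma_vimage:
  fixes h :: "'a::topological_space \<Rightarrow> 'b::topological_space"
  assumes Q: "fsigma {y. Q y}" and h: "continuous_on UNIV h"
  shows "fsigma {z. Q (h z)}"
proof -
  obtain F :: "nat \<Rightarrow> 'b set" where F: "\<And>n. closed (F n)" "{y. Q y} = (\<Union>n. F n)"
    using Q by (auto elim!: fsigma.cases)
  have "fsigma (\<Union>n. h -` F n)"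
    using F(1) h by (intro fsigma.intros) (simp add: closed_vimage)
  also have "(\<Union>n. h -` F n) = {z. Q (h z)}"
    using F(2) unfolding set_eq_iff by simp
  finally show ?thesis .
qed

lemma fsigma_eq: "continuous_on UNIV f \<Longrightarrow> continuous_on UNIV g \<Longrightarrow> fsigma {z. f z = g z}"
  for f g :: "'a::euclidean_space \<Rightarrow> 'b::real_normed_vector"
  by (intro fsigma_closed closed_Collect_eq)

lemma fsigma_less: "continuous_on UNIV f \<Longrightarrow> continuous_on UNIV g \<Longrightarrow> fsigma {z. f z < g z}"
  for f g :: "'a::euclidean_space \<Rightarrow> real"
  by (intro fsigma_open open_Collect_less)

lemma fsigma_neq: "continuous_on UNIV f \<Longrightarrow> continuous_on UNIV g \<Longrightarrow> fsigma {z. f z \<noteq> g z}"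
  for f g :: "'a::euclidean_space \<Rightarrow> 'b::real_normed_vector"
  by (intro fsigma_open open_Collect_neq)

lemma fsigma_conj: "fsigma {z. P z} \<Longrightarrow> fsigma {z. Q z} \<Longrightarrow> fsigma {z. P z \<and> Q z}"
  using fsigma_Int[of "{z. P z}" "{z. Q z}"] by (simp add: Collect_conj_eq)

lemma fsigma_all: "(\<And>i. fsigma {z. P i z}) \<Longrightarrow> fsigma {z. \<forall>i. P i z}"
  for P :: "'i::finite \<Rightarrow> 'a::euclidean_space \<Rightarrow> bool"
  using fsigma_INT[of UNIV "\<lambda>i. {z. P i z}"] by (simp add: Collect_all_eq)

lemma continuous_on_matrix_mult [continuous_intros]:
  fixes f :: "'a::topological_space \<Rightarrow> real ^ 'n ^ 'm" and g :: "'a \<Rightarrow> real ^ 'k ^ 'n"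
  shows "continuous_on S f \<Longrightarrow> continuous_on S g \<Longrightarrow> continuous_on S (\<lambda>x. f x ** g x)"
  unfolding matrix_matrix_mult_def by (intro continuous_intros)

lemma continuous_on_matrix_vector_mult [continuous_intros]:
  fixes f :: "'a::topological_space \<Rightarrow> real ^ 'n ^ 'm" and g :: "'a \<Rightarrow> real ^ 'n"
  shows "continuous_on S f \<Longrightarrow> continuous_on S g \<Longrightarrow> continuous_on S (\<lambda>x. f x *v g x)"
  unfolding matrix_vector_mult_def by (intro continuous_intros)

lemma continuous_on_transpose [continuous_intros]:
  fixes f :: "'a::topological_space \<Rightarrow> real ^ 'n ^ 'm"
  shows "continuous_on S f \<Longrightarrow> continuous_on S (\<lambda>x. transpose (f x))"
  unfolding transpose_def by (intro continuous_intros)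

lemma continuous_on_diagonal_of [continuous_intros]:
  fixes f :: "'a::topological_space \<Rightarrow> real ^ 'n"
  shows "continuous_on S f \<Longrightarrow> continuous_on S (\<lambda>x. diagonal_of (f x))"
  unfolding diagonal_of_def
proof (intro continuous_on_vec_lambda)
  fix i j
  assume "continuous_on S f"
  then show "continuous_on S (\<lambda>x. if i = j then f x $ i else 0)"
    by (cases "i = j") (auto intro: continuous_intros)
qed

text \<open>\<open>Max {}\<close> is a fixed number about which nothing is known, so empty sets are treated
  separately; the set of points where \<open>R\<close> is empty is again determined by the sets of \<open>above\<close>.\<close>
lemma borel_measurable_Max:
  fixes R :: "'a::topological_space \<Rightarrow> real set"
  assumes fin: "\<And>x. finite (R x)" and above: "\<And>c. {x. \<exists>\<mu>\<in>R x. c < \<mu>} \<in> sets borel"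
  shows "(\<lambda>x. Max (R x)) \<in> borel_measurable borel"
proof -
  have "{x. R x \<noteq> {}} = (\<Union>n :: nat. {x. \<exists>\<mu>\<in>R x. - real n < \<mu>})"
  proof (intro set_eqI iffI)
    fix x assume "x \<in> {x. R x \<noteq> {}}"
    then obtain \<mu> where \<mu>: "\<mu> \<in> R x" by blast
    obtain n :: nat where "- \<mu> < real n" using reals_Archimedean2 by blast
    then have "- real n < \<mu>" by linarith
    with \<mu> show "x \<in> (\<Union>n :: nat. {x. \<exists>\<mu>\<in>R x. - real n < \<mu>})" by blast
  qed auto
  then have ne: "{x. R x \<noteq> {}} \<in> sets borel" using above by auto
  have "{x. R x = {}} = - {x. R x \<noteq> {}}" by auto
  then have empty: "{x. R x = {}} \<in> sets borel" using ne by (metis borel_comp)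
  have "{x. c < Max (R x)} = {x. \<exists>\<mu>\<in>R x. c < \<mu>} \<union> (if c < Max ({} :: real set) then {x. R x = {}} else {})" for c
  proof (intro set_eqI)
    fix x
    show "x \<in> {x. c < Max (R x)} \<longleftrightarrow>
      x \<in> {x. \<exists>\<mu>\<in>R x. c < \<mu>} \<union> (if c < Max ({} :: real set) then {x. R x = {}} else {})"
      using fin[of x] by (cases "R x = {}") (auto simp: Max_gr_iff)
  qed
  then have "{x. c < Max (R x)} \<in> sets borel" for c using above empty by auto
  then show ?thesis by (simp add: borel_measurable_iff_greater)
qed

lemma borel_largest_finite_root:
  "(\<lambda>(B, A). largest_finite_root TYPE('m::finite) B A) \<in> borel_measurable (borel :: ((real ^ 'p ^ 'p) \<times> (real ^ 'p ^ 'p)) measure)"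
proof -
  have "(\<lambda>z. Max (finite_roots TYPE('m) (fst z) (snd z))) \<in> borel_measurable (borel :: ((real ^ 'p ^ 'p) \<times> (real ^ 'p ^ 'p)) measure)"
  proof (rule borel_measurable_Max)
    fix c :: real
    have 1: "{z :: (real ^ 'p ^ 'p) \<times> (real ^ 'p ^ 'p). \<exists>y :: (real ^ 'm ^ 'p) \<times> (real ^ 'm).
      spectral_decomposition (snd z) (fst y) (snd y)} \<in> sets borel"
      unfolding spectral_decomposition_def
      by (intro borel_projection fsigma_conj fsigma_all fsigma_eq fsigma_less continuous_intros)
    have 2: "{z :: (real ^ 'p ^ 'p) \<times> (real ^ 'p ^ 'p). \<exists>y :: real \<times> (real ^ 'p).
      c < fst y \<and> 0 < fst y \<and> snd z *v snd y \<noteq> 0 \<and>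
      snd z *v (fst z *v (snd z *v snd y)) = fst y *\<^sub>R (snd z *v (snd z *v (snd z *v snd y)))} \<in> sets borel"
      by (intro borel_projection fsigma_conj fsigma_eq fsigma_less fsigma_neq continuous_intros)
    have eq: "{z. \<exists>\<mu>\<in>finite_roots TYPE('m) (fst z) (snd z). c < \<mu>} =
      {z :: (real ^ 'p ^ 'p) \<times> (real ^ 'p ^ 'p). \<exists>y :: (real ^ 'm ^ 'p) \<times> (real ^ 'm).
        spectral_decomposition (snd z) (fst y) (snd y)} \<inter>
      {z. \<exists>y :: real \<times> (real ^ 'p). c < fst y \<and> 0 < fst y \<and> snd z *v snd y \<noteq> 0 \<and>
        snd z *v (fst z *v (snd z *v snd y)) = fst y *\<^sub>R (snd z *v (snd z *v (snd z *v snd y)))}"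
      unfolding set_eq_iff Int_iff mem_Collect_eq Bex_def mem_finite_roots_iff split_paired_Ex fst_conv snd_conv
      by blast
    show "{z. \<exists>\<mu>\<in>finite_roots TYPE('m) (fst z) (snd z). c < \<mu>} \<in> sets (borel :: ((real ^ 'p ^ 'p) \<times> (real ^ 'p ^ 'p)) measure)"
      unfolding eq by (rule sets.Int[OF 1 2])
  qed (rule finite_finite_roots)
  then show ?thesis by (simp add: largest_finite_root_def case_prod_beta')
qed

lemma matrix_inv_singular:
  fixes V W :: "real ^ 'n ^ 'n"
  assumes "\<not> (\<exists>V'. V ** V' = mat 1)" "\<not> (\<exists>W'. W ** W' = mat 1)"
  shows "matrix_inv V = matrix_inv W"
  using assms unfolding matrix_inv_def by simp

text \<open>On invertible \<open>V\<close> the inverse is one more existentially quantified matrix, subject to a closed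
  condition. At all singular \<open>V\<close> the function \<^const>\<open>matrix_inv\<close> takes the same unspecified
  value.\<close>
lemma borel_eigenvalue_quotient:
  fixes Q :: "real \<Rightarrow> bool"
  assumes Q: "fsigma {\<mu>. Q \<mu>}"
  shows "(\<lambda>(U, V). Max {\<mu>. real_eigenvalue (U ** matrix_inv V) \<mu> \<and> Q \<mu>})
    \<in> borel_measurable (borel :: ((real ^ 'n ^ 'n) \<times> (real ^ 'n ^ 'n)) measure)"
proof -
  have "(\<lambda>z. Max {\<mu>. real_eigenvalue (fst z ** matrix_inv (snd z)) \<mu> \<and> Q \<mu>})
    \<in> borel_measurable (borel :: ((real ^ 'n ^ 'n) \<times> (real ^ 'n ^ 'n)) measure)"
  proof (rule borel_measurable_Max)
    fix z :: "(real ^ 'n ^ 'n) \<times> (real ^ 'n ^ 'n)"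
    show "finite {\<mu>. real_eigenvalue (fst z ** matrix_inv (snd z)) \<mu> \<and> Q \<mu>}"
      using finite_real_eigenvalues by (rule rev_finite_subset) auto
  next
    fix c :: real
    let ?G = "{z :: (real ^ 'n ^ 'n) \<times> (real ^ 'n ^ 'n). \<exists>V'. snd z ** V' = mat 1}"
    note Qf = fsigma_vimage[OF Q]
    (* the value of the inverse at every singular matrix, the zero matrix being one of them *)
    define C where "C = matrix_inv (0 :: real ^ 'n ^ 'n)"
    have 1: "?G \<in> sets borel"
      by (intro borel_projection fsigma_eq continuous_intros)
    have 2: "{z :: (real ^ 'n ^ 'n) \<times> (real ^ 'n ^ 'n). \<exists>y :: (real ^ 'n ^ 'n) \<times> real \<times> (real ^ 'n).
      snd z ** fst y = mat 1 \<and> c < fst (snd y) \<and> Q (fst (snd y)) \<and> snd (snd y) \<noteq> 0 \<and>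
      (fst z ** fst y) *v snd (snd y) = fst (snd y) *\<^sub>R snd (snd y)} \<in> sets borel"
      by (intro borel_projection fsigma_conj Qf fsigma_eq fsigma_less fsigma_neq continuous_intros)
    have 3: "{z :: (real ^ 'n ^ 'n) \<times> (real ^ 'n ^ 'n). \<exists>y :: real \<times> (real ^ 'n).
      c < fst y \<and> Q (fst y) \<and> snd y \<noteq> 0 \<and> (fst z ** C) *v snd y = fst y *\<^sub>R snd y} \<in> sets borel"
      by (intro borel_projection fsigma_conj Qf fsigma_eq fsigma_less fsigma_neq continuous_intros)
    have inv: "V' = matrix_inv V" if "V ** V' = mat 1" for V V' :: "real ^ 'n ^ 'n"
      using matrix_inv_inverse[OF that] that by (metis matrix_mul_assoc matrix_mul_lid matrix_mul_rid)
    have sing: "matrix_inv V = C" if "\<not> (\<exists>V'. V ** V' = mat 1)" for V :: "real ^ 'n ^ 'n"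
      unfolding C_def
    proof (rule matrix_inv_singular[OF that])
      show "\<not> (\<exists>W'. (0 :: real ^ 'n ^ 'n) ** W' = mat 1)"
        by (auto simp: vec_eq_iff matrix_matrix_mult_def mat_def)
    qed
    have eq: "{z. \<exists>\<mu>\<in>{\<mu>. real_eigenvalue (fst z ** matrix_inv (snd z)) \<mu> \<and> Q \<mu>}. c < \<mu>} =
      {z :: (real ^ 'n ^ 'n) \<times> (real ^ 'n ^ 'n). \<exists>y :: (real ^ 'n ^ 'n) \<times> real \<times> (real ^ 'n).
      snd z ** fst y = mat 1 \<and> c < fst (snd y) \<and> Q (fst (snd y)) \<and> snd (snd y) \<noteq> 0 \<and>
      (fst z ** fst y) *v snd (snd y) = fst (snd y) *\<^sub>R snd (snd y)} \<union>
      ({z :: (real ^ 'n ^ 'n) \<times> (real ^ 'n ^ 'n). \<exists>y :: real \<times> (real ^ 'n).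
      c < fst y \<and> Q (fst y) \<and> snd y \<noteq> 0 \<and> (fst z ** C) *v snd y = fst y *\<^sub>R snd y} - ?G)" (is "?L = ?R")
    proof (intro set_eqI)
      fix z :: "(real ^ 'n ^ 'n) \<times> (real ^ 'n ^ 'n)"
      have L: "z \<in> ?L \<longleftrightarrow> (\<exists>\<mu> v. c < \<mu> \<and> Q \<mu> \<and> v \<noteq> 0 \<and> (fst z ** matrix_inv (snd z)) *v v = \<mu> *\<^sub>R v)"
        by (auto simp: real_eigenvalue_def)
      show "z \<in> ?L \<longleftrightarrow> z \<in> ?R"
      proof (cases "\<exists>V'. snd z ** V' = mat 1")
        case True
        then have V: "snd z ** V' = mat 1 \<longleftrightarrow> V' = matrix_inv (snd z)" for V'
          using inv matrix_inv_inverse(1) by blast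
        show ?thesis unfolding L using True by (auto simp: V)
      next
        case False
        then show ?thesis unfolding L by (auto simp: sing)
      qed
    qed
    show "{z. \<exists>\<mu>\<in>{\<mu>. real_eigenvalue (fst z ** matrix_inv (snd z)) \<mu> \<and> Q \<mu>}. c < \<mu>}
      \<in> sets (borel :: ((real ^ 'n ^ 'n) \<times> (real ^ 'n ^ 'n)) measure)"
      unfolding eq by (rule sets.Un[OF 2 sets.Diff[OF 3 1]])
  qed
  then show ?thesis by (simp add: case_prod_beta')
qed

lemma borel_largest_nonzero_eigenvalue_quotient:
  "(\<lambda>(U, V). largest_nonzero_eigenvalue (U ** matrix_inv V))
    \<in> borel_measurable (borel :: ((real ^ 'n ^ 'n) \<times> (real ^ 'n ^ 'n)) measure)"
  unfolding largest_nonzero_eigenvalue_def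
  by (rule borel_eigenvalue_quotient) (intro fsigma_neq continuous_intros)

lemma borel_lambda_max_quotient:
  "(\<lambda>(U, V). lambda_max (U ** matrix_inv V))
    \<in> borel_measurable (borel :: ((real ^ 'n ^ 'n) \<times> (real ^ 'n ^ 'n)) measure)"
  using borel_eigenvalue_quotient[of "\<lambda>_. True"] by (simp add: lambda_max_def)

section \<open>Wishart matrices from Gaussian families\<close>

text \<open>The matrix \<open>\<Sum> g\<^sub>k g\<^sub>k\<^sup>T\<close>.\<close>
definition scatter :: "'k set \<Rightarrow> ('k \<Rightarrow> real ^ 'd) \<Rightarrow> real ^ 'd ^ 'd" where
  "scatter K g = (\<chi> i j. \<Sum>k\<in>K. g k $ i * g k $ j)"

definition matrix_of_columns :: "('k::finite \<Rightarrow> real ^ 'd) \<Rightarrow> real ^ 'k ^ 'd" where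
  "matrix_of_columns x = (\<chi> i j. x j $ i)"

lemma scatter_restrict [simp]: "scatter K (\<lambda>k\<in>K. f k) = scatter K f"
  by (simp add: scatter_def)

lemma scatter_UNIV: "scatter UNIV x = matrix_of_columns x ** transpose (matrix_of_columns x)"
  by (simp add: scatter_def matrix_of_columns_def matrix_matrix_mult_def transpose_def)

lemma measurable_from_gaussian [simp]: "gaussian \<rightarrow>\<^sub>M N = borel \<rightarrow>\<^sub>M N"
  by (rule measurable_cong_sets) auto

lemma measurable_to_gaussian [simp]: "M \<rightarrow>\<^sub>M gaussian = M \<rightarrow>\<^sub>M borel"
  by (rule measurable_cong_sets) auto

lemma measurable_gaussian_component:
  "k \<in> K \<Longrightarrow> (\<lambda>g. g k) \<in> (\<Pi>\<^sub>M k\<in>K. (gaussian :: (real ^ 'd) measure)) \<rightarrow>\<^sub>M borel"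
  using measurable_component_singleton[of k K "\<lambda>_. gaussian :: (real ^ 'd) measure"] by simp

lemma measurable_gaussian_entry:
  "k \<in> K \<Longrightarrow> (\<lambda>g. g k $ i) \<in> borel_measurable (\<Pi>\<^sub>M k\<in>K. (gaussian :: (real ^ 'd) measure))"
  by (rule measurable_compose[OF measurable_gaussian_component borel_measurable_vec_nth])

lemma measurable_scatter: "scatter K \<in> (\<Pi>\<^sub>M k\<in>K. (gaussian :: (real ^ 'd) measure)) \<rightarrow>\<^sub>M borel"
  unfolding scatter_def[abs_def]
  by (intro borel_measurable_vec_lambda borel_measurable_sum borel_measurable_times measurable_gaussian_entry)

lemma measurable_matrix_of_columns:
  "matrix_of_columns \<in> (\<Pi>\<^sub>M k\<in>(UNIV :: 'k::finite set). (gaussian :: (real ^ 'd) measure)) \<rightarrow>\<^sub>M borel"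
  unfolding matrix_of_columns_def[abs_def]
  by (intro borel_measurable_vec_lambda measurable_gaussian_entry) simp

lemma prob_space_PiM_gaussian: "prob_space (\<Pi>\<^sub>M k\<in>K. (gaussian :: (real ^ 'd) measure))"
  by (intro prob_space_PiM prob_space_gaussian)

text \<open>Only the number of summands matters, so columns may be indexed by any finite set, in particular
  by the elements of a type.\<close>
lemma wishart_card_eq_distr:
  assumes K: "finite K"
  shows "wishart (card K) (mat 1 :: real ^ 'd ^ 'd) = distr (\<Pi>\<^sub>M k\<in>K. gaussian) borel (scatter K)"
proof -
  obtain h where h: "bij_betw h K {..<card K}"
    using K by (metis finite_same_card_bij finite_lessThan card_lessThan)
  let ?r = "\<lambda>\<omega>. \<lambda>k\<in>K. \<omega> (h k) :: real ^ 'd"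
  have r: "?r \<in> (\<Pi>\<^sub>M k\<in>{..<card K}. gaussian) \<rightarrow>\<^sub>M (\<Pi>\<^sub>M k\<in>K. gaussian)"
    using h by (intro measurable_restrict) (auto intro!: measurable_gaussian_component simp: bij_betw_def)
  have "distr (\<Pi>\<^sub>M k\<in>{..<card K}. gaussian) (\<Pi>\<^sub>M k\<in>K. gaussian) ?r = (\<Pi>\<^sub>M k\<in>K. gaussian)"
    by (rule distr_PiM_reindex) (use h prob_space_gaussian in \<open>auto simp: bij_betw_def\<close>)
  then have "distr (\<Pi>\<^sub>M k\<in>K. gaussian) borel (scatter K)
    = distr (distr (\<Pi>\<^sub>M k\<in>{..<card K}. gaussian) (\<Pi>\<^sub>M k\<in>K. gaussian) ?r) borel (scatter K)" by simp
  also have "\<dots> = distr (\<Pi>\<^sub>M k\<in>{..<card K}. gaussian) borel (scatter K \<circ> ?r)"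
    by (rule distr_distr[OF measurable_scatter r])
  also have "scatter K \<circ> ?r = (\<lambda>g. \<chi> i j. \<Sum>k<card K. g k $ i * g k $ j)"
  proof
    fix g :: "nat \<Rightarrow> real ^ 'd"
    have "(\<Sum>k\<in>K. g (h k) $ i * g (h k) $ j) = (\<Sum>k<card K. g k $ i * g k $ j)" for i j
      by (rule sum.reindex_bij_betw[OF h])
    then show "(scatter K \<circ> ?r) g = (\<chi> i j. \<Sum>k<card K. g k $ i * g k $ j)"
      by (simp add: scatter_def)
  qed
  finally show ?thesis by (simp add: wishart_def)
qed

lemma sets_wishart [simp]: "sets (wishart r S) = sets borel"
  and space_wishart [simp]: "space (wishart r S) = UNIV"
  by (simp_all add: wishart_def)

lemma prob_space_wishart: "prob_space (wishart r (mat 1 :: real ^ 'd ^ 'd))"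
proof -
  interpret prob_space "\<Pi>\<^sub>M k\<in>{..<r}. (gaussian :: (real ^ 'd) measure)" by (rule prob_space_PiM_gaussian)
  have w: "wishart r (mat 1 :: real ^ 'd ^ 'd) = distr (\<Pi>\<^sub>M k\<in>{..<r}. gaussian) borel (scatter {..<r})"
    using wishart_card_eq_distr[of "{..<r}"] by simp
  show ?thesis unfolding w by (rule prob_space_distr[OF measurable_scatter])
qed

text \<open>The entries of \<open>\<Sum>\<^sub>k (n\<^sub>k \<bullet> x\<^sub>a) (n\<^sub>k \<bullet> x\<^sub>b)\<close> are inner products of projections of the vectors
  \<open>x\<^sub>a\<close>. The number of degrees of freedom is the dimension projected onto.\<close>
lemma wishart_eq_distr_mixing:
  fixes n :: "'k \<Rightarrow> real ^ 'd"
  assumes K: "finite K" and n: "orthonormal_family K n"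
  shows "distr (\<Pi>\<^sub>M a\<in>UNIV. gaussian) borel (\<lambda>x. scatter K (\<lambda>k. \<chi> a. n k \<bullet> x a)) =
    wishart (card K) (mat 1 :: real ^ 'n ^ 'n)"
proof -
  let ?f = "\<lambda>x. \<lambda>k\<in>K. (\<chi> a. n k \<bullet> x a) :: real ^ 'n"
  have f: "?f \<in> (\<Pi>\<^sub>M a\<in>UNIV. gaussian) \<rightarrow>\<^sub>M (\<Pi>\<^sub>M k\<in>K. gaussian)"
    unfolding measurable_to_gaussian
    by (intro measurable_restrict)
      (auto intro!: borel_measurable_vec_lambda borel_measurable_inner measurable_gaussian_component)
  have "wishart (card K) (mat 1 :: real ^ 'n ^ 'n) = distr (distr (\<Pi>\<^sub>M a\<in>UNIV. gaussian) (\<Pi>\<^sub>M k\<in>K. gaussian) ?f) borel (scatter K)"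
    unfolding gaussian_family_mixing[OF K n] by (rule wishart_card_eq_distr[OF K])
  also have "\<dots> = distr (\<Pi>\<^sub>M a\<in>UNIV. gaussian) borel (scatter K \<circ> ?f)"
    by (rule distr_distr[OF measurable_scatter f])
  finally show ?thesis by (simp add: comp_def)
qed

lemma wishart_eq_distr_gram:
  "distr (\<Pi>\<^sub>M a\<in>UNIV. (gaussian :: (real ^ 'd) measure)) borel
      (\<lambda>x. transpose (matrix_of_columns x) ** matrix_of_columns x) =
    wishart CARD('d) (mat 1 :: real ^ 'n ^ 'n)"
proof -
  have "orthonormal_family UNIV (\<lambda>k :: 'd. axis k (1 :: real))"
    by (simp add: orthonormal_family_def inner_axis_axis)
  from wishart_eq_distr_mixing[OF finite this]
  have "distr (\<Pi>\<^sub>M a\<in>UNIV. gaussian) borel (\<lambda>x. scatter UNIV (\<lambda>k :: 'd. \<chi> a. axis k 1 \<bullet> x a)) =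
    wishart CARD('d) (mat 1 :: real ^ 'n ^ 'n)" by simp
  moreover have "scatter UNIV (\<lambda>k :: 'd. \<chi> a. axis k 1 \<bullet> x a) = transpose (matrix_of_columns x) ** matrix_of_columns x"
    for x :: "'n \<Rightarrow> real ^ 'd"
    by (simp add: scatter_def matrix_of_columns_def matrix_matrix_mult_def transpose_def inner_axis')
  ultimately show ?thesis by simp
qed

text \<open>Each vector is expressed by its coordinates along the orthonormal columns of \<open>H\<close>.\<close>
lemma distr_gaussian_compression:
  fixes H :: "real ^ 'm ^ 'p"
  assumes H: "transpose H ** H = mat 1" and K: "finite K"
  shows "distr (\<Pi>\<^sub>M k\<in>K. gaussian) (\<Pi>\<^sub>M k\<in>K. gaussian) (\<lambda>y. \<lambda>k\<in>K. transpose H *v y k) = (\<Pi>\<^sub>M k\<in>K. gaussian)"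
proof (intro distr_PiM_componentwise K prob_space_gaussian)
  show m: "(*v) (transpose H) \<in> gaussian \<rightarrow>\<^sub>M gaussian"
    by (simp, intro borel_measurable_continuous_onI continuous_intros)
  have on: "orthonormal_family UNIV (\<lambda>i. column i H)"
    using H by (simp add: orthonormal_family_def matrix_mult_transpose_dot_column vec_eq_iff mat_def)
  have m1: "(\<lambda>x. \<lambda>i\<in>UNIV. column i H \<bullet> x) \<in> gaussian \<rightarrow>\<^sub>M (\<Pi>\<^sub>M i\<in>UNIV. std_normal_distribution)"
    by (intro measurable_restrict) simp
  have m2: "(\<lambda>f. \<chi> i. f i) \<in> (\<Pi>\<^sub>M i\<in>UNIV. std_normal_distribution) \<rightarrow>\<^sub>M (borel :: (real ^ 'm) measure)"
    by (intro borel_measurable_vec_lambda) measurable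
  have "distr gaussian borel ((\<lambda>f. \<chi> i. f i) \<circ> (\<lambda>x. \<lambda>i\<in>UNIV. column i H \<bullet> x)) = (gaussian :: (real ^ 'm) measure)"
    using gaussian_orthonormal_coordinates[OF finite on] distr_distr[OF m2 m1]
    by (simp only: distr_vec_lambda_std_normal)
  moreover have "(\<lambda>f. \<chi> i. f i) \<circ> (\<lambda>x. \<lambda>i\<in>UNIV. column i H \<bullet> x) = (*v) (transpose H)"
    by (simp add: fun_eq_iff vec_eq_iff column_def matrix_vector_mult_def transpose_def inner_vec_def)
  ultimately have "distr gaussian borel ((*v) (transpose H)) = gaussian" by simp
  then show "distr gaussian gaussian ((*v) (transpose H)) = gaussian"
    by (metis distr_cong sets_gaussian)
qed

section \<open>Conditioning and almost sure full rank\<close>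

text \<open>Two functions of a pair have the same law if they have the same conditional law given almost
  every value of the first component. The second components may live on different spaces.\<close>
lemma distr_pair_eqI:
  assumes Q: "prob_space Q" and R: "prob_space R"
    and f: "f \<in> P \<Otimes>\<^sub>M Q \<rightarrow>\<^sub>M S" and g: "g \<in> P \<Otimes>\<^sub>M R \<rightarrow>\<^sub>M S"
    and eq: "AE x in P. distr Q S (\<lambda>y. f (x, y)) = distr R S (\<lambda>y. g (x, y))"
  shows "distr (P \<Otimes>\<^sub>M Q) S f = distr (P \<Otimes>\<^sub>M R) S g"
proof (rule measure_eqI)
  interpret Q: prob_space Q by fact
  interpret R: prob_space R by fact
  fix A assume "A \<in> sets (distr (P \<Otimes>\<^sub>M Q) S f)"
  then have A: "A \<in> sets S" by simp
  have cut_f: "Pair x -` (f -` A \<inter> space (P \<Otimes>\<^sub>M Q)) = (\<lambda>y. f (x, y)) -` A \<inter> space Q" if "x \<in> space P" for x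
    using that by (auto simp: space_pair_measure)
  have cut_g: "Pair x -` (g -` A \<inter> space (P \<Otimes>\<^sub>M R)) = (\<lambda>y. g (x, y)) -` A \<inter> space R" if "x \<in> space P" for x
    using that by (auto simp: space_pair_measure)
  have "emeasure (distr (P \<Otimes>\<^sub>M Q) S f) A = (\<integral>\<^sup>+ x. emeasure Q (Pair x -` (f -` A \<inter> space (P \<Otimes>\<^sub>M Q))) \<partial>P)"
    using A f by (simp add: emeasure_distr Q.emeasure_pair_measure_alt measurable_sets)
  also have "\<dots> = (\<integral>\<^sup>+ x. emeasure R (Pair x -` (g -` A \<inter> space (P \<Otimes>\<^sub>M R))) \<partial>P)"
  proof (rule nn_integral_cong_AE, use eq in eventually_elim)
    fix x assume *: "distr Q S (\<lambda>y. f (x, y)) = distr R S (\<lambda>y. g (x, y))"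
    show "emeasure Q (Pair x -` (f -` A \<inter> space (P \<Otimes>\<^sub>M Q))) = emeasure R (Pair x -` (g -` A \<inter> space (P \<Otimes>\<^sub>M R)))"
    proof (cases "x \<in> space P")
      case True
      have "(\<lambda>y. f (x, y)) \<in> Q \<rightarrow>\<^sub>M S" "(\<lambda>y. g (x, y)) \<in> R \<rightarrow>\<^sub>M S"
        using f g True by (auto intro: measurable_Pair2)
      then show ?thesis
        unfolding cut_f[OF True] cut_g[OF True]
        using arg_cong[OF *, of "\<lambda>M. emeasure M A"] A by (simp add: emeasure_distr)
    next
      case False
      then have "Pair x -` (f -` A \<inter> space (P \<Otimes>\<^sub>M Q)) = {}" "Pair x -` (g -` A \<inter> space (P \<Otimes>\<^sub>M R)) = {}"
        by (auto simp: space_pair_measure)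
      then show ?thesis by simp
    qed
  qed
  also have "\<dots> = emeasure (distr (P \<Otimes>\<^sub>M R) S g) A"
    using A g by (simp add: emeasure_distr R.emeasure_pair_measure_alt measurable_sets)
  finally show "emeasure (distr (P \<Otimes>\<^sub>M Q) S f) A = emeasure (distr (P \<Otimes>\<^sub>M R) S g) A" .
qed simp

lemma AE_gaussian_notin_subspace:
  fixes T :: "(real ^ 'p) set"
  assumes "subspace T" "dim T < CARD('p)"
  shows "AE x in gaussian. x \<notin> T"
proof -
  have "negligible T" using assms(2) by (intro negligible_lowdim) simp
  then have "T \<in> null_sets lebesgue" by (simp add: negligible_iff_null_sets)
  moreover have "T \<in> sets lborel" using closed_subspace[OF assms(1)] by simp
  ultimately have "T \<in> null_sets lborel" using null_sets_completion_iff by blast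
  then have "AE x in lborel. x \<notin> T" by (rule AE_not_in)
  then show ?thesis unfolding gaussian_eq_density by (subst AE_density) (auto elim: eventually_mono)
qed

text \<open>Given the other vectors, \<open>x j\<close> avoids their span, a subspace of dimension at most \<open>m - 1 < p\<close>.\<close>
lemma AE_gaussian_column_independent:
  fixes j :: "'m::finite"
  assumes le: "CARD('m) \<le> CARD('p)"
  shows "AE x in (\<Pi>\<^sub>M i\<in>UNIV. (gaussian :: (real ^ 'p) measure)). \<not> (\<exists>c :: real ^ 'm. c $ j = 0 \<and> x j = (\<Sum>i\<in>UNIV. c $ i *\<^sub>R x i))"
proof -
  let ?g = "gaussian :: (real ^ 'p) measure"
  let ?D = "\<lambda>x. \<exists>c :: real ^ 'm. c $ j = 0 \<and> x j = (\<Sum>i\<in>UNIV. c $ i *\<^sub>R x i)"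
  let ?I = "- {j}"
  have ins: "insert j ?I = UNIV" by auto
  interpret g: prob_space ?g by (rule prob_space_gaussian)
  interpret I: prob_space "\<Pi>\<^sub>M i\<in>?I. ?g" by (rule prob_space_PiM_gaussian)
  interpret P: pair_sigma_finite ?g "\<Pi>\<^sub>M i\<in>?I. ?g" ..
  have eq: "distr (?g \<Otimes>\<^sub>M (\<Pi>\<^sub>M i\<in>?I. ?g)) (\<Pi>\<^sub>M i\<in>UNIV. ?g) (\<lambda>(x, X). X(j := x)) = (\<Pi>\<^sub>M i\<in>UNIV. ?g)"
    using distr_pair_PiM_eq_PiM[of ?I "\<lambda>_. ?g" j] prob_space_gaussian unfolding ins by blast
  have meas: "(\<lambda>(x, X). X(j := x)) \<in> ?g \<Otimes>\<^sub>M (\<Pi>\<^sub>M i\<in>?I. ?g) \<rightarrow>\<^sub>M (\<Pi>\<^sub>M i\<in>UNIV. ?g)"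
  proof -
    have "(\<lambda>(x, X). X(j := x)) = (\<lambda>(X, x). X(j := x)) \<circ> (\<lambda>(x :: real ^ 'p, X :: 'm \<Rightarrow> real ^ 'p). (X, x))" by auto
    then show ?thesis
      using measurable_comp[OF measurable_pair_swap' measurable_add_dim[of j ?I "\<lambda>_. ?g"]]
      unfolding ins by simp
  qed
  have D_set: "{x \<in> space (\<Pi>\<^sub>M i\<in>UNIV. ?g). ?D x} \<in> sets (\<Pi>\<^sub>M i\<in>(UNIV :: 'm set). ?g)"
  proof -
    have "{M :: real ^ 'm ^ 'p. \<exists>c :: real ^ 'm. c $ j = 0 \<and> column j M = M *v c} \<in> sets borel"
      unfolding column_def
      by (intro borel_projection fsigma_conj fsigma_eq continuous_intros)
    from measurable_sets[OF measurable_matrix_of_columns this]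
    have "matrix_of_columns -` {M :: real ^ 'm ^ 'p. \<exists>c. c $ j = 0 \<and> column j M = M *v c} \<inter> space (\<Pi>\<^sub>M i\<in>UNIV. ?g)
      \<in> sets (\<Pi>\<^sub>M i\<in>UNIV. ?g)" .
    also have "matrix_of_columns -` {M :: real ^ 'm ^ 'p. \<exists>c. c $ j = 0 \<and> column j M = M *v c} \<inter> space (\<Pi>\<^sub>M i\<in>UNIV. ?g)
      = {x \<in> space (\<Pi>\<^sub>M i\<in>UNIV. ?g). ?D x}"
    proof -
      have "column j (matrix_of_columns x) = x j" for x :: "'m \<Rightarrow> real ^ 'p"
        by (simp add: column_def matrix_of_columns_def)
      moreover have "matrix_of_columns x *v c = (\<Sum>i\<in>UNIV. c $ i *\<^sub>R x i)" for x :: "'m \<Rightarrow> real ^ 'p" and c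
        by (simp add: matrix_of_columns_def matrix_vector_mult_def vec_eq_iff mult.commute)
      ultimately show ?thesis by auto
    qed
    finally show ?thesis .
  qed
  (* the other vectors have to be fixed first, which is the reverse of the order of the factors *)
  have "AE X in (\<Pi>\<^sub>M i\<in>?I. ?g). AE x in ?g. \<not> ?D (X(j := x))"
  proof (rule always_eventually, rule allI)
    fix X :: "'m \<Rightarrow> real ^ 'p"
    let ?T = "span (X ` ?I)"
    have "dim ?T \<le> card (X ` ?I)" by (simp add: dim_le_card')
    also have "\<dots> \<le> card ?I" by (rule card_image_le) simp
    also have "\<dots> < CARD('m)" by (rule psubset_card_mono) auto
    finally have "dim ?T < CARD('p)" using le by simp
    then have "AE x in ?g. x \<notin> ?T" by (intro AE_gaussian_notin_subspace) auto
    then show "AE x in ?g. \<not> ?D (X(j := x))"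
    proof eventually_elim
      fix x assume "x \<notin> ?T"
      show "\<not> ?D (X(j := x))"
      proof
        assume "?D (X(j := x))"
        then obtain c :: "real ^ 'm" where c: "c $ j = 0" "x = (\<Sum>i\<in>UNIV. c $ i *\<^sub>R (X(j := x)) i)" by auto
        note c(2)
        also have "(\<Sum>i\<in>UNIV. c $ i *\<^sub>R (X(j := x)) i) = (\<Sum>i\<in>?I. c $ i *\<^sub>R (X(j := x)) i)"
          using c(1) by (intro sum.mono_neutral_right) auto
        also have "\<dots> = (\<Sum>i\<in>?I. c $ i *\<^sub>R X i)" by (intro sum.cong) auto
        also have "\<dots> \<in> ?T" by (intro span_sum span_scale span_base) auto
        finally show False using \<open>x \<notin> ?T\<close> by simp
      qed
    qed
  qed
  moreover have "{z \<in> space (?g \<Otimes>\<^sub>M (\<Pi>\<^sub>M i\<in>?I. ?g)). \<not> ?D ((snd z)(j := fst z))} \<in> sets (?g \<Otimes>\<^sub>M (\<Pi>\<^sub>M i\<in>?I. ?g))"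
  proof -
    have "(\<lambda>(x, X). X(j := x)) -` {x \<in> space (\<Pi>\<^sub>M i\<in>UNIV. ?g). ?D x} \<inter> space (?g \<Otimes>\<^sub>M (\<Pi>\<^sub>M i\<in>?I. ?g))
      \<in> sets (?g \<Otimes>\<^sub>M (\<Pi>\<^sub>M i\<in>?I. ?g))" by (rule measurable_sets[OF meas D_set])
    also have "(\<lambda>(x, X). X(j := x)) -` {x \<in> space (\<Pi>\<^sub>M i\<in>UNIV. ?g). ?D x} \<inter> space (?g \<Otimes>\<^sub>M (\<Pi>\<^sub>M i\<in>?I. ?g))
      = {z \<in> space (?g \<Otimes>\<^sub>M (\<Pi>\<^sub>M i\<in>?I. ?g)). ?D ((snd z)(j := fst z))}"
      unfolding case_prod_beta' by (simp add: space_PiM vimage_def Int_def conj_commute)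
    finally show ?thesis by (rule sets.sets_Collect_neg)
  qed
  ultimately have "AE z in ?g \<Otimes>\<^sub>M (\<Pi>\<^sub>M i\<in>?I. ?g). \<not> ?D ((snd z)(j := fst z))"
    using P.AE_commute[of "\<lambda>x X. \<not> ?D (X(j := x))"] by (intro P.AE_pair_measure) auto
  then have "AE x in distr (?g \<Otimes>\<^sub>M (\<Pi>\<^sub>M i\<in>?I. ?g)) (\<Pi>\<^sub>M i\<in>UNIV. ?g) (\<lambda>(x, X). X(j := x)). \<not> ?D x"
    by (subst AE_distr_iff[OF meas sets.sets_Collect_neg[OF D_set]]) (simp add: case_prod_beta')
  then show ?thesis unfolding eq .
qed

lemma AE_gaussian_full_column_rank:
  assumes le: "CARD('m::finite) \<le> CARD('p)"
  shows "AE x in (\<Pi>\<^sub>M i\<in>UNIV. (gaussian :: (real ^ 'p) measure)).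
    \<forall>v :: real ^ 'm. matrix_of_columns x *v v = 0 \<longrightarrow> v = 0"
proof -
  have "AE x in (\<Pi>\<^sub>M i\<in>UNIV. (gaussian :: (real ^ 'p) measure)).
    \<forall>j\<in>UNIV. \<not> (\<exists>c :: real ^ 'm. c $ j = 0 \<and> x j = (\<Sum>i\<in>UNIV. c $ i *\<^sub>R x i))"
    by (intro AE_finite_allI AE_gaussian_column_independent le) simp
  then show ?thesis
  proof eventually_elim
    fix x :: "'m \<Rightarrow> real ^ 'p"
    assume ind: "\<forall>j\<in>UNIV. \<not> (\<exists>c :: real ^ 'm. c $ j = 0 \<and> x j = (\<Sum>i\<in>UNIV. c $ i *\<^sub>R x i))"
    show "\<forall>v :: real ^ 'm. matrix_of_columns x *v v = 0 \<longrightarrow> v = 0"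
    proof (intro allI impI, rule ccontr)
      fix v :: "real ^ 'm" assume v: "matrix_of_columns x *v v = 0" "v \<noteq> 0"
      then obtain j where j: "v $ j \<noteq> 0" by (auto simp: vec_eq_iff)
      have "(\<Sum>i\<in>UNIV. v $ i *\<^sub>R x i) = 0"
        using v(1) by (simp add: matrix_of_columns_def matrix_vector_mult_def vec_eq_iff mult.commute)
      then have vj: "v $ j *\<^sub>R x j + (\<Sum>i\<in>-{j}. v $ i *\<^sub>R x i) = 0"
        by (simp add: sum.remove[of UNIV j] Compl_eq_Diff_UNIV)
      (* a relation with v j nonzero is solved for x j *)
      define c :: "real ^ 'm" where "c = (\<chi> i. if i = j then 0 else - v $ i / v $ j)"
      have "x j = (1 / v $ j) *\<^sub>R (v $ j *\<^sub>R x j)" using j by simp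
      also have "v $ j *\<^sub>R x j = (\<Sum>i\<in>-{j}. - (v $ i *\<^sub>R x i))"
        using vj by (simp add: sum_negf eq_neg_iff_add_eq_0)
      also have "(1 / v $ j) *\<^sub>R (\<Sum>i\<in>-{j}. - (v $ i *\<^sub>R x i)) = (\<Sum>i\<in>-{j}. c $ i *\<^sub>R x i)"
        unfolding scaleR_sum_right by (rule sum.cong) (auto simp: c_def)
      also have "\<dots> = (\<Sum>i\<in>UNIV. c $ i *\<^sub>R x i)"
        by (intro sum.mono_neutral_left) (auto simp: c_def)
      finally have "x j = (\<Sum>i\<in>UNIV. c $ i *\<^sub>R x i)" .
      moreover have "c $ j = 0" by (simp add: c_def)
      ultimately show False using ind by blast
    qed
  qed
qed

text \<open>Splits the columns of a Gaussian matrix into those indexed by \<open>\<sigma>\<close> and the others.\<close>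
lemma distr_PiM_split:
  fixes \<sigma> :: "'q::finite \<Rightarrow> 'm::finite"
  assumes \<sigma>: "inj \<sigma>" and g: "prob_space g"
  shows "distr ((\<Pi>\<^sub>M c\<in>- range \<sigma>. g) \<Otimes>\<^sub>M (\<Pi>\<^sub>M a\<in>UNIV. g)) (\<Pi>\<^sub>M c\<in>UNIV. g)
      (\<lambda>(d, e) c. if c \<in> range \<sigma> then e (inv \<sigma> c) else d c) = (\<Pi>\<^sub>M c\<in>UNIV. g)" (is "?L = _")
    and "(\<lambda>(d, e) c. if c \<in> range \<sigma> then e (inv \<sigma> c) else d c) \<in>
      (\<Pi>\<^sub>M c\<in>- range \<sigma>. g) \<Otimes>\<^sub>M (\<Pi>\<^sub>M a\<in>UNIV. g) \<rightarrow>\<^sub>M (\<Pi>\<^sub>M c\<in>UNIV. g)" (is "?t \<in> _")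
proof -
  interpret m: product_prob_space "\<lambda>_. g" "UNIV :: 'm set" by (intro product_prob_spaceI g)
  interpret d: product_prob_space "\<lambda>_. g" "- range \<sigma>" by (intro product_prob_spaceI g)
  interpret e: product_prob_space "\<lambda>_. g" "UNIV :: 'q set" by (intro product_prob_spaceI g)
  let ?D = "\<Pi>\<^sub>M c\<in>- range \<sigma>. g" and ?E = "\<Pi>\<^sub>M a\<in>(UNIV :: 'q set). g"
  show t: "?t \<in> ?D \<Otimes>\<^sub>M ?E \<rightarrow>\<^sub>M (\<Pi>\<^sub>M c\<in>UNIV. g)"
  proof (rule measurable_PiM_single')
    fix c :: 'm
    show "(\<lambda>z. ?t z c) \<in> ?D \<Otimes>\<^sub>M ?E \<rightarrow>\<^sub>M g"
    proof (cases "c \<in> range \<sigma>")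
      case True
      have "(\<lambda>z. snd z (inv \<sigma> c)) \<in> ?D \<Otimes>\<^sub>M ?E \<rightarrow>\<^sub>M g"
        by (rule measurable_compose[OF measurable_snd measurable_component_singleton]) simp
      then show ?thesis using True by (simp add: case_prod_beta')
    next
      case False
      have "(\<lambda>z. fst z c) \<in> ?D \<Otimes>\<^sub>M ?E \<rightarrow>\<^sub>M g"
        by (rule measurable_compose[OF measurable_fst measurable_component_singleton]) (use False in simp)
      then show ?thesis using False by (simp add: case_prod_beta')
    qed
  qed (auto simp: space_pair_measure space_PiM PiE_iff)
  show "?L = (\<Pi>\<^sub>M c\<in>UNIV. g)"
  proof (rule m.PiM_eqI)
    fix A :: "'m \<Rightarrow> 'a set" assume A: "\<And>c. c \<in> UNIV \<Longrightarrow> A c \<in> sets g"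
    have im: "?t -` Pi\<^sub>E UNIV A \<inter> space (?D \<Otimes>\<^sub>M ?E) = Pi\<^sub>E (- range \<sigma>) A \<times> Pi\<^sub>E UNIV (A \<circ> \<sigma>)"
    proof (rule set_eqI)
      fix z :: "('m \<Rightarrow> 'a) \<times> ('q \<Rightarrow> 'a)"
      obtain d e where z: "z = (d, e)" by (cases z)
      have "(\<forall>c. (if c \<in> range \<sigma> then e (inv \<sigma> c) else d c) \<in> A c) \<longleftrightarrow>
        (\<forall>c\<in>- range \<sigma>. d c \<in> A c) \<and> (\<forall>a. e a \<in> A (\<sigma> a))" (is "?l \<longleftrightarrow> ?r")
      proof
        assume l: ?l
        show ?r
        proof (intro conjI ballI allI)
          show "d c \<in> A c" if "c \<in> - range \<sigma>" for c using l[rule_format, of c] that by simp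
          show "e a \<in> A (\<sigma> a)" for a using l[rule_format, of "\<sigma> a"] by (simp add: inv_f_f[OF \<sigma>])
        qed
      next
        assume ?r
        then show ?l by (auto simp: inv_f_f[OF \<sigma>])
      qed
      moreover have sp: "A c \<subseteq> space g" for c using A sets.sets_into_space by blast
      ultimately show "z \<in> ?t -` Pi\<^sub>E UNIV A \<inter> space (?D \<Otimes>\<^sub>M ?E) \<longleftrightarrow>
        z \<in> Pi\<^sub>E (- range \<sigma>) A \<times> Pi\<^sub>E UNIV (A \<circ> \<sigma>)"
        unfolding z by (auto simp: space_pair_measure space_PiM PiE_iff intro: sp[THEN subsetD])
    qed
    have "emeasure ?L (Pi\<^sub>E UNIV A) = emeasure (?D \<Otimes>\<^sub>M ?E) (Pi\<^sub>E (- range \<sigma>) A \<times> Pi\<^sub>E UNIV (A \<circ> \<sigma>))"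
      using A by (subst emeasure_distr[OF t]) (auto simp: im[symmetric] intro!: sets_PiM_I_finite)
    also have "\<dots> = emeasure ?D (Pi\<^sub>E (- range \<sigma>) A) * emeasure ?E (Pi\<^sub>E UNIV (A \<circ> \<sigma>))"
      using A by (intro e.emeasure_pair_measure_Times sets_PiM_I_finite) auto
    also have "\<dots> = (\<Prod>c\<in>- range \<sigma>. emeasure g (A c)) * (\<Prod>a\<in>UNIV. emeasure g (A (\<sigma> a)))"
      using A by (simp add: m.emeasure_PiM e.emeasure_PiM)
    also have "(\<Prod>a\<in>UNIV. emeasure g (A (\<sigma> a))) = (\<Prod>c\<in>range \<sigma>. emeasure g (A c))"
      using \<sigma> by (simp add: prod.reindex)
    also have "(\<Prod>c\<in>- range \<sigma>. emeasure g (A c)) * (\<Prod>c\<in>range \<sigma>. emeasure g (A c)) = (\<Prod>c\<in>UNIV. emeasure g (A c))"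
      by (subst prod.union_disjoint[symmetric]) (auto intro!: prod.cong)
    finally show "emeasure ?L (Pi\<^sub>E UNIV A) = (\<Prod>c\<in>UNIV. emeasure g (A c))" .
  qed auto
qed

section \<open>Passage to the column space of the first matrix\<close>

lemma pencil_eigenvalue_pos:
  fixes X :: "real ^ 'm ^ 'p" and Y :: "real ^ 'k ^ 'm"
  assumes inj: "\<And>v. X *v v = 0 \<Longrightarrow> v = 0"
    and "pencil_eigenvalue (Y ** transpose Y) (transpose X ** X) \<mu>" and "\<mu> \<noteq> 0"
  shows "0 < \<mu>"
proof -
  obtain t where t: "t \<noteq> 0" "(Y ** transpose Y) *v t = \<mu> *\<^sub>R ((transpose X ** X) *v t)"
    using assms(2) unfolding pencil_eigenvalue_def by blast
  have "0 \<le> (transpose Y *v t) \<bullet> (transpose Y *v t)" by simp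
  also have "\<dots> = t \<bullet> ((Y ** transpose Y) *v t)"
    by (simp add: inner_transpose matrix_vector_mul_assoc[symmetric])
  also have "\<dots> = \<mu> * (t \<bullet> ((transpose X ** X) *v t))" by (simp add: t(2))
  finally have "0 \<le> \<mu> * (t \<bullet> ((transpose X ** X) *v t))" .
  moreover have "0 < t \<bullet> ((transpose X ** X) *v t)" by (intro gram_pos inj t(1))
  ultimately have "0 \<le> \<mu>" by (metis zero_le_mult_iff less_le_not_le order_less_le)
  with assms(3) show ?thesis by simp
qed

text \<open>The matrix \<open>H\<close> depends on \<open>X\<close> alone, so that for fixed \<open>X\<close> the root is a function of the
  Gaussian matrix \<open>H\<^sup>T Y\<close>.\<close>
lemma largest_finite_root_full_rank:
  fixes X :: "real ^ 'm ^ 'p"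
  assumes inj: "\<And>v. X *v v = 0 \<Longrightarrow> v = 0"
  obtains H :: "real ^ 'm ^ 'p" where "transpose H ** H = mat 1"
    "\<And>Y :: real ^ 'q ^ 'p. largest_finite_root TYPE('m) (Y ** transpose Y) (X ** transpose X) =
      largest_nonzero_eigenvalue ((transpose H ** Y ** transpose (transpose H ** Y)) ** matrix_inv (transpose X ** X))"
proof -
  obtain H :: "real ^ 'm ^ 'p" and S S' where H: "transpose H ** H = mat 1" "X = H ** S" "transpose S = S"
    and S: "S ** S = transpose X ** X" "S ** S' = mat 1" "S' ** S = mat 1"
    by (rule polar_decomposition[OF inj])
  obtain V' where V: "(transpose X ** X) ** V' = mat 1" by (rule gram_invertible[OF inj])
  show thesis
  proof
    fix Y :: "real ^ 'q ^ 'p"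
    let ?U = "transpose H ** Y ** transpose (transpose H ** Y)"
    have "finite_roots TYPE('m) (Y ** transpose Y) (X ** transpose X) =
      {\<mu>. 0 < \<mu> \<and> pencil_eigenvalue (transpose H ** (Y ** transpose Y) ** H) (transpose X ** X) \<mu>}"
      by (rule finite_roots_eq_pencil_eigenvalues[OF inj H S])
    also have "transpose H ** (Y ** transpose Y) ** H = ?U"
      by (simp add: matrix_transpose_mul matrix_mul_assoc)
    also have "{\<mu>. 0 < \<mu> \<and> pencil_eigenvalue ?U (transpose X ** X) \<mu>} =
      {\<mu>. real_eigenvalue (?U ** matrix_inv (transpose X ** X)) \<mu> \<and> \<mu> \<noteq> 0}"
      using pencil_eigenvalue_pos[OF inj] by (auto simp: real_eigenvalue_mult_matrix_inv[OF V])
    finally show "largest_finite_root TYPE('m) (Y ** transpose Y) (X ** transpose X) =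
      largest_nonzero_eigenvalue (?U ** matrix_inv (transpose X ** X))"
      by (simp add: largest_finite_root_def largest_nonzero_eigenvalue_def)
  qed (rule H(1))
qed

lemma measurable_gram:
  "(\<lambda>x. transpose (matrix_of_columns x) ** matrix_of_columns x)
    \<in> (\<Pi>\<^sub>M k\<in>(UNIV :: 'k::finite set). (gaussian :: (real ^ 'd) measure)) \<rightarrow>\<^sub>M borel"
  by (rule measurable_compose[OF measurable_matrix_of_columns])
    (intro borel_measurable_continuous_onI continuous_intros)

lemma measurable_pair_compose:
  assumes "(\<lambda>(u, v). F u v) \<in> borel_measurable (borel :: ('u::second_countable_topology \<times> 'v::second_countable_topology) measure)"
    and "f \<in> M \<rightarrow>\<^sub>M borel" "g \<in> M \<rightarrow>\<^sub>M borel"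
  shows "(\<lambda>x. F (f x) (g x)) \<in> borel_measurable M"
proof -
  have "(\<lambda>x. (f x, g x)) \<in> M \<rightarrow>\<^sub>M (borel \<Otimes>\<^sub>M borel)" using assms(2,3) by (rule measurable_Pair)
  then have "(\<lambda>x. (f x, g x)) \<in> M \<rightarrow>\<^sub>M borel" by (simp add: borel_prod)
  from measurable_compose[OF this assms(1)] show ?thesis by simp
qed

lemma matrix_of_columns_mult: "matrix_of_columns (\<lambda>k. M *v y k) = M ** matrix_of_columns y"
  by (simp add: matrix_of_columns_def matrix_matrix_mult_def matrix_vector_mult_def vec_eq_iff)

lemma wishart_CARD_eq_distr:
  "wishart CARD('k::finite) (mat 1 :: real ^ 'd ^ 'd) = distr (\<Pi>\<^sub>M k\<in>(UNIV :: 'k set). gaussian) borel (scatter UNIV)"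
  by (rule wishart_card_eq_distr) simp

lemma largest_finite_root_law_given_A:
  fixes x :: "'m::finite \<Rightarrow> real ^ 'p"
  assumes inj: "\<And>v. matrix_of_columns x *v v = 0 \<Longrightarrow> v = 0"
  shows "distr (\<Pi>\<^sub>M k\<in>(UNIV :: 'q::finite set). gaussian) borel
      (\<lambda>y. largest_finite_root TYPE('m) (scatter UNIV y) (scatter UNIV x)) =
    distr (wishart CARD('q) (mat 1)) borel (\<lambda>U. largest_nonzero_eigenvalue
      (U ** matrix_inv (transpose (matrix_of_columns x) ** matrix_of_columns x)))"
proof -
  let ?X = "matrix_of_columns x"
  let ?V = "transpose ?X ** ?X"
  obtain H :: "real ^ 'm ^ 'p" where H: "transpose H ** H = mat 1"
    "\<And>Y :: real ^ 'q ^ 'p. largest_finite_root TYPE('m) (Y ** transpose Y) (?X ** transpose ?X) =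
      largest_nonzero_eigenvalue ((transpose H ** Y ** transpose (transpose H ** Y)) ** matrix_inv ?V)"
    using largest_finite_root_full_rank[OF inj] by metis
  let ?c = "\<lambda>y :: 'q \<Rightarrow> real ^ 'p. \<lambda>k\<in>UNIV. transpose H *v y k"
  let ?G = "\<lambda>U. largest_nonzero_eigenvalue (U ** matrix_inv ?V)"
  have G: "?G \<in> borel_measurable borel"
    by (rule measurable_pair_compose[OF borel_largest_nonzero_eigenvalue_quotient]) simp_all
  have c: "?c \<in> (\<Pi>\<^sub>M k\<in>UNIV. gaussian) \<rightarrow>\<^sub>M (\<Pi>\<^sub>M k\<in>UNIV. gaussian)"
  proof (intro measurable_restrict)
    fix k :: 'q
    have "(*v) (transpose H) \<in> borel_measurable borel"
      by (intro borel_measurable_continuous_onI continuous_intros)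
    from measurable_compose[OF measurable_gaussian_component[of k UNIV] this]
    show "(\<lambda>y. transpose H *v y k) \<in> (\<Pi>\<^sub>M k\<in>UNIV. gaussian) \<rightarrow>\<^sub>M gaussian" by simp
  qed
  have "distr (wishart CARD('q) (mat 1)) borel ?G = distr (\<Pi>\<^sub>M k\<in>(UNIV :: 'q set). gaussian) borel (?G \<circ> scatter UNIV)"
    unfolding wishart_CARD_eq_distr by (rule distr_distr[OF G measurable_scatter])
  also have "\<dots> = distr (distr (\<Pi>\<^sub>M k\<in>UNIV. gaussian) (\<Pi>\<^sub>M k\<in>UNIV. gaussian) ?c) borel (?G \<circ> scatter UNIV)"
    using distr_gaussian_compression[OF H(1) finite[of "UNIV :: 'q set"]] by simp
  also have "\<dots> = distr (\<Pi>\<^sub>M k\<in>UNIV. gaussian) borel (?G \<circ> scatter UNIV \<circ> ?c)"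
    by (rule distr_distr[OF measurable_comp[OF measurable_scatter G] c])
  also have "?G \<circ> scatter UNIV \<circ> ?c = (\<lambda>y. largest_finite_root TYPE('m) (scatter UNIV y) (scatter UNIV x))"
    by (rule ext) (simp add: scatter_UNIV H(2) matrix_of_columns_mult)
  finally show ?thesis by simp
qed

lemma distr_pair_distr:
  assumes f: "f \<in> M \<rightarrow>\<^sub>M S" and g: "g \<in> N \<rightarrow>\<^sub>M T" and N: "prob_space N"
    and h: "h \<in> S \<Otimes>\<^sub>M T \<rightarrow>\<^sub>M R"
  shows "distr (distr M S f \<Otimes>\<^sub>M distr N T g) R h = distr (M \<Otimes>\<^sub>M N) R (\<lambda>(x, y). h (f x, g y))"
proof -
  interpret N: prob_space "distr N T g" using N g by (rule prob_space.prob_space_distr)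
  have fg: "(\<lambda>(x, y). (f x, g y)) \<in> M \<Otimes>\<^sub>M N \<rightarrow>\<^sub>M S \<Otimes>\<^sub>M T"
    unfolding case_prod_beta'
    by (intro measurable_Pair measurable_compose[OF measurable_fst f] measurable_compose[OF measurable_snd g])
  have "distr M S f \<Otimes>\<^sub>M distr N T g = distr (M \<Otimes>\<^sub>M N) (S \<Otimes>\<^sub>M T) (\<lambda>(x, y). (f x, g y))"
    by (rule pair_measure_distr[OF f g]) unfold_locales
  then show ?thesis using distr_distr[OF h fg] by (simp add: comp_def case_prod_beta')
qed

lemma distr_pair_distr_left:
  assumes f: "f \<in> M \<rightarrow>\<^sub>M S" and N: "prob_space N" and h: "h \<in> S \<Otimes>\<^sub>M N \<rightarrow>\<^sub>M R"
  shows "distr (distr M S f \<Otimes>\<^sub>M N) R h = distr (M \<Otimes>\<^sub>M N) R (\<lambda>(x, y). h (f x, y))"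
  using distr_pair_distr[OF f measurable_ident_sets[OF refl] N h] by (simp add: distr_id2)

text \<open>Conditioning on \<open>X\<close>, the law of the root depends on \<open>X\<close> only through the Gram matrix
  \<open>X\<^sup>T X\<close>, which is itself a Wishart matrix.\<close>
lemma largest_finite_root_law:
  assumes "CARD('m::finite) \<le> CARD('p)"
  shows "distr (wishart CARD('m) (mat 1 :: real ^ 'p ^ 'p) \<Otimes>\<^sub>M wishart CARD('q::finite) (mat 1)) borel
      (\<lambda>(A, B). largest_finite_root TYPE('m) B A) =
    distr (wishart CARD('q) (mat 1 :: real ^ 'm ^ 'm) \<Otimes>\<^sub>M wishart CARD('p) (mat 1)) borel
      (\<lambda>(U, V). largest_nonzero_eigenvalue (U ** matrix_inv V))"
proof -
  let ?X = "\<Pi>\<^sub>M j\<in>(UNIV :: 'm set). (gaussian :: (real ^ 'p) measure)"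
  let ?Y = "\<Pi>\<^sub>M k\<in>(UNIV :: 'q set). (gaussian :: (real ^ 'p) measure)"
  let ?WU = "wishart CARD('q) (mat 1 :: real ^ 'm ^ 'm)" and ?WV = "wishart CARD('p) (mat 1 :: real ^ 'm ^ 'm)"
  let ?F = "\<lambda>A B. largest_finite_root TYPE('m) B (A :: real ^ 'p ^ 'p)"
  let ?G = "\<lambda>U V. largest_nonzero_eigenvalue (U ** matrix_inv (V :: real ^ 'm ^ 'm))"
  let ?gram = "\<lambda>x :: 'm \<Rightarrow> real ^ 'p. transpose (matrix_of_columns x) ** matrix_of_columns x"
  interpret WU: prob_space ?WU by (rule prob_space_wishart)
  interpret WV: prob_space ?WV by (rule prob_space_wishart)
  interpret P: pair_sigma_finite ?WU ?WV ..
  note F = measurable_pair_compose[OF borel_largest_finite_root[where 'm = 'm and 'p = 'p]]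
  note G = measurable_pair_compose[OF borel_largest_nonzero_eigenvalue_quotient]
  have fst: "fst \<in> M \<Otimes>\<^sub>M N \<rightarrow>\<^sub>M borel" if "sets M = sets borel"
    for M N :: "(real ^ 'm ^ 'm) measure"
    using measurable_fst[of M N] measurable_cong_sets[OF refl that] by blast
  have snd: "snd \<in> M \<Otimes>\<^sub>M N \<rightarrow>\<^sub>M borel" if "sets N = sets borel"
    for M N :: "(real ^ 'm ^ 'm) measure"
    using measurable_snd[of M N] measurable_cong_sets[OF refl that] by blast
  have "distr (wishart CARD('m) (mat 1 :: real ^ 'p ^ 'p) \<Otimes>\<^sub>M wishart CARD('q) (mat 1)) borel (\<lambda>(A, B). ?F A B)
    = distr (?X \<Otimes>\<^sub>M ?Y) borel (\<lambda>(x, y). case (scatter UNIV x, scatter UNIV y) of (A, B) \<Rightarrow> ?F A B)"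
    unfolding wishart_CARD_eq_distr
  proof (rule distr_pair_distr[OF measurable_scatter measurable_scatter prob_space_PiM_gaussian])
    show "(\<lambda>(A, B). ?F A B) \<in> borel_measurable (borel \<Otimes>\<^sub>M borel)"
      unfolding case_prod_beta' by (intro F measurable_fst measurable_snd)
  qed
  also have "\<dots> = distr (?X \<Otimes>\<^sub>M ?WU) borel (\<lambda>(x, U). ?G U (?gram x))"
  proof (rule distr_pair_eqI[OF prob_space_PiM_gaussian prob_space_wishart])
    show "(\<lambda>(x, y). case (scatter UNIV x, scatter UNIV y) of (A, B) \<Rightarrow> ?F A B) \<in> borel_measurable (?X \<Otimes>\<^sub>M ?Y)"
      unfolding case_prod_beta' fst_conv snd_conv
      by (intro F measurable_compose[OF measurable_fst measurable_scatter]
          measurable_compose[OF measurable_snd measurable_scatter])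
    have "snd \<in> ?X \<Otimes>\<^sub>M ?WU \<rightarrow>\<^sub>M borel"
      using measurable_snd[of ?X ?WU] measurable_cong_sets[OF refl sets_wishart] by blast
    then show "(\<lambda>(x, U). ?G U (?gram x)) \<in> borel_measurable (?X \<Otimes>\<^sub>M ?WU)"
      unfolding case_prod_beta' by (intro G measurable_compose[OF measurable_fst measurable_gram])
    show "AE x in ?X. distr ?Y borel (\<lambda>y. case (x, y) of (x, y) \<Rightarrow> case (scatter UNIV x, scatter UNIV y) of (A, B) \<Rightarrow> ?F A B)
      = distr ?WU borel (\<lambda>y. case (x, y) of (x, U) \<Rightarrow> ?G U (?gram x))"
      using AE_gaussian_full_column_rank[OF assms]
    proof eventually_elim
      fix x :: "'m \<Rightarrow> real ^ 'p" assume "\<forall>v. matrix_of_columns x *v v = 0 \<longrightarrow> v = 0"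
      then show "distr ?Y borel (\<lambda>y. case (x, y) of (x, y) \<Rightarrow> case (scatter UNIV x, scatter UNIV y) of (A, B) \<Rightarrow> ?F A B)
        = distr ?WU borel (\<lambda>y. case (x, y) of (x, U) \<Rightarrow> ?G U (?gram x))"
        unfolding prod.case by (intro largest_finite_root_law_given_A) blast
    qed
  qed
  also have "\<dots> = distr (?WV \<Otimes>\<^sub>M ?WU) borel (\<lambda>(V, U). ?G U V)"
  proof -
    have "snd \<in> (borel :: (real ^ 'm ^ 'm) measure) \<Otimes>\<^sub>M ?WU \<rightarrow>\<^sub>M borel" by (rule snd) simp
    then have "(\<lambda>(V, U). ?G U V) \<in> borel_measurable (borel \<Otimes>\<^sub>M ?WU)"
      unfolding case_prod_beta' by (intro G measurable_fst)
    from distr_pair_distr_left[OF measurable_gram[where 'd = 'p and 'k = 'm] prob_space_wishart this]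
    show ?thesis unfolding wishart_eq_distr_gram by simp
  qed
  also have "\<dots> = distr (?WU \<Otimes>\<^sub>M ?WV) borel (\<lambda>(U, V). ?G U V)"
  proof -
    have G2: "(\<lambda>(U, V). ?G U V) \<in> borel_measurable (?WU \<Otimes>\<^sub>M ?WV)"
      unfolding case_prod_beta' by (intro G fst snd) simp_all
    have "distr (?WU \<Otimes>\<^sub>M ?WV) borel (\<lambda>(U, V). ?G U V)
      = distr (distr (?WV \<Otimes>\<^sub>M ?WU) (?WU \<Otimes>\<^sub>M ?WV) (\<lambda>(x, y). (y, x))) borel (\<lambda>(U, V). ?G U V)"
      using P.distr_pair_swap by simp
    also have "\<dots> = distr (?WV \<Otimes>\<^sub>M ?WU) borel ((\<lambda>(U, V). ?G U V) \<circ> (\<lambda>(x, y). (y, x)))"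
      by (rule distr_distr[OF G2 measurable_pair_swap'])
    also have "(\<lambda>(U, V). ?G U V) \<circ> (\<lambda>(x, y). (y, x)) = (\<lambda>(V, U). ?G U V)" by auto
    finally show ?thesis ..
  qed
  finally show ?thesis .
qed

section \<open>Passage to the column space of the second matrix\<close>

text \<open>The \<open>x c\<close> are the vectors \<open>X w\<^sub>c\<close>, from which \<open>X\<close> is recovered by multiplication with the
  orthogonal matrix of rows \<open>w\<^sub>c\<close>.\<close>
lemma largest_nonzero_eigenvalue_eq_lambda_max:
  fixes Z Q1 :: "real ^ 'q ^ 'm" and x :: "'m \<Rightarrow> real ^ 'p"
  assumes Z: "Z = Q1 ** T" "transpose Q1 ** Q1 = mat 1" "transpose T = T" "T ** T' = mat 1"
    and w: "orthonormal_family UNIV w" "inj \<sigma>" "\<And>a. w (\<sigma> a) = column a Q1"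
    and inj: "\<And>v. matrix_of_columns x *v v = 0 \<Longrightarrow> v = 0"
    and orth: "\<And>k c. k \<in> K \<Longrightarrow> c \<notin> range \<sigma> \<Longrightarrow> n k \<bullet> x c = 0"
    and complete: "\<And>y. (\<And>c. c \<notin> range \<sigma> \<Longrightarrow> y \<bullet> x c = 0) \<Longrightarrow> (\<Sum>k\<in>K. (n k \<bullet> y) *\<^sub>R n k) = y"
  defines "X \<equiv> matrix_of_columns x ** (\<chi> c. w c)"
  shows "largest_nonzero_eigenvalue ((Z ** transpose Z) ** matrix_inv (transpose X ** X)) =
    lambda_max ((transpose Z ** Z) ** matrix_inv (scatter K (\<lambda>k. \<chi> a. n k \<bullet> x (\<sigma> a))))"
proof -
  let ?M = "(\<chi> c. w c) :: real ^ 'm ^ 'm" and ?W = "scatter K (\<lambda>k. \<chi> a. n k \<bullet> x (\<sigma> a))"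
  have MM: "?M ** transpose ?M = mat 1"
    using w(1) by (simp add: vec_eq_iff matrix_matrix_mult_def transpose_def mat_def
        orthonormal_family_def inner_vec_def)
  then have MM': "transpose ?M ** ?M = mat 1" by (simp add: matrix_left_right_inverse)
  have "X *v v = 0 \<Longrightarrow> v = 0" for v
  proof -
    assume "X *v v = 0"
    then have "?M *v v = 0" by (intro inj) (simp add: X_def matrix_vector_mul_assoc)
    then have "transpose ?M *v (?M *v v) = 0" by simp
    then show "v = 0" by (simp add: matrix_vector_mul_assoc MM')
  qed
  then obtain V' where V': "(transpose X ** X) ** V' = mat 1" by (rule gram_invertible)
  have Xw: "X *v w c = x c" for c
  proof -
    have "?M *v w c = axis c 1"
      using w(1) by (simp add: vec_eq_iff matrix_vector_mult_def axis_def orthonormal_family_def inner_vec_def)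
    then show ?thesis
      by (simp add: X_def matrix_vector_mul_assoc[symmetric] matrix_vector_mult_basis column_def matrix_of_columns_def)
  qed
  have "(\<chi> a b. \<Sum>k\<in>K. (n k \<bullet> (X *v w (\<sigma> a))) * (n k \<bullet> (X *v w (\<sigma> b)))) **
      (transpose (\<chi> i a. w (\<sigma> a) $ i) ** V' ** (\<chi> i a. w (\<sigma> a) $ i)) = mat 1"
    by (rule schur_complement_inverse[OF V' w(1,2)]) (use orth complete in \<open>simp_all add: Xw\<close>)
  moreover have "(\<chi> i a. w (\<sigma> a) $ i) = Q1" by (simp add: w(3) column_def vec_eq_iff)
  ultimately have W: "?W ** (transpose Q1 ** V' ** Q1) = mat 1"
    by (simp add: scatter_def Xw)
  have "{\<mu>. real_eigenvalue ((Z ** transpose Z) ** matrix_inv (transpose X ** X)) \<mu> \<and> \<mu> \<noteq> 0} =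
    {\<mu>. real_eigenvalue ((transpose Z ** Z) ** matrix_inv ?W) \<mu>}"
    using pencil_eigenvalue_transfer[OF Z(1,2,3) V' W Z(4)]
    unfolding real_eigenvalue_mult_matrix_inv[OF V'] real_eigenvalue_mult_matrix_inv[OF W] by blast
  then show ?thesis by (simp add: largest_nonzero_eigenvalue_def lambda_max_def)
qed

text \<open>The matrix \<open>V\<close> is the Gram matrix of a Gaussian matrix whose rows are the \<open>g i\<close>. Its columns in the basis
  adapted to \<open>z\<close> split into a part \<open>d\<close>, on which one conditions, and a part \<open>e\<close>, whose
  projection onto the complement of \<open>d\<close> has the Wishart matrix \<open>W\<close> as Gram matrix.\<close>
lemma quotient_law_given_U:
  fixes z :: "'q::finite \<Rightarrow> real ^ 'm"
  assumes q: "CARD('q) \<le> CARD('m)" and m: "CARD('m) \<le> CARD('p::finite)"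
    and inj: "\<And>v. matrix_of_columns z *v v = 0 \<Longrightarrow> v = 0"
  shows "distr (\<Pi>\<^sub>M i\<in>(UNIV :: 'p set). gaussian) borel
      (\<lambda>g. largest_nonzero_eigenvalue (scatter UNIV z ** matrix_inv (scatter UNIV g))) =
    distr (wishart (CARD('p) - CARD('m) + CARD('q)) (mat 1)) borel
      (\<lambda>W. lambda_max ((transpose (matrix_of_columns z) ** matrix_of_columns z) ** matrix_inv W))"
proof -
  let ?Z = "matrix_of_columns z"
  define r where "r = CARD('p) - CARD('m) + CARD('q)"
  obtain Q1 :: "real ^ 'q ^ 'm" and T T' where Q1: "transpose Q1 ** Q1 = mat 1"
    and T: "?Z = Q1 ** T" "transpose T = T" "T ** T' = mat 1"
    by (rule polar_decomposition[OF inj])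
  have "orthonormal_family UNIV (\<lambda>a. column a Q1)"
    using Q1 by (simp add: orthonormal_family_def matrix_mult_transpose_dot_column vec_eq_iff mat_def)
  then obtain \<sigma> and w :: "'m \<Rightarrow> real ^ 'm" where \<sigma>: "inj \<sigma>" and w: "orthonormal_family UNIV w"
    and w\<sigma>: "\<And>a. w (\<sigma> a) = column a Q1"
    by (rule orthonormal_family_extension[OF finite[of "UNIV :: 'q set"]]) blast
  let ?M = "(\<chi> c. w c) :: real ^ 'm ^ 'm"
  have MM: "transpose ?M ** ?M = mat 1"
  proof -
    have "?M ** transpose ?M = mat 1"
      using w by (simp add: vec_eq_iff matrix_matrix_mult_def transpose_def mat_def
          orthonormal_family_def inner_vec_def)
    then show ?thesis by (simp add: matrix_left_right_inverse)
  qed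
  define X where "X x = matrix_of_columns x ** ?M" for x :: "'m \<Rightarrow> real ^ 'p"
  define \<Phi> where "\<Phi> x = largest_nonzero_eigenvalue (scatter UNIV z ** matrix_inv (transpose (X x) ** X x))" for x
  define L where "L W = lambda_max ((transpose ?Z ** ?Z) ** matrix_inv W)" for W
  let ?P = "\<Pi>\<^sub>M c\<in>(UNIV :: 'm set). (gaussian :: (real ^ 'p) measure)"
  let ?D = "\<Pi>\<^sub>M c\<in>- range \<sigma>. (gaussian :: (real ^ 'p) measure)"
  let ?E = "\<Pi>\<^sub>M a\<in>(UNIV :: 'q set). (gaussian :: (real ^ 'p) measure)"
  let ?R = "wishart r (mat 1 :: real ^ 'q ^ 'q)"
  let ?t = "\<lambda>(d, e) c. if c \<in> range \<sigma> then e (inv \<sigma> c) else d c"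
  have X: "X \<in> borel_measurable ?P"
    unfolding X_def[abs_def]
    by (rule measurable_compose[OF measurable_matrix_of_columns])
      (intro borel_measurable_continuous_onI continuous_intros)
  then have "(\<lambda>x. transpose (X x) ** X x) \<in> borel_measurable ?P"
    by (rule measurable_compose) (intro borel_measurable_continuous_onI continuous_intros)
  then have \<Phi>: "\<Phi> \<in> borel_measurable ?P"
    unfolding \<Phi>_def[abs_def]
    by (intro measurable_pair_compose[OF borel_largest_nonzero_eigenvalue_quotient]) simp_all
  have L: "L \<in> borel_measurable borel"
    unfolding L_def[abs_def] by (intro measurable_pair_compose[OF borel_lambda_max_quotient]) simp_all
  have L': "L \<in> borel_measurable ?R" using L measurable_cong_sets[OF sets_wishart refl] by blast
  (* passes from the rows g i to the columns in the basis w *)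
  let ?m = "\<lambda>g. \<lambda>c\<in>UNIV. (\<chi> i. w c \<bullet> g i) :: real ^ 'p"
  have mm: "?m \<in> (\<Pi>\<^sub>M i\<in>UNIV. gaussian) \<rightarrow>\<^sub>M ?P"
    by (intro measurable_restrict)
      (auto intro!: borel_measurable_vec_lambda borel_measurable_inner measurable_gaussian_component)
  have "distr (\<Pi>\<^sub>M i\<in>(UNIV :: 'p set). gaussian) borel
      (\<lambda>g. largest_nonzero_eigenvalue (scatter UNIV z ** matrix_inv (scatter UNIV g)))
    = distr (\<Pi>\<^sub>M i\<in>UNIV. gaussian) borel (\<Phi> \<circ> ?m)"
  proof (rule arg_cong[where f = "distr _ _"], rule ext)
    fix g :: "'p \<Rightarrow> real ^ 'm"
    have "matrix_of_columns (?m g) = (\<chi> i. g i) ** transpose ?M"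
      by (simp add: matrix_of_columns_def matrix_matrix_mult_def transpose_def inner_vec_def mult.commute)
    then have "X (?m g) = (\<chi> i. g i)" by (simp add: X_def matrix_mul_assoc[symmetric] MM)
    then have "transpose (X (?m g)) ** X (?m g) = scatter UNIV g"
      by (simp add: scatter_def matrix_matrix_mult_def transpose_def)
    then show "largest_nonzero_eigenvalue (scatter UNIV z ** matrix_inv (scatter UNIV g)) = (\<Phi> \<circ> ?m) g"
      by (simp add: \<Phi>_def)
  qed
  also have "\<dots> = distr ?P borel \<Phi>"
    using distr_distr[OF \<Phi> mm] unfolding gaussian_family_mixing[OF finite w] by simp
  also have "\<dots> = distr (?D \<Otimes>\<^sub>M ?E) borel (\<Phi> \<circ> ?t)"
    using distr_distr[OF \<Phi> distr_PiM_split(2)[OF \<sigma> prob_space_gaussian]]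
    unfolding distr_PiM_split(1)[OF \<sigma> prob_space_gaussian] .
  also have "\<dots> = distr (?D \<Otimes>\<^sub>M ?R) borel (\<lambda>(d, W). L W)"
  proof (rule distr_pair_eqI[OF prob_space_PiM_gaussian prob_space_wishart])
    show "\<Phi> \<circ> ?t \<in> borel_measurable (?D \<Otimes>\<^sub>M ?E)"
      by (rule measurable_comp[OF distr_PiM_split(2)[OF \<sigma> prob_space_gaussian] \<Phi>])
    show "(\<lambda>(d, W). L W) \<in> borel_measurable (?D \<Otimes>\<^sub>M ?R)"
      unfolding case_prod_beta' by (rule measurable_compose[OF measurable_snd L'])
    interpret D: prob_space ?D by (rule prob_space_PiM_gaussian)
    interpret E: prob_space ?E by (rule prob_space_PiM_gaussian)
    interpret DE: pair_sigma_finite ?D ?E ..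
    have "AE x in distr (?D \<Otimes>\<^sub>M ?E) ?P ?t. \<forall>v. matrix_of_columns x *v v = 0 \<longrightarrow> v = 0"
      unfolding distr_PiM_split(1)[OF \<sigma> prob_space_gaussian] by (rule AE_gaussian_full_column_rank[OF m])
    then have "AE y in ?D \<Otimes>\<^sub>M ?E. \<forall>v. matrix_of_columns (?t y) *v v = 0 \<longrightarrow> v = 0"
      by (rule AE_distrD[OF distr_PiM_split(2)[OF \<sigma> prob_space_gaussian]])
    then have "AE d in ?D. AE e in ?E. \<forall>v. matrix_of_columns (?t (d, e)) *v v = 0 \<longrightarrow> v = 0"
      by (rule DE.AE_pair)
    then show "AE d in ?D. distr ?E borel (\<lambda>e. (\<Phi> \<circ> ?t) (d, e)) = distr ?R borel (\<lambda>W. case (d, W) of (d, W) \<Rightarrow> L W)"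
    proof (rule AE_mp[OF _ AE_I2], intro impI)
      fix d assume d: "d \<in> space ?D"
        and AE: "AE e in ?E. \<forall>v. matrix_of_columns (?t (d, e)) *v v = 0 \<longrightarrow> v = 0"
      (* one completion of full rank shows that the vectors d c are linearly independent, so that
         their complement has dimension r; the basis n does not depend on the completion *)
      obtain e0 where e0: "\<And>v. matrix_of_columns (?t (d, e0)) *v v = 0 \<Longrightarrow> v = 0"
      proof -
        have "\<exists>e0. \<forall>v. matrix_of_columns (?t (d, e0)) *v v = 0 \<longrightarrow> v = 0"
        proof (rule ccontr)
          assume contra: "\<not> ?thesis"
          have "AE e in ?E. False" using AE by (rule eventually_mono) (use contra in blast)
          then show False by simp
        qed
        then show thesis using that by blast
      qed
      have col: "column c (matrix_of_columns (?t (d, e))) = d c" if "c \<notin> range \<sigma>" for c e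
        using that by (simp add: column_def matrix_of_columns_def)
      have "card (- range \<sigma>) + card (range \<sigma>) = CARD('m)"
        by (simp add: card_Un_disjoint[symmetric])
      then have rC: "r + card (- range \<sigma>) = CARD('p)"
        using m q \<sigma> by (simp add: r_def card_image)
      obtain n :: "nat \<Rightarrow> real ^ 'p" where n: "orthonormal_family {..<r} n"
        "\<And>k c. k < r \<Longrightarrow> c \<in> - range \<sigma> \<Longrightarrow> n k \<bullet> column c (matrix_of_columns (?t (d, e0))) = 0"
        "\<And>y. (\<And>c. c \<in> - range \<sigma> \<Longrightarrow> y \<bullet> column c (matrix_of_columns (?t (d, e0))) = 0) \<Longrightarrow> (\<Sum>k<r. (n k \<bullet> y) *\<^sub>R n k) = y"
        by (rule orthonormal_basis_of_columns_complement[OF e0 rC]) (assumption | rule that | blast)+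
      have n_orth: "n k \<bullet> d c = 0" if "k \<in> {..<r}" "c \<notin> range \<sigma>" for k c
        using n(2)[of k c] that unfolding col[OF that(2)] by simp
      have n_complete: "(\<Sum>k<r. (n k \<bullet> y) *\<^sub>R n k) = y" if "\<And>c. c \<notin> range \<sigma> \<Longrightarrow> y \<bullet> d c = 0" for y
      proof (rule n(3))
        fix c assume "c \<in> - range \<sigma>"
        then have c: "c \<notin> range \<sigma>" by simp
        show "y \<bullet> column c (matrix_of_columns (?t (d, e0))) = 0"
          unfolding col[OF c] by (rule that[OF c])
      qed
      let ?s = "\<lambda>e. scatter {..<r} (\<lambda>k. \<chi> a. n k \<bullet> e a)"
      have s: "?s \<in> ?E \<rightarrow>\<^sub>M borel"
        unfolding scatter_def
        by (auto intro!: borel_measurable_vec_lambda borel_measurable_sum borel_measurable_times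
            borel_measurable_inner measurable_gaussian_component)
      have t_d: "(\<lambda>e. (\<Phi> \<circ> ?t) (d, e)) \<in> borel_measurable ?E"
        by (rule measurable_Pair2[OF \<open>\<Phi> \<circ> ?t \<in> _\<close> d])
      have "distr ?E borel (\<lambda>e. (\<Phi> \<circ> ?t) (d, e)) = distr ?E borel (L \<circ> ?s)"
      proof (rule distr_cong_AE)
        show "AE e in ?E. (\<Phi> \<circ> ?t) (d, e) = (L \<circ> ?s) e"
          using AE
        proof eventually_elim
          fix e assume e: "\<forall>v. matrix_of_columns (?t (d, e)) *v v = 0 \<longrightarrow> v = 0"
          have "largest_nonzero_eigenvalue ((?Z ** transpose ?Z) ** matrix_inv (transpose (X (?t (d, e))) ** X (?t (d, e)))) =
            lambda_max ((transpose ?Z ** ?Z) ** matrix_inv (scatter {..<r} (\<lambda>k. \<chi> a. n k \<bullet> (?t (d, e)) (\<sigma> a))))"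
            unfolding X_def
          proof (rule largest_nonzero_eigenvalue_eq_lambda_max[OF T(1) Q1 T(2,3) w \<sigma> w\<sigma>])
            show "n k \<bullet> (?t (d, e)) c = 0" if "k \<in> {..<r}" "c \<notin> range \<sigma>" for k c
              using n_orth that by simp
            show "(\<Sum>k<r. (n k \<bullet> y) *\<^sub>R n k) = y" if "\<And>c. c \<notin> range \<sigma> \<Longrightarrow> y \<bullet> (?t (d, e)) c = 0" for y
              by (rule n_complete) (use that in simp)
          qed (use e in blast)
          then show "(\<Phi> \<circ> ?t) (d, e) = (L \<circ> ?s) e"
            by (simp add: \<Phi>_def L_def scatter_UNIV inv_f_f[OF \<sigma>])
        qed
      qed (use t_d measurable_comp[OF s L] in auto)
      also have "\<dots> = distr (distr ?E borel ?s) borel L" by (rule distr_distr[OF L s, symmetric])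
      also have "distr ?E borel ?s = ?R"
        using wishart_eq_distr_mixing[OF _ n(1), where 'n = 'q] by simp
      finally show "distr ?E borel (\<lambda>e. (\<Phi> \<circ> ?t) (d, e)) = distr ?R borel (\<lambda>W. case (d, W) of (d, W) \<Rightarrow> L W)"
        by simp
    qed
  qed
  also have "\<dots> = distr ?R borel L"
  proof -
    interpret D: prob_space ?D by (rule prob_space_PiM_gaussian)
    interpret R: prob_space ?R by (rule prob_space_wishart)
    have "distr (?D \<Otimes>\<^sub>M ?R) ?R snd = ?R"
    proof (rule measure_eqI)
      fix A assume "A \<in> sets (distr (?D \<Otimes>\<^sub>M ?R) ?R snd)"
      then have A: "A \<in> sets ?R" by simp
      then have "snd -` A \<inter> space (?D \<Otimes>\<^sub>M ?R) = space ?D \<times> A"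
        using sets.sets_into_space by (auto simp: space_pair_measure)
      then show "emeasure (distr (?D \<Otimes>\<^sub>M ?R) ?R snd) A = emeasure ?R A"
        using A by (simp add: emeasure_distr R.emeasure_pair_measure_Times D.emeasure_space_1)
    qed simp
    then have "distr ?R borel L = distr (distr (?D \<Otimes>\<^sub>M ?R) ?R snd) borel L" by simp
    also have "\<dots> = distr (?D \<Otimes>\<^sub>M ?R) borel (L \<circ> snd)" by (rule distr_distr[OF L' measurable_snd])
    finally show ?thesis by (simp add: comp_def case_prod_beta')
  qed
  finally show ?thesis unfolding L_def r_def .
qed

lemma quotient_law:
  assumes q: "CARD('q::finite) \<le> CARD('m::finite)" and m: "CARD('m) \<le> CARD('p::finite)"
  shows "distr (wishart CARD('q) (mat 1 :: real ^ 'm ^ 'm) \<Otimes>\<^sub>M wishart CARD('p) (mat 1)) borel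
      (\<lambda>(U, V). largest_nonzero_eigenvalue (U ** matrix_inv V)) =
    distr (wishart CARD('m) (mat 1 :: real ^ 'q ^ 'q) \<Otimes>\<^sub>M wishart (CARD('p) - CARD('m) + CARD('q)) (mat 1)) borel
      (\<lambda>(U, V). lambda_max (U ** matrix_inv V))"
proof -
  let ?Z = "\<Pi>\<^sub>M k\<in>(UNIV :: 'q set). (gaussian :: (real ^ 'm) measure)"
  let ?Y = "\<Pi>\<^sub>M i\<in>(UNIV :: 'p set). (gaussian :: (real ^ 'm) measure)"
  let ?R = "wishart (CARD('p) - CARD('m) + CARD('q)) (mat 1 :: real ^ 'q ^ 'q)"
  let ?G = "\<lambda>U V. largest_nonzero_eigenvalue (U ** matrix_inv (V :: real ^ 'm ^ 'm))"
  let ?L = "\<lambda>U V. lambda_max (U ** matrix_inv (V :: real ^ 'q ^ 'q))"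
  let ?gram = "\<lambda>x :: 'q \<Rightarrow> real ^ 'm. transpose (matrix_of_columns x) ** matrix_of_columns x"
  note G = measurable_pair_compose[OF borel_largest_nonzero_eigenvalue_quotient]
  note L = measurable_pair_compose[OF borel_lambda_max_quotient]
  have "distr (wishart CARD('q) (mat 1 :: real ^ 'm ^ 'm) \<Otimes>\<^sub>M wishart CARD('p) (mat 1)) borel (\<lambda>(U, V). ?G U V)
    = distr (?Z \<Otimes>\<^sub>M ?Y) borel (\<lambda>(z, g). case (scatter UNIV z, scatter UNIV g) of (U, V) \<Rightarrow> ?G U V)"
    unfolding wishart_CARD_eq_distr
  proof (rule distr_pair_distr[OF measurable_scatter measurable_scatter prob_space_PiM_gaussian])
    show "(\<lambda>(U, V). ?G U V) \<in> borel_measurable (borel \<Otimes>\<^sub>M borel)"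
      unfolding case_prod_beta' by (intro G measurable_fst measurable_snd)
  qed
  also have "\<dots> = distr (?Z \<Otimes>\<^sub>M ?R) borel (\<lambda>(z, W). ?L (?gram z) W)"
  proof (rule distr_pair_eqI[OF prob_space_PiM_gaussian prob_space_wishart])
    show "(\<lambda>(z, g). case (scatter UNIV z, scatter UNIV g) of (U, V) \<Rightarrow> ?G U V) \<in> borel_measurable (?Z \<Otimes>\<^sub>M ?Y)"
      unfolding case_prod_beta' fst_conv snd_conv
      by (intro G measurable_compose[OF measurable_fst measurable_scatter]
          measurable_compose[OF measurable_snd measurable_scatter])
    have "snd \<in> ?Z \<Otimes>\<^sub>M ?R \<rightarrow>\<^sub>M borel"
      using measurable_snd[of ?Z ?R] measurable_cong_sets[OF refl sets_wishart] by blast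
    then show "(\<lambda>(z, W). ?L (?gram z) W) \<in> borel_measurable (?Z \<Otimes>\<^sub>M ?R)"
      unfolding case_prod_beta' by (intro L measurable_compose[OF measurable_fst measurable_gram])
    show "AE z in ?Z. distr ?Y borel (\<lambda>y. case (z, y) of (z, g) \<Rightarrow> case (scatter UNIV z, scatter UNIV g) of (U, V) \<Rightarrow> ?G U V)
      = distr ?R borel (\<lambda>y. case (z, y) of (z, W) \<Rightarrow> ?L (?gram z) W)"
      using AE_gaussian_full_column_rank[OF q]
    proof eventually_elim
      fix z :: "'q \<Rightarrow> real ^ 'm" assume "\<forall>v. matrix_of_columns z *v v = 0 \<longrightarrow> v = 0"
      then show "distr ?Y borel (\<lambda>y. case (z, y) of (z, g) \<Rightarrow> case (scatter UNIV z, scatter UNIV g) of (U, V) \<Rightarrow> ?G U V)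
        = distr ?R borel (\<lambda>y. case (z, y) of (z, W) \<Rightarrow> ?L (?gram z) W)"
        unfolding prod.case by (intro quotient_law_given_U q m) blast
    qed
  qed
  also have "\<dots> = distr (wishart CARD('m) (mat 1) \<Otimes>\<^sub>M ?R) borel (\<lambda>(U, W). ?L U W)"
  proof -
    have "snd \<in> (borel :: (real ^ 'q ^ 'q) measure) \<Otimes>\<^sub>M ?R \<rightarrow>\<^sub>M borel"
      using measurable_snd[of borel ?R] measurable_cong_sets[OF refl sets_wishart] by blast
    then have "(\<lambda>(U, W). ?L U W) \<in> borel_measurable (borel \<Otimes>\<^sub>M ?R)"
      unfolding case_prod_beta' by (intro L measurable_fst)
    from distr_pair_distr_left[OF measurable_gram[where 'd = 'm and 'k = 'q] prob_space_wishart this]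
    show ?thesis unfolding wishart_eq_distr_gram by simp
  qed
  finally show ?thesis .
qed

text \<open>The law of a function of two independent matrices depends only on their two laws, which moves
  the problem from the given probability spaces to the product of two Wishart measures.\<close>
lemma distr_independent_with_laws:
  assumes ind: "independent_with_laws N U P V Q"
    and f: "(\<lambda>(u, v). f u v) \<in> borel_measurable (borel :: ((real ^ 'd ^ 'd) \<times> (real ^ 'd ^ 'd)) measure)"
    and PQ: "sets P = sets borel" "sets Q = sets borel"
  shows "(\<lambda>\<omega>. f (U \<omega>) (V \<omega>)) \<in> borel_measurable N"
    and "distr N borel (\<lambda>\<omega>. f (U \<omega>) (V \<omega>)) = distr (P \<Otimes>\<^sub>M Q) borel (\<lambda>(u, v). f u v)"
proof -
  interpret prob_space N using ind by (simp add: independent_with_laws_def)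
  have U: "U \<in> borel_measurable N" and V: "V \<in> borel_measurable N"
    and eq: "P \<Otimes>\<^sub>M Q = distr N (borel \<Otimes>\<^sub>M borel) (\<lambda>\<omega>. (U \<omega>, V \<omega>))"
    using ind unfolding independent_with_laws_def indep_var_distribution_eq by auto
  show "(\<lambda>\<omega>. f (U \<omega>) (V \<omega>)) \<in> borel_measurable N" by (rule measurable_pair_compose[OF f U V])
  have "(\<lambda>(u, v). f u v) \<in> borel_measurable (borel \<Otimes>\<^sub>M borel)" using f by (simp add: borel_prod)
  from distr_distr[OF this measurable_Pair[OF U V]]
  show "distr N borel (\<lambda>\<omega>. f (U \<omega>) (V \<omega>)) = distr (P \<Otimes>\<^sub>M Q) borel (\<lambda>(u, v). f u v)"
    unfolding eq by (simp add: comp_def)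
qed

theorem theorem1:
  fixes M :: "'a measure"
    and A B :: "'a \<Rightarrow> real ^ 'p ^ 'p"
  assumes "CARD('p) > CARD('m)"
    and "CARD('m) \<ge> CARD('q)"
    and "independent_with_laws M
           A (wishart CARD('m) (mat 1)) B (wishart CARD('q) (mat 1))"
  shows
    "(\<forall>(N :: 'b measure) (U :: 'b \<Rightarrow> real ^ 'm ^ 'm) (V :: 'b \<Rightarrow> real ^ 'm ^ 'm).
        independent_with_laws N
          U (wishart CARD('q) (mat 1)) V (wishart CARD('p) (mat 1)) \<longrightarrow>
        eq_in_distribution
          M (\<lambda>\<omega>. largest_finite_root TYPE('m) (B \<omega>) (A \<omega>))
          N (\<lambda>\<omega>. largest_nonzero_eigenvalue (U \<omega> ** matrix_inv (V \<omega>)))) \<and>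
     (\<forall>(N :: 'c measure) (U :: 'c \<Rightarrow> real ^ 'q ^ 'q) (V :: 'c \<Rightarrow> real ^ 'q ^ 'q).
        independent_with_laws N
          U (wishart CARD('m) (mat 1))
          V (wishart (CARD('p) - CARD('m) + CARD('q)) (mat 1)) \<longrightarrow>
        eq_in_distribution
          M (\<lambda>\<omega>. largest_finite_root TYPE('m) (B \<omega>) (A \<omega>))
          N (\<lambda>\<omega>. lambda_max (U \<omega> ** matrix_inv (V \<omega>))))"
proof -
  have le: "CARD('m) \<le> CARD('p)" using assms(1) by simp
  have "(\<lambda>(A, B). largest_finite_root TYPE('m) B A) \<in>
    borel_measurable (borel :: ((real ^ 'p ^ 'p) \<times> (real ^ 'p ^ 'p)) measure)"
    unfolding case_prod_beta'
    by (intro measurable_pair_compose[OF borel_largest_finite_root] borel_measurable_continuous_onI continuous_intros)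
  note root = distr_independent_with_laws[OF assms(3) this sets_wishart sets_wishart]
  note quotient = distr_independent_with_laws[OF _ borel_largest_nonzero_eigenvalue_quotient
      sets_wishart sets_wishart]
  note max_quotient = distr_independent_with_laws[OF _ borel_lambda_max_quotient
      sets_wishart sets_wishart]
  note law = largest_finite_root_law[OF le, where 'q = 'q]
  show ?thesis
    unfolding eq_in_distribution_def
  proof (intro conjI allI impI)
    fix N :: "'b measure" and U V :: "'b \<Rightarrow> real ^ 'm ^ 'm"
    assume N: "independent_with_laws N U (wishart CARD('q) (mat 1)) V (wishart CARD('p) (mat 1))"
    show "(\<lambda>\<omega>. largest_nonzero_eigenvalue (U \<omega> ** matrix_inv (V \<omega>))) \<in> borel_measurable N"
      by (rule quotient(1)[OF N])
    show "distr M borel (\<lambda>\<omega>. largest_finite_root TYPE('m) (B \<omega>) (A \<omega>)) =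
      distr N borel (\<lambda>\<omega>. largest_nonzero_eigenvalue (U \<omega> ** matrix_inv (V \<omega>)))"
      unfolding root(2) quotient(2)[OF N] by (rule law)
  next
    fix N :: "'c measure" and U V :: "'c \<Rightarrow> real ^ 'q ^ 'q"
    assume N: "independent_with_laws N U (wishart CARD('m) (mat 1))
      V (wishart (CARD('p) - CARD('m) + CARD('q)) (mat 1))"
    show "(\<lambda>\<omega>. lambda_max (U \<omega> ** matrix_inv (V \<omega>))) \<in> borel_measurable N"
      by (rule max_quotient(1)[OF N])
    show "distr M borel (\<lambda>\<omega>. largest_finite_root TYPE('m) (B \<omega>) (A \<omega>)) =
      distr N borel (\<lambda>\<omega>. lambda_max (U \<omega> ** matrix_inv (V \<omega>)))"
      unfolding root(2) max_quotient(2)[OF N] law by (rule quotient_law[OF assms(2) le])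
  qed (rule root(1))+
qed

end
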